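(* Let $d\ge1$, $\sigma\in(-d,0)$, and let $C^*=C^*(\sigma,d)>0$ be a constant with the following compactness property: for every $g\in C^0(\mathbb{R}^d)$ satisfying $g(x)\ge C_1+C_2|x|^{-\sigma}$ for all $x$, for some $C_1\in\mathbb{R}$ and $C_2>C^*$, every family $\{\mu_\varepsilon\}_{\varepsilon\in(0,1)}\subset\mathcal{M}_b(\mathbb{R}^d)$ with $\sup_\varepsilon\mathcal{T}^\sigma_\varepsilon(\mu_\varepsilon)<+\infty$ satisfies, up to a subsequence, $\frac{\varepsilon^d\omega_d}{C^d}\mu_\varepsilon\to\rho\,\mathcal{L}^d$ tightly for some $\rho\in L^1(\mathbb{R}^d,[0,1])$. Let $g\in C^0(\mathbb{R}^d)$ satisfy $g(x)\ge C_1+C_2|x|^{-\sigma}$ for all $x\in\mathbb{R}^d$, for some $C_1\in\mathbb{R}$ and $C_2>C^*$, and for every $\varepsilon\in(0,1)$ let $\mu_\varepsilon$ be a minimizer of $\mathcal{T}^\sigma_\varepsilon$. Then, up to a subsequence, $\frac{\varepsilon^d\omega_d}{C^d}\mu_\varepsilon\to\chi_E\mathcal{L}^d$ tightly in $\mathcal{M}_b(\mathbb{R}^d)$ for some measurable set $E\subset\mathbb{R}^d$ of finite Lebesgue measure. Moreover, $\chi_E\mathcal{L}^d$ is a minimizer of $\mathcal{T}^\sigma$. Finally, if $g(x)=G(|x|)$ for some increasing function $G:\mathbb{R}^+\to\mathbb{R}$, then $E$ is a ball (up to a Lebesgue null set, the empty set being regarded as a degenerate ball).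
   Context: $\mathcal{L}^d$ (also $|\cdot|$ on sets) is Lebesgue measure on $\mathbb{R}^d$, $\omega_d$ is the Lebesgue measure of the unit ball, $\mathcal{M}_b(\mathbb{R}^d)$ is the set of nonnegative finite Radon measures on $\mathbb{R}^d$, and $L^1(\mathbb{R}^d,[0,1])$ is the set of integrable functions with values in $[0,1]$. Optimal packing density: let $\mathrm{Ad}^d$ be the class of sets $X\subset\mathbb{R}^d$ with $|x-y|\ge2$ for all distinct $x,y\in X$, and let $Q=[0,1)^d$. Then $$C^d:=\sup_{X\in\mathrm{Ad}^d}\limsup_{r\to+\infty}\frac{\#(X\cap rQ)\,\omega_d}{|rQ|}.$$ Tight convergence $\nu_\varepsilon\to\nu$ in $\mathcal{M}_b(\mathbb{R}^d)$ means $\nu_\varepsilon\stackrel{*}{\rightharpoonup}\nu$ weakly-star and $\nu_\varepsilon(\mathbb{R}^d)\to\nu(\mathbb{R}^d)$ as $\varepsilon\to0^+$. "Up to a subsequence" means along some sequence $\varepsilon_n\to0^+$. For $\varepsilon>0$, $\mathcal{EM}_\varepsilon$ is the set of measures $\sum_{i=1}^N\delta_{x_i}$ ($N\in\mathbb{N}$, possibly $N=0$) with $|x_i-x_j|\ge2\varepsilon$ for all $i\ne j$. Discrete energies on $\mathcal{M}_b(\mathbb{R}^d)$: $$\mathcal{F}^\sigma_\varepsilon(\mu)=\sum_{i\ne j}-\frac{1}{|x_i-x_j|^{d+\sigma}}\Big(\frac{\omega_d\varepsilon^d}{C^d}\Big)^2\quad\text{if }\mu=\sum_{i=1}^N\delta_{x_i}\in\mathcal{EM}_\varepsilon,\qquad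 \mathcal{F}^\sigma_\varepsilon(\mu)=+\infty\text{ otherwise},$$ $$\mathcal{T}^\sigma_\varepsilon(\mu)=\mathcal{F}^\sigma_\varepsilon(\mu)+\int_{\mathbb{R}^d}g(x)\,\frac{\varepsilon^d\omega_d}{C^d}\,d\mu(x).$$ Limit energy on $\mathcal{M}_b(\mathbb{R}^d)$: $$\mathcal{T}^\sigma(\mu)=\int_{\mathbb{R}^d}\int_{\mathbb{R}^d}-\frac{1}{|x-y|^{d+\sigma}}\,d\mu\otimes\mu+\int_{\mathbb{R}^d}g(x)\,d\mu(x)\quad\text{if }\mu\le\mathcal{L}^d,$$ and $\mathcal{T}^\sigma(\mu)=+\infty$ otherwise. Minimizers are meant over $\mathcal{M}_b(\mathbb{R}^d)$. *)

theory Defs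
  imports "HOL-Analysis.Analysis"
begin

text \<open>The space of dimension d is an arbitrary type of class \<^class>\<open>euclidean_space\<close>, with
  d rendered as DIM('a).\<close>

definition ball_vol :: "'a::euclidean_space itself \<Rightarrow> real" where
  "ball_vol _ = measure lborel (ball (0::'a) 1)"

definition separated :: "real \<Rightarrow> 'a::euclidean_space set \<Rightarrow> bool" where
  "separated s X \<longleftrightarrow> (\<forall>x\<in>X. \<forall>y\<in>X. x \<noteq> y \<longrightarrow> s \<le> dist x y)"

definition unit_cube :: "'a::euclidean_space set" where
  "unit_cube = {x. \<forall>b\<in>Basis. 0 \<le> x \<bullet> b \<and> x \<bullet> b < 1}"

text \<open>The supremum is taken in \<^typ>\<open>ereal\<close>; by volume comparison it is finite, so converting it
  to a real number loses nothing. The sets counted by \<^const>\<open>card\<close> are finite, see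
  \<open>finite_separated_bounded\<close> below.\<close>

definition packing_density :: "'a::euclidean_space itself \<Rightarrow> real" where
  "packing_density _ = real_of_ereal
     (SUP X \<in> {X :: 'a set. separated 2 X}.
        Limsup at_top (\<lambda>r::real.
          ereal (real (card (X \<inter> (*\<^sub>R) r ` unit_cube)) * ball_vol TYPE('a)
                 / measure lborel ((*\<^sub>R) r ` (unit_cube :: 'a set)))))"

lemma finite_separated_bounded:
  fixes X B :: "'a::euclidean_space set"
  assumes "separated s X" "s > 0" "bounded B"
  shows "finite (X \<inter> B)"
proof (rule ccontr)
  assume inf: "infinite (X \<inter> B)"
  have "compact (closure B)"
    using assms(3) by (simp add: compact_closure)
  moreover have "X \<inter> B \<subseteq> closure B"
    using closure_subset by blast
  ultimately obtain l where l: "l islimpt (X \<inter> B)"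
    using inf Heine_Borel_imp_Bolzano_Weierstrass by blast
  have "infinite ((X \<inter> B) \<inter> ball l (s/2))"
    using l assms(2) by (simp add: islimpt_eq_infinite_ball)
  then obtain x y where xy: "x \<in> (X \<inter> B) \<inter> ball l (s/2)" "y \<in> (X \<inter> B) \<inter> ball l (s/2)" "x \<noteq> y"
    by (metis (no_types, lifting) finite.simps finite_subset insertI1 subsetI)
  have "dist x y \<le> dist x l + dist l y"
    by (rule dist_triangle)
  moreover have "dist x l < s/2" "dist l y < s/2"
    using xy by (simp_all add: dist_commute)
  moreover have "s \<le> dist x y"
    using xy assms(1) by (auto simp: separated_def)
  ultimately show False
    by linarith
qed

text \<open>Every finite Borel measure on a Euclidean space is Radon.\<close>

definition finite_borel_measures :: "'a::euclidean_space measure set" where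
  "finite_borel_measures = {\<mu>. sets \<mu> = sets borel \<and> finite_measure \<mu>}"

text \<open>Weak-star convergence is in duality with the continuous functions vanishing at infinity.\<close>

definition tightly_converges ::
  "(nat \<Rightarrow> 'a::euclidean_space measure) \<Rightarrow> 'a measure \<Rightarrow> bool" where
  "tightly_converges \<nu> \<nu>' \<longleftrightarrow>
     (\<forall>f :: 'a \<Rightarrow> real. continuous_on UNIV f \<longrightarrow> (f \<longlongrightarrow> 0) at_infinity \<longrightarrow>
        (\<lambda>n. \<integral>x. f x \<partial>\<nu> n) \<longlonglongrightarrow> (\<integral>x. f x \<partial>\<nu>')) \<and>
     (\<lambda>n. measure (\<nu> n) UNIV) \<longlonglongrightarrow> measure \<nu>' UNIV"

text \<open>Convergence up to a subsequence as \<open>\<epsilon> \<rightarrow> 0\<close> of a family indexed by \<open>\<epsilon> \<in> (0,1)\<close>.\<close>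

definition subseq_tightly_converges ::
  "(real \<Rightarrow> 'a::euclidean_space measure) \<Rightarrow> 'a measure \<Rightarrow> bool" where
  "subseq_tightly_converges \<nu> \<nu>' \<longleftrightarrow>
     (\<exists>e :: nat \<Rightarrow> real. (\<forall>n. e n \<in> {0<..<1}) \<and> e \<longlonglongrightarrow> 0 \<and>
        tightly_converges (\<lambda>n. \<nu> (e n)) \<nu>')"

text \<open>Integral of a real function with values in the extended reals. It is only used where at
  most one of the two parts is infinite.\<close>

definition ext_integral :: "'b measure \<Rightarrow> ('b \<Rightarrow> real) \<Rightarrow> ereal" where
  "ext_integral M f =
     enn2ereal (\<integral>\<^sup>+x. ennreal (f x) \<partial>M) - enn2ereal (\<integral>\<^sup>+x. ennreal (- f x) \<partial>M)"

text \<open>The sum of the Dirac masses at \<open>x 0, \<dots>, x (N - 1)\<close>, as image of the counting measure.\<close>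

definition dirac_sum :: "nat \<Rightarrow> (nat \<Rightarrow> 'a::euclidean_space) \<Rightarrow> 'a measure" where
  "dirac_sum N x = distr (count_space {..<N}) borel x"

lemma emeasure_dirac_sum:
  assumes "A \<in> sets borel"
  shows "emeasure (dirac_sum N x) A = (\<Sum>i<N. indicator A (x i))"
proof -
  have "emeasure (dirac_sum N x) A = emeasure (count_space {..<N}) (x -` A \<inter> {..<N})"
    unfolding dirac_sum_def using assms by (subst emeasure_distr) auto
  also have "\<dots> = of_nat (card (x -` A \<inter> {..<N}))"
    by (simp add: emeasure_count_space_finite)
  also have "\<dots> = (\<Sum>i \<in> x -` A \<inter> {..<N}. 1)"
    by simp
  also have "\<dots> = (\<Sum>i<N. indicator A (x i))"
    by (intro sum.mono_neutral_cong_left) (auto simp: indicator_def)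
  finally show ?thesis .
qed

definition empirical_measures :: "real \<Rightarrow> 'a::euclidean_space measure set" where
  "empirical_measures \<epsilon> =
     {dirac_sum N x | N x. \<forall>i<N. \<forall>j<N. i \<noteq> j \<longrightarrow> 2 * \<epsilon> \<le> dist (x i) (x j)}"

definition atoms :: "'a::euclidean_space measure \<Rightarrow> 'a set" where
  "atoms \<mu> = {x. emeasure \<mu> {x} \<noteq> 0}"

lemma atoms_dirac_sum: "atoms (dirac_sum N x) = x ` {..<N}"
  by (auto simp: atoms_def emeasure_dirac_sum indicator_def)

definition particle_mass :: "'a::euclidean_space itself \<Rightarrow> real \<Rightarrow> real" where
  "particle_mass T \<epsilon> = \<epsilon> ^ DIM('a) * ball_vol T / packing_density T"

definition rescaled :: "real \<Rightarrow> 'a::euclidean_space measure \<Rightarrow> 'a measure" where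
  "rescaled \<epsilon> \<mu> = scale_measure (ennreal (particle_mass TYPE('a) \<epsilon>)) \<mu>"

definition riesz_kernel :: "real \<Rightarrow> 'a::euclidean_space \<Rightarrow> 'a \<Rightarrow> real" where
  "riesz_kernel \<sigma> x y = - (1 / norm (x - y) powr (real DIM('a) + \<sigma>))"

text \<open>For an empirical measure the points are distinct, so the sum over pairs of indices
  is the sum over pairs of distinct atoms; see \<open>discrete_F_dirac_sum\<close>. This makes the energy a
  function of the measure alone.\<close>

definition discrete_F :: "real \<Rightarrow> real \<Rightarrow> 'a::euclidean_space measure \<Rightarrow> ereal" where
  "discrete_F \<sigma> \<epsilon> \<mu> =
     (if \<mu> \<in> empirical_measures \<epsilon>
      then ereal (\<Sum>(x, y) \<in> {(x, y). x \<in> atoms \<mu> \<and> y \<in> atoms \<mu> \<and> x \<noteq> y}.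
                    riesz_kernel \<sigma> x y * (particle_mass TYPE('a) \<epsilon>)\<^sup>2)
      else \<infinity>)"

lemma discrete_F_dirac_sum:
  fixes x :: "nat \<Rightarrow> 'a::euclidean_space"
  assumes sep: "\<And>i j. i < N \<Longrightarrow> j < N \<Longrightarrow> i \<noteq> j \<Longrightarrow> 2 * \<epsilon> \<le> dist (x i) (x j)" and "\<epsilon> > 0"
  shows "discrete_F \<sigma> \<epsilon> (dirac_sum N x) =
    ereal (\<Sum>(i, j) \<in> {(i, j). i < N \<and> j < N \<and> i \<noteq> j}.
             - (1 / norm (x i - x j) powr (real DIM('a) + \<sigma>)) *
             (ball_vol TYPE('a) * \<epsilon> ^ DIM('a) / packing_density TYPE('a))\<^sup>2)"
proof -
  have inj: "x i = x j \<longleftrightarrow> i = j" if "i < N" "j < N" for i j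
    using sep[OF that] \<open>\<epsilon> > 0\<close> by force
  have "dirac_sum N x \<in> empirical_measures \<epsilon>"
    using sep by (auto simp: empirical_measures_def)
  moreover have "(\<Sum>(x, y) \<in> {(y, z). y \<in> x ` {..<N} \<and> z \<in> x ` {..<N} \<and> y \<noteq> z}.
      riesz_kernel \<sigma> x y * (particle_mass TYPE('a) \<epsilon>)\<^sup>2) =
    (\<Sum>(i, j) \<in> {(i, j). i < N \<and> j < N \<and> i \<noteq> j}.
      riesz_kernel \<sigma> (x i) (x j) * (particle_mass TYPE('a) \<epsilon>)\<^sup>2)"
    by (rule sum.reindex_cong[where l = "map_prod x x"])
       (auto simp: inj_on_def inj image_def map_prod_def split_beta)
  ultimately show ?thesis
    by (simp add: discrete_F_def atoms_dirac_sum riesz_kernel_def particle_mass_def mult.commute)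
qed

definition discrete_T ::
  "real \<Rightarrow> ('a::euclidean_space \<Rightarrow> real) \<Rightarrow> real \<Rightarrow> 'a measure \<Rightarrow> ereal" where
  "discrete_T \<sigma> g \<epsilon> \<mu> =
     discrete_F \<sigma> \<epsilon> \<mu> + ext_integral \<mu> (\<lambda>x. g x * particle_mass TYPE('a) \<epsilon>)"

definition limit_T ::
  "real \<Rightarrow> ('a::euclidean_space \<Rightarrow> real) \<Rightarrow> 'a measure \<Rightarrow> ereal" where
  "limit_T \<sigma> g \<mu> =
     (if \<forall>A\<in>sets borel. emeasure \<mu> A \<le> emeasure lborel A
      then ext_integral (\<mu> \<Otimes>\<^sub>M \<mu>) (\<lambda>(x, y). riesz_kernel \<sigma> x y) + ext_integral \<mu> g
      else \<infinity>)"

definition is_minimizer ::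
  "('a::euclidean_space measure \<Rightarrow> ereal) \<Rightarrow> 'a measure \<Rightarrow> bool" where
  "is_minimizer F \<mu> \<longleftrightarrow>
     \<mu> \<in> finite_borel_measures \<and> (\<forall>\<nu>\<in>finite_borel_measures. F \<mu> \<le> F \<nu>)"

definition confining :: "real \<Rightarrow> real \<Rightarrow> ('a::euclidean_space \<Rightarrow> real) \<Rightarrow> bool" where
  "confining \<sigma> C g \<longleftrightarrow> continuous_on UNIV g \<and>
     (\<exists>C1 C2. C2 > C \<and> (\<forall>x. g x \<ge> C1 + C2 * norm x powr (- \<sigma>)))"

definition compactness_constant :: "'a::euclidean_space itself \<Rightarrow> real \<Rightarrow> real \<Rightarrow> bool" where
  "compactness_constant _ \<sigma> C \<longleftrightarrow> C > 0 \<and>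
     (\<forall>(g :: 'a \<Rightarrow> real) \<mu>.
        confining \<sigma> C g \<longrightarrow>
        (\<forall>\<epsilon>\<in>{0<..<1}. \<mu> \<epsilon> \<in> finite_borel_measures) \<longrightarrow>
        (SUP \<epsilon>\<in>{0<..<1}. discrete_T \<sigma> g \<epsilon> (\<mu> \<epsilon>)) < \<infinity> \<longrightarrow>
        (\<exists>\<rho> :: 'a \<Rightarrow> real. integrable lborel \<rho> \<and> (\<forall>x. \<rho> x \<in> {0..1}) \<and>
           subseq_tightly_converges (\<lambda>\<epsilon>. rescaled \<epsilon> (\<mu> \<epsilon>))
             (density lborel (\<lambda>x. ennreal (\<rho> x)))))"

end

theory Submission
  imports Defs
begin

text \<open>The compactness property yields a tight limit \<open>\<rho>\<close> of the rescaled minimizers. Small-scale interactions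
  are uniformly negligible, by separation of the particles on the discrete side and by \<open>\<rho> \<le> 1\<close> on the
  limit side, so the interaction energies converge along the sequence; together with recovery sequences built
  from nearly optimal packings this makes \<open>\<rho>\<close> a minimizer of the limit energy. That energy is strictly
  concave along perturbations by multiples of an indicator function, so its first-order conditions are
  strict: with \<open>v = g - 2 U\<close>, where \<open>U\<close> is the Riesz potential of \<open>\<rho>\<close>, one has \<open>\<rho> = 1\<close> a.e. on
  \<open>E = {v < 0}\<close>, \<open>\<rho> = 0\<close> a.e. on \<open>{v > 0}\<close>, and \<open>{v = 0}\<close> is a null set.

  If \<open>g\<close> is radial and increasing, polarizing \<open>E\<close> in any hyperplane cannot increase the energy, and lowers it
  strictly unless one of the two one-sided parts of \<open>E\<close> is null. The first moment of \<open>E\<close> tells which one it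
  is: mirror images in a half-space containing the barycentre always stay inside \<open>E\<close>. Applied to bisectors
  this shows that no point of \<open>{v > 0}\<close> is closer to the barycentre than a point of \<open>E\<close>.\<close>

section \<open>The Riesz kernel and isometries\<close>

text \<open>The kernel is singular, while tight convergence only tests bounded continuous functions.
  So the distance is frozen below a radius \<delta>, and the error per unit of mass is at most a
  constant times \<delta> to the power -\<sigma>, the same constant for all \<epsilon>; this is
  where \<sigma> < 0 enters. The kernel is also positive and the interaction attractive, so adding
  or removing mass on one set always has a strictly negative second-order term. This is what
  excludes intermediate densities. The obstacle in the radial case is that \<open>G\<close> is only
  weakly increasing: it may be constant on a large ball, so \<open>E\<close> need not be centred at
  the origin, and reflecting \<open>E\<close> may leave the energy unchanged. Polarization therefore
  ends in an alternative, and the centre has to be read off from \<open>E\<close> itself; hence the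
  barycentre. Finally, \<open>v\<close> is continuous, so \<open>E\<close> and the set where
  \<open>v\<close> is positive are open. This turns the alternative, which speaks of null sets, into
  a statement about individual points.\<close>

definition riesz :: "real \<Rightarrow> 'a::euclidean_space \<Rightarrow> 'a \<Rightarrow> real" where
  "riesz \<alpha> x y = 1 / dist x y powr \<alpha>"

text \<open>Freezing the distance at \<delta> keeps the kernel unchanged from distance \<delta> on
  and makes it bounded and Lipschitz, which is what tight convergence can handle.\<close>

definition riesz_cut :: "real \<Rightarrow> real \<Rightarrow> 'a::euclidean_space \<Rightarrow> 'a \<Rightarrow> real" where
  "riesz_cut \<alpha> \<delta> x y = 1 / max \<delta> (dist x y) powr \<alpha>"

lemma riesz_nonneg [simp]: "0 \<le> riesz \<alpha> x y"
  by (simp add: riesz_def)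

text \<open>Division by zero gives the kernel the value \<open>0\<close> on the diagonal, so that
  double sums over atoms may run over all pairs.\<close>

lemma riesz_self [simp]: "riesz \<alpha> x x = 0"
  by (simp add: riesz_def)

lemma riesz_commute: "riesz \<alpha> x y = riesz \<alpha> y x"
  by (simp add: riesz_def dist_commute)

lemma riesz_measurable [measurable (raw)]:
  assumes "f \<in> borel_measurable M" "h \<in> borel_measurable M"
  shows "(\<lambda>z. riesz \<alpha> (f z) (h z :: 'a::euclidean_space)) \<in> borel_measurable M"
  unfolding riesz_def using assms by measurable

lemma riesz_cut_nonneg [simp]: "0 \<le> riesz_cut \<alpha> \<delta> x y"
  by (simp add: riesz_cut_def)

lemma riesz_cut_measurable [measurable (raw)]:
  assumes "f \<in> borel_measurable M" "h \<in> borel_measurable M"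
  shows "(\<lambda>z. riesz_cut \<alpha> \<delta> (f z) (h z :: 'a::euclidean_space)) \<in> borel_measurable M"
  unfolding riesz_cut_def using assms by measurable

text \<open>Sum of the geometric series with first term \<open>2 powr \<alpha>\<close> and ratio
  \<open>2 powr (\<alpha> - n)\<close>: at distance at least half the dyadic radius the kernel costs
  the factor \<open>2 powr \<alpha>\<close>, and each halving of the radius gains
  \<open>2 powr n\<close> in mass and loses \<open>2 powr \<alpha>\<close> in the kernel.\<close>

definition riesz_const :: "real \<Rightarrow> real \<Rightarrow> real" where
  "riesz_const \<alpha> n = 2 powr \<alpha> / (1 - 2 powr (\<alpha> - n))"

lemma riesz_const_nonneg: "\<alpha> < n \<Longrightarrow> 0 \<le> riesz_const \<alpha> n"
  using powr_mono[of "\<alpha> - n" 0 2] by (simp add: riesz_const_def)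

text \<open>The kernel is dominated by a geometric sum over dyadic balls.\<close>

lemma nn_integral_riesz_ball:
  fixes M :: "'a::euclidean_space measure" and \<alpha> :: real
  assumes M: "sets M = sets borel" and \<alpha>: "0 < \<alpha>" "\<alpha> < real DIM('a)" and "\<delta> > 0" "A \<ge> 0"
    and growth: "\<And>r. 0 < r \<Longrightarrow> r \<le> \<delta> \<Longrightarrow> emeasure M (ball x r) \<le> ennreal (A * r ^ DIM('a))"
  shows "(\<integral>\<^sup>+y. ennreal (riesz \<alpha> x y) * indicator (ball x \<delta>) y \<partial>M)
     \<le> ennreal (A * riesz_const \<alpha> DIM('a) * \<delta> powr (DIM('a) - \<alpha>))"
proof -
  define d where "d = real DIM('a)"
  define c where "c k = (\<delta> / 2 ^ Suc k) powr (- \<alpha>)" for k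
  have q: "2 powr (\<alpha> - d) < 1"
    using \<alpha> powr_less_mono[of "\<alpha> - d" 0 2] by (simp add: d_def)
  have c: "c k \<ge> 0" for k by (simp add: c_def)
  have pw: "ennreal (riesz \<alpha> x y) * indicator (ball x \<delta>) y
     \<le> (\<Sum>k. ennreal (c k) * indicator (ball x (\<delta> / 2 ^ k)) y)" for y
  proof (cases "y \<in> ball x \<delta> \<and> x \<noteq> y")
    case True
    then have pos: "dist x y > 0" "dist x y < \<delta>" by auto
    have "\<exists>n. \<delta> / 2 ^ n < dist x y"
      using real_arch_pow_inv[of "dist x y / \<delta>" "1/2"] pos \<open>\<delta> > 0\<close>
      by (auto simp: field_simps)
    then obtain n :: nat where n: "\<delta> / 2 ^ n \<le> dist x y" by (meson less_imp_le)
    \<comment> \<open>The least such \<open>m\<close> puts \<open>y\<close> in a dyadic shell: at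
      distance at least \<open>\<delta> / 2 ^ m\<close> but inside the ball of twice that radius. It
      is positive because \<open>y\<close> lies in the open ball of radius \<delta>.\<close>
    define m where "m = (LEAST n. \<delta> / 2 ^ n \<le> dist x y)"
    have m: "\<delta> / 2 ^ m \<le> dist x y" unfolding m_def by (rule LeastI, rule n)
    have "m \<noteq> 0" using m pos by (intro notI) auto
    then obtain k where k: "m = Suc k" by (cases m) auto
    have "\<not> \<delta> / 2 ^ k \<le> dist x y" using not_less_Least[of k "\<lambda>n. \<delta> / 2 ^ n \<le> dist x y"] k
      unfolding m_def by auto
    then have yk: "y \<in> ball x (\<delta> / 2 ^ k)" by auto
    have le: "1 / u powr \<alpha> \<le> 1 / t powr \<alpha>" if "0 < t" "t \<le> u" for t u :: real
      using that \<alpha> by (intro divide_left_mono powr_mono2) auto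
    have "riesz \<alpha> x y \<le> c k"
      unfolding riesz_def c_def powr_minus_divide
      by (rule le) (use m k \<open>\<delta> > 0\<close> in auto)
    then have "ennreal (riesz \<alpha> x y) * indicator (ball x \<delta>) y \<le> ennreal (c k) * indicator (ball x (\<delta> / 2 ^ k)) y"
      using yk True by (auto intro!: ennreal_leI)
    also have "\<dots> = (\<Sum>i\<in>{k}. ennreal (c i) * indicator (ball x (\<delta> / 2 ^ i)) y)"
      by (subst sum.insert) simp_all
    also have "\<dots> \<le> (\<Sum>k. ennreal (c k) * indicator (ball x (\<delta> / 2 ^ k)) y)"
      by (rule sum_le_suminf) auto
    finally show ?thesis .
  qed auto
  have "(\<integral>\<^sup>+y. ennreal (riesz \<alpha> x y) * indicator (ball x \<delta>) y \<partial>M)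
     \<le> (\<integral>\<^sup>+y. (\<Sum>k. ennreal (c k) * indicator (ball x (\<delta> / 2 ^ k)) y) \<partial>M)"
    by (intro nn_integral_mono pw)
  also have "\<dots> = (\<Sum>k. ennreal (c k) * emeasure M (ball x (\<delta> / 2 ^ k)))"
    by (subst nn_integral_suminf)
      (auto intro!: borel_measurable_times_ennreal borel_measurable_indicator simp: M measurable_cong_sets[OF M refl] nn_integral_cmult_indicator)
  also have "\<dots> \<le> (\<Sum>k. ennreal (c k) * ennreal (A * (\<delta> / 2 ^ k) ^ DIM('a)))"
    using \<open>\<delta> > 0\<close> by (intro suminf_le mult_left_mono growth) (auto simp: field_simps)
  also have "\<dots> = (\<Sum>k. ennreal (A * 2 powr \<alpha> * \<delta> powr (d - \<alpha>) * (2 powr (\<alpha> - d)) ^ k))"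
  proof (intro suminf_cong)
    fix k
    have 1: "c k = 2 powr \<alpha> * (2 powr \<alpha>) ^ k * \<delta> powr (-\<alpha>)"
      unfolding c_def using \<open>\<delta> > 0\<close>
      by (simp add: powr_divide powr_minus powr_mult powr_power field_simps powr_powr flip: powr_realpow)
    have 2: "(\<delta> / 2 ^ k) ^ DIM('a) = \<delta> powr d * (2 powr (- d)) ^ k"
      unfolding d_def using \<open>\<delta> > 0\<close>
      by (simp add: power_divide powr_realpow powr_minus field_simps power_mult[symmetric] mult.commute)
    have 3: "\<delta> powr (d - \<alpha>) = \<delta> powr d * \<delta> powr (-\<alpha>)"
      by (simp add: powr_add[symmetric])
    have 4: "(2::real) powr (\<alpha> - d) = 2 powr \<alpha> * 2 powr (-d)"
      by (simp add: powr_add[symmetric])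
    show "ennreal (c k) * ennreal (A * (\<delta> / 2 ^ k) ^ DIM('a))
      = ennreal (A * 2 powr \<alpha> * \<delta> powr (d - \<alpha>) * (2 powr (\<alpha> - d)) ^ k)"
      unfolding 2 by (simp add: c \<open>A \<ge> 0\<close> flip: ennreal_mult' del: powr_mult)
        (simp add: 1 3 4 power_mult_distrib mult_ac)
  qed
  also have "\<dots> = ennreal (\<Sum>k. A * 2 powr \<alpha> * \<delta> powr (d - \<alpha>) * (2 powr (\<alpha> - d)) ^ k)"
    using q \<open>A \<ge> 0\<close> by (intro suminf_ennreal2) (auto intro!: summable_mult summable_geometric simp: d_def)
  also have "(\<Sum>k. A * 2 powr \<alpha> * \<delta> powr (d - \<alpha>) * (2 powr (\<alpha> - d)) ^ k)
     = A * riesz_const \<alpha> DIM('a) * \<delta> powr (DIM('a) - \<alpha>)"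
    using q by (subst suminf_mult) (auto intro!: summable_geometric simp: d_def suminf_geometric riesz_const_def)
  finally show ?thesis .
qed

text \<open>Haar uniqueness: comparing with the unit ball by Fubini, an isometric image of Lebesgue
  measure, being translation invariant, is Lebesgue measure.\<close>

lemma distr_lborel_linear_isometry:
  fixes f :: "'a::euclidean_space \<Rightarrow> 'a"
  assumes lin: "linear f" and iso: "\<And>x. norm (f x) = norm x"
  shows "distr lborel borel f = lborel"
proof -
  define N where "N = distr lborel borel f"
  have f [measurable]: "f \<in> borel_measurable borel"
    using lin by (simp add: borel_measurable_continuous_onI linear_continuous_on linear_conv_bounded_linear)
  have sN [measurable_cong, simp]: "sets N = sets borel" by (simp add: N_def)
  have ball: "f -` ball 0 1 = ball 0 1"
    using iso by auto
  interpret N: sigma_finite_measure N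
  proof
    show "\<exists>A. countable A \<and> A \<subseteq> sets N \<and> \<Union> A = space N \<and> (\<forall>a\<in>A. emeasure N a \<noteq> \<infinity>)"
    proof (intro exI[of _ "range (\<lambda>n. ball 0 (real n))"] conjI ballI)
      have "f -` ball 0 r = ball 0 r" for r using iso by auto
      then show "emeasure N a \<noteq> \<infinity>" if "a \<in> range (\<lambda>n. ball 0 (real n))" for a
        using that by (auto simp: N_def emeasure_distr emeasure_ball)
      show "\<Union> (range (\<lambda>n. ball 0 (real n))) = space N"
        by (auto simp: N_def reals_Archimedean2)
    qed auto
  qed
  interpret pair_sigma_finite N lborel ..
  have inv: "(\<integral>\<^sup>+x. h (x - y) \<partial>N) = (\<integral>\<^sup>+x. h x \<partial>N)" if [measurable]: "h \<in> borel_measurable borel" for h y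
  proof -
    \<comment> \<open>An injective linear map of a finite-dimensional space is onto, so translating
      the image by \<open>y\<close> amounts to translating the source by a preimage
      \<open>w\<close>.\<close>
    obtain w where w: "f w = y"
      by (metis inj_on_def iso lin linear_injective_imp_surjective linear_injective_0 norm_eq_zero surjD)
    have "(\<integral>\<^sup>+x. h (x - y) \<partial>N) = (\<integral>\<^sup>+x. h (f x - y) \<partial>lborel)"
      by (simp add: N_def nn_integral_distr)
    also have "\<dots> = (\<integral>\<^sup>+x. h (f x - y) \<partial>distr lborel borel ((+) w))"
      by (simp add: lborel_distr_plus)
    also have "\<dots> = (\<integral>\<^sup>+x. h (f (w + x) - y) \<partial>lborel)"
      by (subst nn_integral_distr) auto
    also have "\<dots> = (\<integral>\<^sup>+x. h x \<partial>N)"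
      using w by (simp add: N_def nn_integral_distr linear_add[OF lin])
    finally show ?thesis .
  qed
  have "emeasure N A = emeasure lborel A" if A [measurable]: "A \<in> sets borel" for A
  proof -
    let ?B = "ball (0::'a) 1"
    define h :: "'a \<Rightarrow> ennreal" where "h = indicator ?B"
    have h [measurable]: "h \<in> borel_measurable borel" unfolding h_def by (rule borel_measurable_indicator) simp
    \<comment> \<open>Both this product and \<open>emeasure lborel A * emeasure N ?B\<close> are the
      double integral of \<open>indicator A x * h (x - y)\<close>; then \<open>N\<close> and
      Lebesgue measure agree on the unit ball, which \<open>f\<close> preserves.\<close>
    have "emeasure N A * emeasure lborel ?B = (\<integral>\<^sup>+x. indicator A x * emeasure lborel ?B \<partial>N)"
      by (simp add: nn_integral_multc)
    also have "\<dots> = (\<integral>\<^sup>+x. \<integral>\<^sup>+y. indicator A x * h (x - y) \<partial>lborel \<partial>N)"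
    proof (intro nn_integral_cong)
      fix x
      have "(\<integral>\<^sup>+y. h (x - y) \<partial>lborel) = (\<integral>\<^sup>+y. indicator (ball x 1) y \<partial>lborel)"
        by (intro nn_integral_cong) (auto simp: h_def indicator_def dist_norm norm_minus_commute)
      also have "\<dots> = emeasure lborel (ball x 1)" by simp
      also have "\<dots> = emeasure lborel ?B" by (simp add: emeasure_ball)
      finally have E: "(\<integral>\<^sup>+y. h (x - y) \<partial>lborel) = emeasure lborel ?B" .
      have "(\<integral>\<^sup>+y. indicator A x * h (x - y) \<partial>lborel) = indicator A x * (\<integral>\<^sup>+y. h (x - y) \<partial>lborel)"
        by (rule nn_integral_cmult) measurable
      then show "indicator A x * emeasure lborel ?B = (\<integral>\<^sup>+y. indicator A x * h (x - y) \<partial>lborel)"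
        by (simp only: E)
    qed
    also have "\<dots> = (\<integral>\<^sup>+y. \<integral>\<^sup>+x. indicator A x * h (x - y) \<partial>N \<partial>lborel)"
      by (rule Fubini'[symmetric]) measurable
    also have "\<dots> = (\<integral>\<^sup>+y. \<integral>\<^sup>+x. indicator A (x + y) * h x \<partial>N \<partial>lborel)"
    proof (rule nn_integral_cong)
      fix y
      have "(\<integral>\<^sup>+x. indicator A (x - y + y) * h (x - y) \<partial>N) = (\<integral>\<^sup>+x. indicator A (x + y) * h x \<partial>N)"
        by (rule inv[of "\<lambda>x. indicator A (x + y) * h x" y]) measurable
      then show "(\<integral>\<^sup>+x. indicator A x * h (x - y) \<partial>N) = (\<integral>\<^sup>+x. indicator A (x + y) * h x \<partial>N)"
        by simp
    qed
    also have "\<dots> = (\<integral>\<^sup>+x. \<integral>\<^sup>+y. indicator A (x + y) * h x \<partial>lborel \<partial>N)"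
      by (rule Fubini') measurable
    also have "\<dots> = (\<integral>\<^sup>+x. emeasure lborel A * h x \<partial>N)"
    proof (intro nn_integral_cong)
      fix x
      have "(\<integral>\<^sup>+y. indicator A (x + y) \<partial>lborel) = (\<integral>\<^sup>+y. indicator A y \<partial>distr lborel borel ((+) x))"
        by (subst nn_integral_distr) auto
      then show "(\<integral>\<^sup>+y. indicator A (x + y) * h x \<partial>lborel) = emeasure lborel A * h x"
        by (subst nn_integral_multc) (auto simp: lborel_distr_plus)
    qed
    also have "\<dots> = emeasure lborel A * emeasure N ?B"
      by (simp add: h_def nn_integral_cmult_indicator)
    also have "emeasure N ?B = emeasure lborel ?B"
      using ball by (simp add: N_def emeasure_distr)
    finally show ?thesis
      by (subst (asm) (1 2) mult.commute)
        (simp add: ennreal_mult_cancel_left emeasure_ball unit_ball_vol_pos less_imp_neq[symmetric])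
  qed
  then show ?thesis
    unfolding N_def[symmetric] by (intro measure_eqI) auto
qed

section \<open>Packings\<close>

lemma ball_vol_pos: "ball_vol TYPE('a::euclidean_space) > 0"
  by (simp add: ball_vol_def content_ball)

lemma measure_ball_eq:
  "r \<ge> 0 \<Longrightarrow> measure lborel (ball (x::'a::euclidean_space) r) = ball_vol TYPE('a) * r ^ DIM('a)"
  by (simp add: ball_vol_def content_ball)

lemma emeasure_ball_eq:
  "r \<ge> 0 \<Longrightarrow> emeasure lborel (ball (x::'a::euclidean_space) r) = ennreal (ball_vol TYPE('a) * r ^ DIM('a))"
  by (simp add: ball_vol_def content_ball emeasure_ball)

text \<open>The open balls of half the separation are disjoint, so their volumes add up inside
  \<open>B\<close>.\<close>

lemma separated_card_le:
  fixes T :: "'a::euclidean_space set"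
  assumes "separated s T" "finite T" "s > 0" "B \<in> sets borel" "emeasure lborel B < \<infinity>"
    and sub: "\<And>x. x \<in> T \<Longrightarrow> ball x (s / 2) \<subseteq> B"
  shows "real (card T) * (ball_vol TYPE('a) * (s / 2) ^ DIM('a)) \<le> measure lborel B"
proof -
  have "ball x (s / 2) \<inter> ball y (s / 2) = {}" if "x \<in> T" "y \<in> T" "x \<noteq> y" for x y
  proof -
    have "s \<le> dist x y" using that assms(1) by (auto simp: separated_def)
    moreover have "dist x y < s" if "dist x z < s / 2" "dist y z < s / 2" for z
      using that dist_triangle_half_r[of z x s y] by (simp add: dist_commute)
    ultimately show ?thesis by (auto simp: not_less[symmetric])
  qed
  then have "disjoint_family_on (\<lambda>x. ball x (s / 2)) T"
    by (auto simp: disjoint_family_on_def)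
  then have "measure lborel (\<Union>x\<in>T. ball x (s / 2)) = (\<Sum>x\<in>T. measure lborel (ball x (s / 2)))"
    using assms by (intro measure_finite_Union) (auto simp: emeasure_ball_eq)
  also have "\<dots> = real (card T) * (ball_vol TYPE('a) * (s / 2) ^ DIM('a))"
    using \<open>s > 0\<close> by (simp add: measure_ball_eq)
  finally have "real (card T) * (ball_vol TYPE('a) * (s / 2) ^ DIM('a)) = measure lborel (\<Union>x\<in>T. ball x (s / 2))"
    by simp
  also have "\<dots> \<le> measure lborel B"
    using assms by (intro measure_mono_fmeasurable) (auto simp: fmeasurable_def)
  finally show ?thesis .
qed

section \<open>Half-open cubes and the grid of side \<open>L\<close>\<close>

definition qcube :: "'a::euclidean_space \<Rightarrow> real \<Rightarrow> 'a set" where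
  "qcube a L = {x. \<forall>b\<in>Basis. a \<bullet> b \<le> x \<bullet> b \<and> x \<bullet> b < a \<bullet> b + L}"

lemma qcube_sets [measurable, simp]: "qcube a L \<in> sets borel"
proof -
  have "qcube a L = (\<Inter>b\<in>Basis. {x. a \<bullet> b \<le> x \<bullet> b} \<inter> {x. x \<bullet> b < a \<bullet> b + L})"
    by (auto simp: qcube_def)
  also have "\<dots> \<in> sets borel"
    by (intro sets.finite_INT) auto
  finally show ?thesis .
qed

lemma emeasure_qcube:
  fixes a :: "'a::euclidean_space"
  assumes "L \<ge> 0"
  shows "emeasure lborel (qcube a L) = ennreal (L ^ DIM('a))"
proof (rule antisym)
  have "emeasure lborel (qcube a L) \<le> emeasure lborel (cbox a (a + L *\<^sub>R One))"
    by (intro emeasure_mono) (auto simp: qcube_def mem_box inner_add_left less_imp_le)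
  also have "\<dots> = ennreal (L ^ DIM('a))"
    using assms by (subst emeasure_lborel_cbox) (auto simp: inner_add_left inner_diff_left)
  finally show "emeasure lborel (qcube a L) \<le> ennreal (L ^ DIM('a))" .
  have "ennreal (L ^ DIM('a)) = emeasure lborel (box a (a + L *\<^sub>R One))"
    using assms by (subst emeasure_lborel_box) (auto simp: inner_add_left inner_diff_left)
  also have "\<dots> \<le> emeasure lborel (qcube a L)"
    by (intro emeasure_mono) (auto simp: qcube_def mem_box inner_add_left less_imp_le)
  finally show "ennreal (L ^ DIM('a)) \<le> emeasure lborel (qcube a L)" .
qed

lemma measure_qcube: "L \<ge> 0 \<Longrightarrow> measure lborel (qcube (a::'a::euclidean_space) L) = L ^ DIM('a)"
  by (simp add: measure_def emeasure_qcube)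

lemma scaled_unit_cube:
  assumes "r > 0"
  shows "(*\<^sub>R) r ` unit_cube = qcube 0 r"
proof -
  have "x \<in> (*\<^sub>R) r ` unit_cube" if "x \<in> qcube 0 r" for x
    using that assms by (intro image_eqI[of _ _ "x /\<^sub>R r"]) (auto simp: qcube_def unit_cube_def field_simps)
  then show ?thesis
    using assms by (auto simp: qcube_def unit_cube_def)
qed

lemma bounded_qcube: "bounded (qcube a L)"
  by (rule bounded_subset[OF bounded_cbox[of a "a + L *\<^sub>R One"]])
     (auto simp: qcube_def mem_box inner_add_left less_imp_le)

text \<open>Rounding down to the lattice of mesh \<open>L\<close>. The grid cells are the fibres of
  this map, so every point lies in exactly one cell.\<close>

definition corner :: "real \<Rightarrow> 'a::euclidean_space \<Rightarrow> 'a" where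
  "corner L x = (\<Sum>b\<in>Basis. (L * of_int \<lfloor>x \<bullet> b / L\<rfloor>) *\<^sub>R b)"

lemma corner_inner: "b \<in> Basis \<Longrightarrow> corner L x \<bullet> b = L * of_int \<lfloor>x \<bullet> b / L\<rfloor>"
  by (simp add: corner_def)

lemma mem_qcube_corner: "L > 0 \<Longrightarrow> x \<in> qcube (corner L x) L"
proof -
  assume "L > 0"
  have "L * of_int \<lfloor>x \<bullet> b / L\<rfloor> \<le> x \<bullet> b \<and> x \<bullet> b < L * of_int \<lfloor>x \<bullet> b / L\<rfloor> + L" for b
    using \<open>L > 0\<close> floor_divide_lower[of L "x \<bullet> b"] floor_divide_upper[of L "x \<bullet> b"]
      by (simp add: algebra_simps)
  then show ?thesis by (simp add: qcube_def corner_inner)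
qed

lemma corner_unique:
  assumes "L > 0" "y \<in> qcube (corner L x) L"
  shows "corner L y = corner L x"
proof (rule euclidean_eqI)
  fix b :: 'a assume b: "b \<in> Basis"
  have "L * of_int \<lfloor>x \<bullet> b / L\<rfloor> \<le> y \<bullet> b" "y \<bullet> b < L * of_int \<lfloor>x \<bullet> b / L\<rfloor> + L"
    using assms b by (auto simp: qcube_def corner_inner)
  then have "\<lfloor>y \<bullet> b / L\<rfloor> = \<lfloor>x \<bullet> b / L\<rfloor>"
    using \<open>L > 0\<close> by (intro floor_unique) (simp_all add: field_simps)
  then show "corner L y \<bullet> b = corner L x \<bullet> b" using b by (simp add: corner_inner)
qed

lemma dist_qcube:
  fixes x :: "'a::euclidean_space"
  assumes "x \<in> qcube a L" "y \<in> qcube a L" shows "dist x y \<le> real DIM('a) * L"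
proof -
  have "norm (x - y) \<le> (\<Sum>b\<in>Basis. \<bar>(x - y) \<bullet> b\<bar>)" by (rule norm_le_l1)
  also have "\<dots> \<le> (\<Sum>b\<in>(Basis::'a set). L)"
    using assms by (intro sum_mono) (fastforce simp: qcube_def inner_diff_left)
  finally show ?thesis by (simp add: dist_norm)
qed

lemma corner_mem: "L > 0 \<Longrightarrow> corner L x \<in> qcube (corner L x) L"
  by (simp add: qcube_def)

text \<open>Distinct multiples of \<open>L\<close> differ by at least \<open>L\<close>. The
  coordinate is kept because points of different cells are later separated by projecting on
  it.\<close>

lemma corner_gap:
  assumes "L > 0" "corner L x \<noteq> corner L (y::'a::euclidean_space)"
  shows "\<exists>b\<in>Basis. L \<le> \<bar>corner L x \<bullet> b - corner L y \<bullet> b\<bar>"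
proof -
  obtain b :: 'a where b: "b \<in> Basis" "corner L x \<bullet> b \<noteq> corner L y \<bullet> b"
    using assms(2) euclidean_eqI by blast
  then have "1 \<le> \<bar>\<lfloor>x \<bullet> b / L\<rfloor> - \<lfloor>y \<bullet> b / L\<rfloor>\<bar>"
    by (auto simp: corner_inner)
  then have "1 \<le> real_of_int \<bar>\<lfloor>x \<bullet> b / L\<rfloor> - \<lfloor>y \<bullet> b / L\<rfloor>\<bar>"
    by linarith
  then have "L * 1 \<le> L * real_of_int \<bar>\<lfloor>x \<bullet> b / L\<rfloor> - \<lfloor>y \<bullet> b / L\<rfloor>\<bar>"
    using \<open>L > 0\<close> by (intro mult_left_mono) auto
  then show ?thesis
    using b \<open>L > 0\<close> by (intro bexI[of _ b]) (simp_all add: corner_inner abs_mult flip: right_diff_distrib)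
qed

lemma separated_corners:
  assumes "L > 0" shows "separated L (range (corner L :: 'a::euclidean_space \<Rightarrow> 'a))"
  unfolding separated_def
proof (safe)
  fix x y :: 'a assume "corner L x \<noteq> corner L y"
  then obtain b :: 'a where "b \<in> Basis" "L \<le> \<bar>corner L x \<bullet> b - corner L y \<bullet> b\<bar>"
    using corner_gap[OF assms] by blast
  then show "L \<le> dist (corner L x) (corner L y)"
    using Basis_le_norm[of b "corner L x - corner L y"] by (simp add: dist_norm inner_diff_left)
qed

lemma finite_corners:
  fixes B :: "'a::euclidean_space set"
  assumes "L > 0" "bounded B"
  shows "finite (corner L ` B)"
proof -
  obtain R where R: "\<And>x. x \<in> B \<Longrightarrow> norm x \<le> R" using assms(2) by (auto simp: bounded_iff)
  have "corner L ` B \<subseteq> range (corner L) \<inter> cball 0 (R + real DIM('a) * L)"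
  proof safe
    fix x assume "x \<in> B"
    have "dist (corner L x) x \<le> real DIM('a) * L"
      by (rule dist_qcube[OF corner_mem[OF assms(1)] mem_qcube_corner[OF assms(1)]])
    then have "norm (corner L x) \<le> norm x + real DIM('a) * L"
      using norm_triangle_ineq2[of "corner L x" x] by (simp add: dist_norm)
    then show "corner L x \<in> cball 0 (R + real DIM('a) * L)" using R[OF \<open>x \<in> B\<close>] by simp
  qed simp
  then show ?thesis
    using finite_separated_bounded[OF separated_corners[OF assms(1)] assms(1) bounded_cball] finite_subset by blast
qed

section \<open>Counting points of packings in large cubes\<close>

lemma card_qcube_upper:
  fixes X :: "'a::euclidean_space set"
  assumes "separated 2 X" "r > 0"
  shows "real (card (X \<inter> qcube 0 r)) * ball_vol TYPE('a) \<le> (r + 2) ^ DIM('a)"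
proof -
  have "ball x 1 \<subseteq> qcube (- One) (r + 2)" if "x \<in> qcube 0 r" for x :: 'a
  proof
    fix y assume "y \<in> ball x 1"
    then have "\<bar>(x - y) \<bullet> b\<bar> < 1" if "b \<in> Basis" for b
      using Basis_le_norm[OF that, of "x - y"] by (simp add: dist_norm)
    moreover have "0 \<le> x \<bullet> b \<and> x \<bullet> b < r" if "b \<in> Basis" for b
      using \<open>x \<in> qcube 0 r\<close> that by (simp add: qcube_def)
    ultimately show "y \<in> qcube (- One) (r + 2)"
      unfolding qcube_def by (fastforce simp: inner_diff_left)
  qed
  then have "real (card (X \<inter> qcube 0 r)) * (ball_vol TYPE('a) * (2 / 2) ^ DIM('a)) \<le> measure lborel (qcube (- One :: 'a) (r + 2))"
    using assms by (intro separated_card_le)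
      (auto simp: separated_def emeasure_qcube intro: finite_separated_bounded bounded_qcube)
  then show ?thesis using assms by (simp add: measure_qcube)
qed

text \<open>The lattice of mesh \<open>2\<close> is an admissible packing, and its cells cover the
  cube. It witnesses that the packing density is positive.\<close>

lemma card_qcube_lower:
  assumes "r > 0"
  shows "r ^ DIM('a) \<le> real (card (range (corner 2 :: 'a::euclidean_space \<Rightarrow> 'a) \<inter> qcube 0 r)) * 2 ^ DIM('a)"
proof -
  let ?T = "range (corner 2 :: 'a \<Rightarrow> 'a) \<inter> qcube 0 r"
  have fin: "finite ?T"
    by (rule finite_separated_bounded[OF separated_corners]) (auto simp: bounded_qcube)
  have "qcube 0 r \<subseteq> (\<Union>x\<in>?T. qcube x 2)"
  proof
    fix x :: 'a assume x: "x \<in> qcube 0 r"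
    \<comment> \<open>Rounding down increases no coordinate and, as the cube starts at the origin,
      keeps every coordinate nonnegative.\<close>
    have "corner 2 x \<in> qcube 0 r"
      using x mem_qcube_corner[of 2 x] by (fastforce simp: qcube_def corner_inner)
    then show "x \<in> (\<Union>x\<in>?T. qcube x 2)"
      using mem_qcube_corner[of 2 x] by auto
  qed
  then have "measure lborel (qcube (0::'a) r) \<le> measure lborel (\<Union>x\<in>?T. qcube x 2)"
    using fin by (intro measure_mono_fmeasurable fmeasurable.finite_UN) (auto simp: fmeasurable_def emeasure_qcube)
  also have "\<dots> \<le> (\<Sum>x\<in>?T. measure lborel (qcube x 2))"
    using fin by (intro measure_UNION_le) auto
  finally show ?thesis using assms by (simp add: measure_qcube)
qed

text \<open>\<open>real_of_ereal\<close> sends infinite values to \<open>0\<close>, so both claims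
  rest on the supremum being finite. The upper bound \<open>3 ^ DIM('a)\<close> comes from
  \<open>r + 2 \<le> 3 * r\<close> for \<open>r \<ge> 1\<close>, the positive lower bound from the
  lattice packing.\<close>

lemma packing_density_properties:
  shows packing_density_pos: "packing_density TYPE('a::euclidean_space) > 0"
    and packing_density_approx: "\<And>\<eta> R. \<eta> < packing_density TYPE('a) \<Longrightarrow>
      \<exists>X :: 'a set. \<exists>r\<ge>R. r > 0 \<and> separated 2 X \<and>
        \<eta> * r ^ DIM('a) < real (card (X \<inter> qcube 0 r)) * ball_vol TYPE('a)"
proof -
  define q where "q = (\<lambda>(X::'a set) (r::real). ereal (real (card (X \<inter> (*\<^sub>R) r ` unit_cube)) * ball_vol TYPE('a)
                 / measure lborel ((*\<^sub>R) r ` (unit_cube :: 'a set))))"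
  define P where "P = (SUP X \<in> {X :: 'a set. separated 2 X}. Limsup at_top (q X))"
  have q: "q X r = ereal (real (card (X \<inter> qcube 0 r)) * ball_vol TYPE('a) / r ^ DIM('a))" if "r > 0" for X r
    using that by (simp add: q_def scaled_unit_cube measure_qcube)
  have up: "Limsup at_top (q X) \<le> ereal (3 ^ DIM('a))" if "separated 2 X" for X
  proof (rule Limsup_bounded)
    have "q X r \<le> ereal (3 ^ DIM('a))" if "r \<ge> 1" for r
    proof -
      have "real (card (X \<inter> qcube 0 r)) * ball_vol TYPE('a) \<le> (r + 2) ^ DIM('a)"
        using that by (intro card_qcube_upper \<open>separated 2 X\<close>) auto
      also have "\<dots> \<le> (3 * r) ^ DIM('a)" using that by (intro power_mono) auto
      finally show ?thesis using that by (simp add: q power_mult_distrib field_simps)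
    qed
    then show "\<forall>\<^sub>F r in at_top. q X r \<le> ereal (3 ^ DIM('a))"
      using eventually_ge_at_top[of 1] by (rule eventually_mono[rotated])
  qed
  have "P \<le> ereal (3 ^ DIM('a))" unfolding P_def using up by (intro SUP_least) auto
  moreover have low: "ereal (ball_vol TYPE('a) / 2 ^ DIM('a)) \<le> P"
  proof -
    let ?X = "range (corner 2 :: 'a \<Rightarrow> 'a)"
    have "ereal (ball_vol TYPE('a) / 2 ^ DIM('a)) \<le> q ?X r" if "r > 0" for r
      using card_qcube_lower[where 'a='a, OF that] that ball_vol_pos[where 'a='a]
      by (simp add: q field_simps mult_left_mono)
    then have "\<forall>\<^sub>F r in at_top. ereal (ball_vol TYPE('a) / 2 ^ DIM('a)) \<le> q ?X r"
      using eventually_gt_at_top[of 0] by (rule eventually_mono[rotated])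
    then have "ereal (ball_vol TYPE('a) / 2 ^ DIM('a)) \<le> Limsup at_top (q ?X)"
      by (rule le_Limsup[rotated]) simp
    also have "\<dots> \<le> P" unfolding P_def using separated_corners[of 2, where 'a='a] by (intro SUP_upper) simp
    finally show ?thesis .
  qed
  moreover have "packing_density TYPE('a) = real_of_ereal P"
    by (simp add: packing_density_def P_def q_def)
  ultimately have PC: "P = ereal (packing_density TYPE('a))"
    by (cases P) auto
  show "packing_density TYPE('a) > 0"
    using low ball_vol_pos[where 'a='a] unfolding PC by (auto intro: less_le_trans[rotated])
  show "\<exists>X :: 'a set. \<exists>r\<ge>R. r > 0 \<and> separated 2 X \<and>
        \<eta> * r ^ DIM('a) < real (card (X \<inter> qcube 0 r)) * ball_vol TYPE('a)"
    if \<eta>: "\<eta> < packing_density TYPE('a)" for \<eta> R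
  proof -
    have "ereal \<eta> < P" using \<eta> PC by simp
    then obtain X where X: "separated 2 X" "ereal \<eta> < Limsup at_top (q X)"
      unfolding P_def less_SUP_iff by auto
    \<comment> \<open>A limsup above \<eta> yields the inequality for arbitrarily large
      \<open>r\<close>, though perhaps not for all large \<open>r\<close>. One \<open>r\<close>
      beyond any given \<open>R\<close> is what the recovery construction asks for.\<close>
    have "\<exists>\<^sub>F r in at_top. ereal \<eta> < q X r"
    proof (rule ccontr)
      assume "\<not> ?thesis"
      then have "\<forall>\<^sub>F r in at_top. q X r \<le> ereal \<eta>" by (simp add: frequently_def not_less)
      then have "Limsup at_top (q X) \<le> ereal \<eta>" by (rule Limsup_bounded)
      then show False using X by auto
    qed
    then have "\<exists>\<^sub>F r in at_top. ereal \<eta> < q X r \<and> r \<ge> max R 1"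
      by (rule frequently_eventually_frequently[OF _ eventually_ge_at_top])
    then obtain r where r: "ereal \<eta> < q X r" "r \<ge> max R 1" using frequently_ex by blast
    then show ?thesis
      using X by (intro exI[of _ X] exI[of _ r]) (auto simp: q field_simps)
  qed
qed

section \<open>Empirical measures\<close>

lemma ball_sets [measurable]: "ball (x::'a::euclidean_space) r \<in> sets borel"
  by simp

lemma particle_mass_pos: "\<epsilon> > 0 \<Longrightarrow> particle_mass TYPE('a::euclidean_space) \<epsilon> > 0"
  by (simp add: particle_mass_def packing_density_pos ball_vol_pos)

lemma empirical_dirac_sum:
  assumes "\<mu> \<in> empirical_measures \<epsilon>" "\<epsilon> > 0"
  obtains N x where "\<mu> = dirac_sum N x" "inj_on x {..<N}" "atoms \<mu> = x ` {..<N}" "separated (2 * \<epsilon>) (atoms \<mu>)"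
proof -
  obtain N x where \<mu>: "\<mu> = dirac_sum N x" and sep: "\<forall>i<N. \<forall>j<N. i \<noteq> j \<longrightarrow> 2 * \<epsilon> \<le> dist (x i) (x j)"
    using assms(1) by (auto simp: empirical_measures_def)
  have "inj_on x {..<N}"
    using sep \<open>\<epsilon> > 0\<close> by (fastforce simp: inj_on_def)
  moreover have "separated (2 * \<epsilon>) (atoms \<mu>)"
    using sep by (auto simp: \<mu> atoms_dirac_sum separated_def)
  ultimately show ?thesis
    using that \<mu> by (simp add: atoms_dirac_sum)
qed

lemma sets_empirical: "\<mu> \<in> empirical_measures \<epsilon> \<Longrightarrow> sets \<mu> = sets borel"
  by (auto simp: empirical_measures_def dirac_sum_def)

lemma finite_atoms_empirical:
  "\<mu> \<in> empirical_measures \<epsilon> \<Longrightarrow> finite (atoms \<mu>)"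
  by (auto simp: empirical_measures_def atoms_dirac_sum)

lemma nn_integral_empirical:
  assumes "\<mu> \<in> empirical_measures \<epsilon>" "\<epsilon> > 0" "f \<in> borel_measurable borel"
  shows "(\<integral>\<^sup>+x. f x \<partial>\<mu>) = (\<Sum>x\<in>atoms \<mu>. f x)"
proof -
  obtain N x where *: "\<mu> = dirac_sum N x" "inj_on x {..<N}" "atoms \<mu> = x ` {..<N}"
    by (rule empirical_dirac_sum[OF assms(1,2)])
  show ?thesis
    using assms(3) unfolding *(3) by (simp add: *(1) dirac_sum_def nn_integral_distr nn_integral_count_space_finite sum.reindex[OF *(2)])
qed

lemma empirical_finite_borel:
  assumes "\<mu> \<in> empirical_measures \<epsilon>" "\<epsilon> > 0"
  shows "\<mu> \<in> finite_borel_measures"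
proof -
  have "emeasure \<mu> (space \<mu>) = (\<integral>\<^sup>+x. 1 \<partial>\<mu>)" by simp
  also have "\<dots> = of_nat (card (atoms \<mu>))" by (subst nn_integral_empirical[OF assms]) auto
  finally show ?thesis
    by (auto simp: finite_borel_measures_def sets_empirical[OF assms(1)] intro!: finite_measureI)
qed

lemma empirical_measure_exists:
  fixes S :: "'a::euclidean_space set"
  assumes "finite S" "separated (2 * \<epsilon>) S"
  obtains \<mu> where "\<mu> \<in> empirical_measures \<epsilon>" "atoms \<mu> = S"
proof -
  obtain x where x: "bij_betw x {..<card S} S"
    using ex_bij_betw_nat_finite[OF assms(1)] by (auto simp: atLeast0LessThan)
  then have "dirac_sum (card S) x \<in> empirical_measures \<epsilon>"
    using assms(2) unfolding empirical_measures_def separated_def bij_betw_def inj_on_def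
    by (intro CollectI exI[of _ "card S"] exI[of _ x]) blast
  then show ?thesis
    using that[of "dirac_sum (card S) x"] x by (simp add: atoms_dirac_sum bij_betw_imp_surj_on)
qed

section \<open>Integrals and energies of empirical measures as finite sums\<close>

lemma scale_measure_density: "scale_measure r M = density M (\<lambda>_. r)"
  by (rule measure_eqI) (auto simp: emeasure_density nn_integral_cmult_indicator)

lemma integral_rescaled:
  fixes f :: "'a::euclidean_space \<Rightarrow> real"
  assumes "\<mu> \<in> empirical_measures \<epsilon>" "\<epsilon> > 0" "f \<in> borel_measurable borel"
  shows "(\<integral>x. f x \<partial>rescaled \<epsilon> \<mu>) = particle_mass TYPE('a) \<epsilon> * (\<Sum>x\<in>atoms \<mu>. f x)"
proof -
  obtain N x where *: "\<mu> = dirac_sum N x" "inj_on x {..<N}" "atoms \<mu> = x ` {..<N}"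
    by (rule empirical_dirac_sum[OF assms(1,2)])
  have "(\<integral>x. f x \<partial>rescaled \<epsilon> \<mu>) = (\<integral>x. particle_mass TYPE('a) \<epsilon> * f x \<partial>\<mu>)"
    unfolding rescaled_def scale_measure_density
    using assms(3) particle_mass_pos[OF assms(2), where 'a='a] measurable_cong_sets[OF sets_empirical[OF assms(1)] refl, of borel]
    by (subst integral_density) auto
  also have "\<dots> = particle_mass TYPE('a) \<epsilon> * (\<Sum>x\<in>atoms \<mu>. f x)"
    using assms(3) unfolding *(3) by (simp add: *(1) dirac_sum_def integral_distr lebesgue_integral_count_space_finite sum.reindex[OF *(2)])
  finally show ?thesis .
qed

lemma finite_borel_rescaled:
  "\<mu> \<in> finite_borel_measures \<Longrightarrow> rescaled \<epsilon> \<mu> \<in> finite_borel_measures"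
  by (auto simp: finite_borel_measures_def rescaled_def space_scale_measure finite_measure.emeasure_finite
    ennreal_mult_eq_top_iff intro!: finite_measureI)

lemma measure_rescaled:
  fixes \<mu> :: "'a::euclidean_space measure"
  assumes "\<mu> \<in> empirical_measures \<epsilon>" "\<epsilon> > 0"
  shows "measure (rescaled \<epsilon> \<mu>) UNIV = particle_mass TYPE('a) \<epsilon> * real (card (atoms \<mu>))"
proof -
  have sp: "space (rescaled \<epsilon> \<mu>) = UNIV" using sets_eq_imp_space_eq[OF sets_empirical[OF assms(1)]]
    by (simp add: rescaled_def space_scale_measure)
  have "measure (rescaled \<epsilon> \<mu>) UNIV = (\<integral>x. 1 \<partial>rescaled \<epsilon> \<mu>)"
    by (simp add: sp)
  also have "\<dots> = particle_mass TYPE('a) \<epsilon> * real (card (atoms \<mu>))"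
    by (subst integral_rescaled[OF assms]) auto
  finally show ?thesis .
qed

text \<open>The interaction energy with its sign reversed. The diagonal terms vanish with
  \<open>riesz\<close>.\<close>

definition pair_energy :: "real \<Rightarrow> real \<Rightarrow> 'a::euclidean_space set \<Rightarrow> real" where
  "pair_energy \<alpha> p S = p\<^sup>2 * (\<Sum>x\<in>S. \<Sum>y\<in>S. riesz \<alpha> x y)"

lemma ext_integral_empirical:
  assumes "\<mu> \<in> empirical_measures \<epsilon>" "\<epsilon> > 0" and [measurable]: "f \<in> borel_measurable borel"
  shows "ext_integral \<mu> f = ereal (\<Sum>x\<in>atoms \<mu>. f x)"
proof -
  have "enn2ereal (\<Sum>x\<in>atoms \<mu>. ennreal (h x)) = ereal (\<Sum>x\<in>atoms \<mu>. max 0 (h x))" for h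
  proof -
    have "(\<Sum>x\<in>atoms \<mu>. ennreal (h x)) = (\<Sum>x\<in>atoms \<mu>. ennreal (max 0 (h x)))"
      by (simp add: ennreal_max_0)
    also have "\<dots> = ennreal (\<Sum>x\<in>atoms \<mu>. max 0 (h x))" by (rule sum_ennreal) auto
    finally show ?thesis by (simp add: sum_nonneg enn2ereal_ennreal)
  qed
  then have "ext_integral \<mu> f = ereal ((\<Sum>x\<in>atoms \<mu>. max 0 (f x)) - (\<Sum>x\<in>atoms \<mu>. max 0 (- f x)))"
    by (simp add: ext_integral_def nn_integral_empirical[OF assms(1,2)])
  also have "(\<Sum>x\<in>atoms \<mu>. max 0 (f x)) - (\<Sum>x\<in>atoms \<mu>. max 0 (- f x)) = (\<Sum>x\<in>atoms \<mu>. f x)"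
    unfolding sum_subtractf[symmetric] by (intro sum.cong) auto
  finally show ?thesis .
qed

lemma discrete_T_empirical:
  fixes \<mu> :: "'a::euclidean_space measure"
  assumes "\<mu> \<in> empirical_measures \<epsilon>" "\<epsilon> > 0" and [measurable]: "g \<in> borel_measurable borel"
  shows "discrete_T \<sigma> g \<epsilon> \<mu> = ereal (- pair_energy (real DIM('a) + \<sigma>) (particle_mass TYPE('a) \<epsilon>) (atoms \<mu>)
     + particle_mass TYPE('a) \<epsilon> * (\<Sum>x\<in>atoms \<mu>. g x))"
proof -
  let ?p = "particle_mass TYPE('a) \<epsilon>"
  have "(\<Sum>(x, y) \<in> {(x, y). x \<in> atoms \<mu> \<and> y \<in> atoms \<mu> \<and> x \<noteq> y}. riesz_kernel \<sigma> x y * ?p\<^sup>2)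
    = (\<Sum>(x, y) \<in> atoms \<mu> \<times> atoms \<mu>. - (?p\<^sup>2 * riesz (real DIM('a) + \<sigma>) x y))"
    using finite_atoms_empirical[OF assms(1)]
    by (intro sum.mono_neutral_cong_left) (auto simp: riesz_kernel_def riesz_def dist_norm)
  also have "\<dots> = - pair_energy (real DIM('a) + \<sigma>) ?p (atoms \<mu>)"
    by (simp add: pair_energy_def sum.cartesian_product[symmetric] sum_negf sum_distrib_left)
  finally have "discrete_F \<sigma> \<epsilon> \<mu> = ereal (- pair_energy (real DIM('a) + \<sigma>) ?p (atoms \<mu>))"
    using assms(1) by (simp add: discrete_F_def)
  moreover have "ext_integral \<mu> (\<lambda>x. g x * ?p) = ereal (?p * (\<Sum>x\<in>atoms \<mu>. g x))"
    by (subst ext_integral_empirical[OF assms(1,2)]) (auto simp: sum_distrib_left mult.commute)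
  ultimately show ?thesis by (simp add: discrete_T_def)
qed

lemma discrete_T_not_empirical: "\<mu> \<notin> empirical_measures \<epsilon> \<Longrightarrow> discrete_T \<sigma> g \<epsilon> \<mu> = \<infinity>"
  by (simp add: discrete_T_def discrete_F_def)

text \<open>The empty configuration is a competitor of energy \<open>0\<close>. So a minimizer has
  finite energy, which forces it to be empirical, and the minimal energies are bounded above
  uniformly in \<epsilon>, as the compactness property demands.\<close>

lemma discrete_minimizer:
  fixes \<mu> :: "'a::euclidean_space measure"
  assumes "\<epsilon> > 0" "g \<in> borel_measurable borel" "is_minimizer (discrete_T \<sigma> g \<epsilon>) \<mu>"
  shows "\<mu> \<in> empirical_measures \<epsilon>" "discrete_T \<sigma> g \<epsilon> \<mu> \<le> 0"
proof -
  obtain \<nu> :: "'a measure" where \<nu>: "\<nu> \<in> empirical_measures \<epsilon>" "atoms \<nu> = {}"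
    using empirical_measure_exists[of "{}" \<epsilon>] by (auto simp: separated_def)
  have "discrete_T \<sigma> g \<epsilon> \<mu> \<le> discrete_T \<sigma> g \<epsilon> \<nu>"
    using assms(3) empirical_finite_borel[OF \<nu>(1) assms(1)] by (auto simp: is_minimizer_def)
  also have "\<dots> = 0"
    using discrete_T_empirical[OF \<nu>(1) assms(1,2), of \<sigma>] \<nu>(2) by (simp add: pair_energy_def)
  finally show "discrete_T \<sigma> g \<epsilon> \<mu> \<le> 0" .
  then show "\<mu> \<in> empirical_measures \<epsilon>"
    using discrete_T_not_empirical[of \<mu> \<epsilon> \<sigma> g] by force
qed

text \<open>Leaving out the centre makes the bound hold down to radius \<open>0\<close>: a ball of
  radius at most \<open>2 * \<epsilon>\<close> contains no other point, and beyond that radius the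
  balls of radius \<epsilon> around the points fit into \<open>ball x (2 * r)\<close>.\<close>

lemma card_separated_ball:
  fixes S :: "'a::euclidean_space set"
  assumes "finite S" "separated (2 * \<epsilon>) S" "\<epsilon> > 0" "r > 0" "x \<in> S"
  shows "real (card ((S - {x}) \<inter> ball x r)) \<le> (2 / \<epsilon>) ^ DIM('a) * r ^ DIM('a)"
proof (cases "r \<le> 2 * \<epsilon>")
  case True
  then have "(S - {x}) \<inter> ball x r = {}"
    using assms by (fastforce simp: separated_def)
  then show ?thesis using assms by simp
next
  case False
  let ?T = "(S - {x}) \<inter> ball x r"
  have "ball y \<epsilon> \<subseteq> ball x (2 * r)" if "y \<in> ?T" for y
    using that False \<open>\<epsilon> > 0\<close> by (intro subsetI) (auto intro: le_less_trans[OF dist_triangle[of x _ y]])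
  then have "real (card ?T) * (ball_vol TYPE('a) * (2 * \<epsilon> / 2) ^ DIM('a)) \<le> measure lborel (ball x (2 * r))"
    using assms by (intro separated_card_le) (auto simp: separated_def emeasure_ball_eq)
  then have "real (card ?T) * \<epsilon> ^ DIM('a) \<le> 2 ^ DIM('a) * r ^ DIM('a)"
    using ball_vol_pos[where 'a='a] \<open>r > 0\<close> by (simp add: measure_ball_eq power_mult_distrib algebra_simps)
  then show ?thesis
    using \<open>\<epsilon> > 0\<close> by (simp add: power_divide field_simps)
qed

lemma discrete_riesz_near:
  fixes S :: "'a::euclidean_space set" and \<alpha> :: real
  assumes "finite S" "separated (2 * \<epsilon>) S" "\<epsilon> > 0" "x \<in> S" "\<delta> > 0" "0 < \<alpha>" "\<alpha> < DIM('a)"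
  shows "(\<Sum>y\<in>S \<inter> ball x \<delta>. riesz \<alpha> x y) \<le> (2 / \<epsilon>) ^ DIM('a) * riesz_const \<alpha> DIM('a) * \<delta> powr (DIM('a) - \<alpha>)"
proof -
  \<comment> \<open>A unit mass at \<open>x\<close> would violate the growth bound on small balls.
    Omitting \<open>x\<close> changes no sum, since the kernel vanishes on the diagonal.\<close>
  let ?M = "distr (count_space (S - {x})) borel (\<lambda>x. x)"
  have "(\<integral>\<^sup>+y. ennreal (riesz \<alpha> x y) * indicator (ball x \<delta>) y \<partial>?M)
     \<le> ennreal ((2 / \<epsilon>) ^ DIM('a) * riesz_const \<alpha> DIM('a) * \<delta> powr (DIM('a) - \<alpha>))"
  proof (rule nn_integral_riesz_ball)
    fix r :: real assume r: "r > 0"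
    have "emeasure ?M (ball x r) = of_nat (card ((S - {x}) \<inter> ball x r))"
      using assms(1) by (subst emeasure_distr) (auto simp: emeasure_count_space_finite intro!: arg_cong[where f = card])
    then show "emeasure ?M (ball x r) \<le> ennreal ((2 / \<epsilon>) ^ DIM('a) * r ^ DIM('a))"
      using card_separated_ball[OF assms(1-3) r assms(4)] by (simp add: ennreal_of_nat_eq_real_of_nat ennreal_leI)
  qed (use assms in auto)
  also have "(\<integral>\<^sup>+y. ennreal (riesz \<alpha> x y) * indicator (ball x \<delta>) y \<partial>?M)
     = (\<Sum>y\<in>S - {x}. ennreal (riesz \<alpha> x y) * indicator (ball x \<delta>) y)"
    using assms(1) by (subst nn_integral_distr) (auto simp: nn_integral_count_space_finite)
  also have "\<dots> = (\<Sum>y\<in>S \<inter> ball x \<delta>. ennreal (riesz \<alpha> x y))"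
    using assms(1) by (intro sum.mono_neutral_cong) (auto simp: indicator_def)
  also have "\<dots> = ennreal (\<Sum>y\<in>S \<inter> ball x \<delta>. riesz \<alpha> x y)" by (rule sum_ennreal) auto
  finally show ?thesis
    using assms by (subst (asm) ennreal_le_iff) (auto simp: riesz_const_nonneg)
qed

text \<open>The factor \<open>\<epsilon> ^ DIM('a)\<close> of the particle mass cancels the
  \<open>1 / \<epsilon> ^ DIM('a)\<close> of the count, so the bound is uniform in
  \<epsilon>.\<close>

lemma particle_mass_near:
  fixes S :: "'a::euclidean_space set" and \<alpha> :: real
  assumes "finite S" "separated (2 * \<epsilon>) S" "\<epsilon> > 0" "x \<in> S" "\<delta> > 0" "0 < \<alpha>" "\<alpha> < DIM('a)"
  shows "particle_mass TYPE('a) \<epsilon> * (\<Sum>y\<in>S \<inter> ball x \<delta>. riesz \<alpha> x y)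
    \<le> 2 ^ DIM('a) * ball_vol TYPE('a) / packing_density TYPE('a) * riesz_const \<alpha> DIM('a) * \<delta> powr (DIM('a) - \<alpha>)"
proof -
  have "particle_mass TYPE('a) \<epsilon> * (\<Sum>y\<in>S \<inter> ball x \<delta>. riesz \<alpha> x y)
    \<le> particle_mass TYPE('a) \<epsilon> * ((2 / \<epsilon>) ^ DIM('a) * riesz_const \<alpha> DIM('a) * \<delta> powr (DIM('a) - \<alpha>))"
    using discrete_riesz_near[OF assms] particle_mass_pos[OF assms(3), where 'a='a] by (intro mult_left_mono) auto
  also have "\<dots> = 2 ^ DIM('a) * ball_vol TYPE('a) / packing_density TYPE('a) * riesz_const \<alpha> DIM('a) * \<delta> powr (DIM('a) - \<alpha>)"
    using assms(3) by (simp add: particle_mass_def power_divide)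
  finally show ?thesis .
qed

section \<open>Tight convergence\<close>

lemma finite_borel_measuresD:
  assumes "M \<in> finite_borel_measures"
  shows "sets M = sets borel" "finite_measure M" "space M = UNIV" "borel_measurable M = borel_measurable borel"
  using assms sets_eq_imp_space_eq[of M borel] measurable_cong_sets[of M borel borel borel]
  by (auto simp: finite_borel_measures_def)

lemma integrable_bounded_borel:
  fixes f :: "'a::euclidean_space \<Rightarrow> real"
  assumes "M \<in> finite_borel_measures" "f \<in> borel_measurable borel" "\<And>x. \<bar>f x\<bar> \<le> B"
  shows "integrable M f"
  using assms finite_borel_measuresD[OF assms(1)]
  by (intro finite_measure.integrable_const_bound[where B = B]) auto

text \<open>The mass missed by a cut-off is the total mass minus an integral of a compactly
  supported continuous function. Both converge, so a cut-off adapted to the limit also works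
  eventually along the sequence.\<close>

lemma tight_cutoff:
  fixes \<nu> :: "nat \<Rightarrow> 'a::euclidean_space measure"
  assumes tight: "tightly_converges \<nu> \<nu>'" and \<nu>': "\<nu>' \<in> finite_borel_measures" and "\<eta> > 0"
  obtains c :: "'a \<Rightarrow> real" and R where "continuous_on UNIV c" "\<And>x. 0 \<le> c x" "\<And>x. c x \<le> 1" "\<And>x. norm x \<ge> R \<Longrightarrow> c x = 0"
    "measure \<nu>' UNIV - (\<integral>x. c x \<partial>\<nu>') < \<eta>" "\<forall>\<^sub>F n in sequentially. measure (\<nu> n) UNIV - (\<integral>x. c x \<partial>\<nu> n) < \<eta>"
proof -
  note D = finite_borel_measuresD[OF \<nu>']
  define c where "c k x = max 0 (min 1 (real k - norm x))" for k and x :: 'a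
  have cont: "continuous_on UNIV (c k)" for k
    unfolding c_def by (intro continuous_intros)
  have [measurable]: "c k \<in> borel_measurable borel" for k
    using cont by (rule borel_measurable_continuous_onI)
  have "(\<lambda>k. \<integral>x. c k x \<partial>\<nu>') \<longlonglongrightarrow> (\<integral>x. 1 \<partial>\<nu>')"
  proof (rule integral_dominated_convergence[where w = "\<lambda>_. 1"])
    show "AE x in \<nu>'. (\<lambda>k. c k x) \<longlonglongrightarrow> 1"
    proof (intro AE_I2 tendsto_eventually)
      fix x :: 'a
      have "\<forall>\<^sub>F k in sequentially. norm x + 1 \<le> real k"
        using filterlim_real_sequentially by (simp add: filterlim_at_top)
      then show "\<forall>\<^sub>F k in sequentially. c k x = 1"
        by eventually_elim (simp add: c_def)
    qed
    show "AE x in \<nu>'. norm (c k x) \<le> 1" for k by (auto simp: c_def)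
    show "integrable \<nu>' (\<lambda>_. 1::real)" by (rule integrable_bounded_borel[OF \<nu>', of _ 1]) auto
  qed (auto simp: D)
  then have "(\<lambda>k. measure \<nu>' UNIV - (\<integral>x. c k x \<partial>\<nu>')) \<longlonglongrightarrow> measure \<nu>' UNIV - measure \<nu>' UNIV"
    by (intro tendsto_intros) (simp add: D)
  then have "\<forall>\<^sub>F k in sequentially. measure \<nu>' UNIV - (\<integral>x. c k x \<partial>\<nu>') < \<eta>"
    using \<open>\<eta> > 0\<close> by (intro order_tendstoD(2)) auto
  then obtain k where k: "measure \<nu>' UNIV - (\<integral>x. c k x \<partial>\<nu>') < \<eta>"
    by (auto simp: eventually_sequentially)
  have zero: "c k x = 0" if "norm x \<ge> real k" for x using that by (simp add: c_def)
  then have "(c k \<longlongrightarrow> 0) at_infinity"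
    by (intro tendsto_eventually) (auto simp: eventually_at_infinity)
  then have "(\<lambda>n. measure (\<nu> n) UNIV - (\<integral>x. c k x \<partial>\<nu> n)) \<longlonglongrightarrow> measure \<nu>' UNIV - (\<integral>x. c k x \<partial>\<nu>')"
    using tight cont[of k] unfolding tightly_converges_def by (intro tendsto_diff) auto
  then have "\<forall>\<^sub>F n in sequentially. measure (\<nu> n) UNIV - (\<integral>x. c k x \<partial>\<nu> n) < \<eta>"
    using k by (intro order_tendstoD(2)) auto
  then show ?thesis
    using cont zero k by (intro that[of "c k" "real k"]) (auto simp: c_def)
qed

lemma integral_cutoff_error:
  fixes f c :: "'a::euclidean_space \<Rightarrow> real"
  assumes M: "M \<in> finite_borel_measures" and [measurable]: "f \<in> borel_measurable borel" "c \<in> borel_measurable borel"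
    and B: "\<And>x. \<bar>f x\<bar> \<le> B" and c: "\<And>x. 0 \<le> c x" "\<And>x. c x \<le> 1"
  shows "\<bar>(\<integral>x. f x \<partial>M) - (\<integral>x. f x * c x \<partial>M)\<bar> \<le> B * (measure M UNIV - (\<integral>x. c x \<partial>M))"
proof -
  note D = finite_borel_measuresD[OF M]
  have B0: "B \<ge> 0" using B[of undefined] by linarith
  have bnd: "\<bar>f x * c x\<bar> \<le> B" "\<bar>c x\<bar> \<le> 1" for x
    using B[of x] c[of x] mult_mono[of "\<bar>f x\<bar>" B "c x" 1] by (auto simp: abs_mult)
  have int: "integrable M f" "integrable M (\<lambda>x. f x * c x)" "integrable M c"
    by (rule integrable_bounded_borel[OF M _ B] integrable_bounded_borel[OF M _ bnd(1)] integrable_bounded_borel[OF M _ bnd(2)]; measurable)+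
  have int1: "integrable M (\<lambda>x. 1 :: real)" by (rule integrable_bounded_borel[OF M, of _ 1]) auto
  have "\<bar>(\<integral>x. f x \<partial>M) - (\<integral>x. f x * c x \<partial>M)\<bar> = \<bar>\<integral>x. f x - f x * c x \<partial>M\<bar>"
    using int by simp
  also have "\<dots> \<le> (\<integral>x. \<bar>f x - f x * c x\<bar> \<partial>M)" by (rule integral_abs_bound)
  also have "\<dots> \<le> (\<integral>x. B * (1 - c x) \<partial>M)"
  proof (rule integral_mono)
    fix x
    have "\<bar>f x - f x * c x\<bar> = \<bar>f x\<bar> * (1 - c x)"
      using c[of x] abs_mult[of "f x" "1 - c x"] by (simp add: right_diff_distrib)
    also have "\<dots> \<le> B * (1 - c x)" using B[of x] c[of x] by (intro mult_right_mono) auto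
    finally show "\<bar>f x - f x * c x\<bar> \<le> B * (1 - c x)" .
  qed (use int int1 in auto)
  also have "\<dots> = B * (measure M UNIV - (\<integral>x. c x \<partial>M))"
    using int int1 by (simp add: D)
  finally show ?thesis .
qed

text \<open>The product of \<open>f\<close> with a cut-off vanishes at infinity and is an admissible
  test function; the remaining error is \<open>B\<close> times the small mass that the cut-off
  misses.\<close>

lemma tight_bounded_continuous:
  fixes \<nu> :: "nat \<Rightarrow> 'a::euclidean_space measure" and f :: "'a \<Rightarrow> real"
  assumes tight: "tightly_converges \<nu> \<nu>'" and \<nu>': "\<nu>' \<in> finite_borel_measures" and \<nu>: "\<And>n. \<nu> n \<in> finite_borel_measures"
    and f: "continuous_on UNIV f" "\<And>x. \<bar>f x\<bar> \<le> B"
  shows "(\<lambda>n. \<integral>x. f x \<partial>\<nu> n) \<longlonglongrightarrow> (\<integral>x. f x \<partial>\<nu>')"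
proof (rule LIMSEQ_I)
  fix r :: real assume "r > 0"
  have B0: "B \<ge> 0" using f(2)[of undefined] by linarith
  \<comment> \<open>\<open>B + 1\<close> in place of \<open>B\<close>, which may be zero.\<close>
  define \<eta> where "\<eta> = r / (3 * (B + 1))"
  have \<eta>: "\<eta> > 0" "B * \<eta> \<le> r / 3" using \<open>r > 0\<close> B0 by (auto simp: \<eta>_def field_simps)
  obtain c :: "'a \<Rightarrow> real" and R where c: "continuous_on UNIV c" "\<And>x. 0 \<le> c x" "\<And>x. c x \<le> 1" "\<And>x. norm x \<ge> R \<Longrightarrow> c x = 0"
    and e: "measure \<nu>' UNIV - (\<integral>x. c x \<partial>\<nu>') < \<eta>" "\<forall>\<^sub>F n in sequentially. measure (\<nu> n) UNIV - (\<integral>x. c x \<partial>\<nu> n) < \<eta>"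
    by (rule tight_cutoff[OF tight \<nu>' \<eta>(1)]) blast
  have m: "f \<in> borel_measurable borel" "c \<in> borel_measurable borel"
    using f c by (auto intro: borel_measurable_continuous_onI)
  have fc: "continuous_on UNIV (\<lambda>x. f x * c x)" using f c by (intro continuous_intros)
  have "((\<lambda>x. f x * c x) \<longlongrightarrow> 0) at_infinity"
    using c(4) by (intro tendsto_eventually) (auto simp: eventually_at_infinity)
  then have "(\<lambda>n. \<integral>x. f x * c x \<partial>\<nu> n) \<longlonglongrightarrow> (\<integral>x. f x * c x \<partial>\<nu>')"
    using tight fc by (auto simp: tightly_converges_def)
  then have "\<forall>\<^sub>F n in sequentially. dist (\<integral>x. f x * c x \<partial>\<nu> n) (\<integral>x. f x * c x \<partial>\<nu>') < r / 3"
    using \<open>r > 0\<close> by (intro tendstoD) auto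
  with e(2) have "\<forall>\<^sub>F n in sequentially. norm ((\<integral>x. f x \<partial>\<nu> n) - (\<integral>x. f x \<partial>\<nu>')) < r"
  proof eventually_elim
    case (elim n)
    have 1: "\<bar>(\<integral>x. f x \<partial>\<nu> n) - (\<integral>x. f x * c x \<partial>\<nu> n)\<bar> \<le> B * \<eta>"
      using integral_cutoff_error[OF \<nu> m f(2) c(2,3), of n] mult_left_mono[OF less_imp_le[OF elim(1)] B0] by simp
    have 2: "\<bar>(\<integral>x. f x \<partial>\<nu>') - (\<integral>x. f x * c x \<partial>\<nu>')\<bar> \<le> B * \<eta>"
      using integral_cutoff_error[OF \<nu>' m f(2) c(2,3)] mult_left_mono[OF less_imp_le[OF e(1)] B0] by simp
    show ?case
      using 1 2 elim(2) \<eta>(2) unfolding real_norm_def dist_real_def by linarith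
  qed
  then show "\<exists>no. \<forall>n\<ge>no. norm ((\<integral>x. f x \<partial>\<nu> n) - (\<integral>x. f x \<partial>\<nu>')) < r"
    by (simp add: eventually_sequentially)
qed

lemma tight_mass_bound:
  assumes "tightly_converges \<nu> \<nu>'"
  obtains m where "m > 0" "\<And>n. measure (\<nu> n) UNIV \<le> m"
proof -
  have "convergent (\<lambda>n. measure (\<nu> n) UNIV)"
    using assms by (auto simp: tightly_converges_def convergent_def)
  then have "Bseq (\<lambda>n. measure (\<nu> n) UNIV)" by (rule convergent_imp_Bseq)
  then obtain m where m: "m > 0" "\<forall>n. norm (measure (\<nu> n) UNIV) \<le> m" by (auto simp: Bseq_def)
  show ?thesis by (rule that[OF m(1)]) (use m(2) in auto)
qed

text \<open>The inner integrals are equi-Lipschitz, hence converge uniformly on compact sets; tightness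
  controls the rest.\<close>

lemma tight_double_integral:
  fixes \<nu> :: "nat \<Rightarrow> 'a::euclidean_space measure" and k :: "'a \<Rightarrow> 'a \<Rightarrow> real"
  assumes tight: "tightly_converges \<nu> \<nu>'" and \<nu>': "\<nu>' \<in> finite_borel_measures" and \<nu>: "\<And>n. \<nu> n \<in> finite_borel_measures"
    and B: "\<And>x y. \<bar>k x y\<bar> \<le> B" and Lip: "\<And>x x' y. \<bar>k x y - k x' y\<bar> \<le> C * dist x x'"
    and cont: "\<And>x. continuous_on UNIV (k x)"
  shows "(\<lambda>n. \<integral>x. \<integral>y. k x y \<partial>\<nu> n \<partial>\<nu> n) \<longlonglongrightarrow> (\<integral>x. \<integral>y. k x y \<partial>\<nu>' \<partial>\<nu>')"
proof -
  define H where "H M x = (\<integral>y. k x y \<partial>M)" for M x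
  obtain m0 where m0: "m0 > 0" "\<And>n. measure (\<nu> n) UNIV \<le> m0"
    using tight_mass_bound[OF tight] by metis
  define m where "m = max m0 (measure \<nu>' UNIV)"
  have m: "m > 0" "\<And>n. measure (\<nu> n) UNIV \<le> m" "measure \<nu>' UNIV \<le> m"
    using m0 by (auto simp: m_def le_max_iff_disj)
  have B0: "B \<ge> 0" using B[of undefined undefined] by linarith
  have C0: "C \<ge> 0"
  proof -
    obtain b :: 'a where "b \<in> Basis" using nonempty_Basis by blast
    then have "\<bar>k b b - k 0 b\<bar> \<le> C" using Lip[of b b 0] by simp
    then show ?thesis by linarith
  qed
  have [measurable]: "k x \<in> borel_measurable borel" for x
    using cont by (rule borel_measurable_continuous_onI)
  have Hb: "\<bar>H M x\<bar> \<le> B * m" and HL: "\<bar>H M x - H M x'\<bar> \<le> (C * m) * dist x x'"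
    if M: "M \<in> finite_borel_measures" "measure M UNIV \<le> m" for M x x'
  proof -
    note D = finite_borel_measuresD[OF M(1)]
    have int: "integrable M (k x)" for x
      by (rule integrable_bounded_borel[OF M(1) _ B]) auto
    have const: "integrable M (\<lambda>_. b :: real)" for b by (rule integrable_bounded_borel[OF M(1), of _ "\<bar>b\<bar>"]) auto
    have "\<bar>H M x\<bar> \<le> (\<integral>y. \<bar>k x y\<bar> \<partial>M)" unfolding H_def by (rule integral_abs_bound)
    also have "\<dots> \<le> (\<integral>y. B \<partial>M)" by (intro integral_mono integrable_abs int const B)
    also have "\<dots> = B * measure M UNIV" by (simp add: D)
    also have "\<dots> \<le> B * m" using M B0 by (intro mult_left_mono) auto
    finally show "\<bar>H M x\<bar> \<le> B * m" .
    have "\<bar>H M x - H M x'\<bar> = \<bar>\<integral>y. k x y - k x' y \<partial>M\<bar>" unfolding H_def using int by simp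
    also have "\<dots> \<le> (\<integral>y. \<bar>k x y - k x' y\<bar> \<partial>M)" by (rule integral_abs_bound)
    also have "\<dots> \<le> (\<integral>y. C * dist x x' \<partial>M)" by (intro integral_mono integrable_abs Bochner_Integration.integrable_diff int const Lip)
    also have "\<dots> = C * dist x x' * measure M UNIV" by (simp add: D)
    also have "\<dots> \<le> C * dist x x' * m" using M C0 by (intro mult_left_mono) auto
    finally show "\<bar>H M x - H M x'\<bar> \<le> (C * m) * dist x x'" by (simp add: mult_ac)
  qed
  have Hc: "continuous_on UNIV (H M)" if "M \<in> finite_borel_measures" "measure M UNIV \<le> m" for M
  proof (rule lipschitz_on_continuous_on)
    show "(C * m)-lipschitz_on UNIV (H M)"
      using HL[OF that] C0 m(1) by (intro lipschitz_onI) (auto simp: dist_real_def)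
  qed
  have Hm: "H M \<in> borel_measurable borel" if "M \<in> finite_borel_measures" "measure M UNIV \<le> m" for M
    using Hc[OF that] by (rule borel_measurable_continuous_onI)
  have pt: "(\<lambda>n. H (\<nu> n) x) \<longlonglongrightarrow> H \<nu>' x" for x
    unfolding H_def by (rule tight_bounded_continuous[OF tight \<nu>' \<nu> cont B])
  have "(\<lambda>n. (\<integral>x. H (\<nu> n) x \<partial>\<nu> n) - (\<integral>x. H \<nu>' x \<partial>\<nu> n)) \<longlonglongrightarrow> 0"
  proof (rule LIMSEQ_I)
    fix r :: real assume "r > 0"
    define \<eta> where "\<eta> = r / (4 * (B * m + 1))"
    have q: "B * m \<ge> 0" "C * m \<ge> 0" using B0 C0 m(1) by auto
    have \<eta>1: "\<eta> > 0" using \<open>r > 0\<close> q by (simp add: \<eta>_def)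
    have "4 * (B * m + 1) * \<eta> = r" using q by (simp add: \<eta>_def)
    then have "4 * ((B * m) * \<eta>) + 4 * \<eta> = r" by (simp add: algebra_simps)
    with \<eta>1 have \<eta>: "\<eta> > 0" "(2 * (B * m)) * \<eta> \<le> r / 2" by linarith+
    define \<theta> where "\<theta> = r / (6 * m)"
    define t where "t = \<theta> / (C * m + 1)"
    have \<theta>: "\<theta> > 0" "3 * \<theta> * m = r / 2" using m(1) \<open>r > 0\<close> by (auto simp: \<theta>_def)
    have t1: "t > 0" using \<theta>(1) q by (simp add: t_def)
    have "(C * m + 1) * t = \<theta>" using q by (simp add: t_def)
    with t1 have t: "t > 0" "C * m * t \<le> \<theta>" by (simp_all add: distrib_right)
    obtain c :: "'a \<Rightarrow> real" and R where c: "continuous_on UNIV c" "\<And>x. 0 \<le> c x" "\<And>x. c x \<le> 1" "\<And>x. norm x \<ge> R \<Longrightarrow> c x = 0"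
      and e: "\<forall>\<^sub>F n in sequentially. measure (\<nu> n) UNIV - (\<integral>x. c x \<partial>\<nu> n) < \<eta>"
      by (rule tight_cutoff[OF tight \<nu>' \<eta>(1)]) blast
    have cm [measurable]: "c \<in> borel_measurable borel" by (rule borel_measurable_continuous_onI[OF c(1)])
    \<comment> \<open>A finite net of mesh \<open>t\<close>: the two inner integrals differ by less
      than \<theta> at a net point, and moving to the net costs at most \<theta> for each of them,
      whence the \<open>3 * \<theta>\<close> below.\<close>
    obtain K where K: "finite K" "cball (0::'a) R \<subseteq> (\<Union>x\<in>K. ball x t)"
      using compact_cball[of "0::'a" R] t(1) unfolding compact_eq_totally_bounded by blast
    have "\<forall>\<^sub>F n in sequentially. \<forall>x\<in>K. dist (H (\<nu> n) x) (H \<nu>' x) < \<theta>"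
      using K(1) tendstoD[OF pt \<theta>(1)] by (intro eventually_ball_finite) auto
    with e have "\<forall>\<^sub>F n in sequentially. norm ((\<integral>x. H (\<nu> n) x \<partial>\<nu> n) - (\<integral>x. H \<nu>' x \<partial>\<nu> n) - 0) < r"
    proof eventually_elim
      case (elim n)
      note D = finite_borel_measuresD[OF \<nu>[of n]]
      define h where "h x = H (\<nu> n) x - H \<nu>' x" for x
      note Hn = Hm[OF \<nu> m(2)] and H' = Hm[OF \<nu>' m(3)]
      have hm [measurable]: "h \<in> borel_measurable borel" unfolding h_def using Hn H' by measurable
      have h_near: "\<bar>h x\<bar> \<le> 3 * \<theta>" if x: "norm x \<le> R" for x
      proof -
        obtain p where p: "p \<in> K" "dist p x < t" using K(2) x by auto
        have "(C * m) * dist x p \<le> (C * m) * t" using p(2) C0 m(1) by (intro mult_left_mono) (auto simp: dist_commute)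
        then have "\<bar>H (\<nu> n) x - H (\<nu> n) p\<bar> \<le> \<theta>" "\<bar>H \<nu>' x - H \<nu>' p\<bar> \<le> \<theta>"
          using HL[OF \<nu> m(2), of n x p] HL[OF \<nu>' m(3), of x p] t(2) by linarith+
        moreover have "\<bar>H (\<nu> n) p - H \<nu>' p\<bar> < \<theta>" using elim(2) p(1) by (auto simp: dist_real_def)
        ultimately show ?thesis unfolding h_def by linarith
      qed
      have h_b: "\<bar>h x\<bar> \<le> 2 * (B * m)" for x
        using Hb[OF \<nu> m(2), of n x] Hb[OF \<nu>' m(3), of x] unfolding h_def by linarith
      have hc: "\<bar>h x * c x\<bar> \<le> 3 * \<theta>" for x
      proof (cases "norm x \<le> R")
        case True
        then show ?thesis using h_near[OF True] c(2,3)[of x] mult_mono[of "\<bar>h x\<bar>" "3 * \<theta>" "c x" 1] \<theta>(1)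
          by (simp add: abs_mult)
      qed (use c(4)[of x] \<theta>(1) in auto)
      have "(\<integral>x. H (\<nu> n) x \<partial>\<nu> n) - (\<integral>x. H \<nu>' x \<partial>\<nu> n) = (\<integral>x. h x \<partial>\<nu> n)"
        unfolding h_def using integrable_bounded_borel[OF \<nu> Hn Hb[OF \<nu> m(2)]] integrable_bounded_borel[OF \<nu> H' Hb[OF \<nu>' m(3)]]
        by simp
      moreover have "\<bar>(\<integral>x. h x \<partial>\<nu> n) - (\<integral>x. h x * c x \<partial>\<nu> n)\<bar> \<le> 2 * (B * m) * (measure (\<nu> n) UNIV - (\<integral>x. c x \<partial>\<nu> n))"
        by (rule integral_cutoff_error[OF \<nu> hm cm h_b c(2,3)])
      moreover have "2 * (B * m) * (measure (\<nu> n) UNIV - (\<integral>x. c x \<partial>\<nu> n)) \<le> 2 * (B * m) * \<eta>"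
        using elim(1) B0 m(1) by (intro mult_left_mono) auto
      moreover have "\<bar>\<integral>x. h x * c x \<partial>\<nu> n\<bar> \<le> 3 * \<theta> * m"
      proof -
        have i: "integrable (\<nu> n) (\<lambda>x. h x * c x)" by (rule integrable_bounded_borel[OF \<nu> _ hc]) measurable
        have const: "integrable (\<nu> n) (\<lambda>_. b :: real)" for b by (rule integrable_bounded_borel[OF \<nu>, of _ "\<bar>b\<bar>"]) auto
        have "\<bar>\<integral>x. h x * c x \<partial>\<nu> n\<bar> \<le> (\<integral>x. \<bar>h x * c x\<bar> \<partial>\<nu> n)" by (rule integral_abs_bound)
        also have "\<dots> \<le> (\<integral>x. 3 * \<theta> \<partial>\<nu> n)" by (intro integral_mono integrable_abs i const hc)
        also have "\<dots> = 3 * \<theta> * measure (\<nu> n) UNIV" by (simp add: D)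
        also have "\<dots> \<le> 3 * \<theta> * m" using m(2) \<theta>(1) by (intro mult_left_mono) auto
        finally show ?thesis .
      qed

      \<comment> \<open>One of the two halves of \<open>r\<close> must be strict. Multiplying by
        \<open>B * m\<close> preserves strictness unless it is zero, in which case the left side
        vanishes.\<close>
      moreover have "(2 * (B * m)) * (measure (\<nu> n) UNIV - (\<integral>x. c x \<partial>\<nu> n)) < r / 2"
      proof (cases "B * m = 0")
        case False
        then have "2 * (B * m) > 0" using B0 m(1) by (simp add: zero_less_mult_iff)
        then have "(2 * (B * m)) * (measure (\<nu> n) UNIV - (\<integral>x. c x \<partial>\<nu> n)) < (2 * (B * m)) * \<eta>"
          using elim(1) by (intro mult_strict_left_mono) auto
        then show ?thesis using \<eta>(2) by linarith
      qed (use \<open>r > 0\<close> in auto)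
      ultimately show ?case unfolding \<theta>(2) real_norm_def by linarith
    qed
    then show "\<exists>no. \<forall>n\<ge>no. norm ((\<integral>x. H (\<nu> n) x \<partial>\<nu> n) - (\<integral>x. H \<nu>' x \<partial>\<nu> n) - 0) < r"
      by (simp add: eventually_sequentially)
  qed
  moreover have "(\<lambda>n. \<integral>x. H \<nu>' x \<partial>\<nu> n) \<longlonglongrightarrow> (\<integral>x. H \<nu>' x \<partial>\<nu>')"
    by (rule tight_bounded_continuous[OF tight \<nu>' \<nu> Hc[OF \<nu>' m(3)] Hb[OF \<nu>' m(3)]])
  ultimately have "(\<lambda>n. ((\<integral>x. H (\<nu> n) x \<partial>\<nu> n) - (\<integral>x. H \<nu>' x \<partial>\<nu> n)) + (\<integral>x. H \<nu>' x \<partial>\<nu> n)) \<longlonglongrightarrow> 0 + (\<integral>x. H \<nu>' x \<partial>\<nu>')"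
    by (rule tendsto_add)
  then show ?thesis unfolding H_def by simp
qed

section \<open>Convergence of the interaction energy\<close>

definition riesz_energy :: "real \<Rightarrow> 'a::euclidean_space measure \<Rightarrow> ennreal" where
  "riesz_energy \<alpha> M = (\<integral>\<^sup>+x. \<integral>\<^sup>+y. ennreal (riesz \<alpha> x y) \<partial>M \<partial>M)"

definition sub_lebesgue :: "'a::euclidean_space measure \<Rightarrow> bool" where
  "sub_lebesgue M \<longleftrightarrow> M \<in> finite_borel_measures \<and> (\<forall>A\<in>sets borel. emeasure M A \<le> emeasure lborel A)"

lemma riesz_le_cut: "riesz \<alpha> x y \<le> riesz_cut \<alpha> \<delta> x y + riesz \<alpha> x y * indicator (ball x \<delta>) y"
  by (auto simp: riesz_def riesz_cut_def indicator_def max_def)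

text \<open>False on the diagonal, where \<open>riesz\<close> is \<open>0\<close> and the truncated
  kernel is positive for \<delta> > 0. For measures below Lebesgue the diagonal is null; for
  empirical measures it produces a separate error term.\<close>

lemma riesz_cut_le:
  assumes "\<alpha> \<ge> 0" "x \<noteq> y" shows "riesz_cut \<alpha> \<delta> x y \<le> riesz \<alpha> x y"
proof -
  have "dist x y powr \<alpha> \<le> max \<delta> (dist x y) powr \<alpha>" using assms by (intro powr_mono2) auto
  then show ?thesis unfolding riesz_def riesz_cut_def using assms by (intro divide_left_mono mult_pos_pos) (auto simp: max_def)
qed

lemma riesz_cut_bound:
  assumes "\<alpha> \<ge> 0" "\<delta> > 0" shows "riesz_cut \<alpha> \<delta> x y \<le> 1 / \<delta> powr \<alpha>"
proof -
  have "\<delta> powr \<alpha> \<le> max \<delta> (dist x y) powr \<alpha>" using assms by (intro powr_mono2) auto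
  then show ?thesis unfolding riesz_cut_def using assms by (intro divide_left_mono mult_pos_pos) (auto simp: max_def)
qed

lemma riesz_cut_lipschitz:
  assumes "\<alpha> > 0" "\<delta> > 0"
  shows "\<bar>riesz_cut \<alpha> \<delta> x y - riesz_cut \<alpha> \<delta> x' y\<bar> \<le> \<alpha> * \<delta> powr (- \<alpha> - 1) * dist x x'"
proof -
  define s where "s = max \<delta> (dist x y)"
  define t where "t = max \<delta> (dist x' y)"
  have "norm (s powr - \<alpha> - t powr - \<alpha>) \<le> \<alpha> * \<delta> powr (- \<alpha> - 1) * norm (s - t)"
  proof (rule field_differentiable_bound[where S = "{\<delta>..}" and f' = "\<lambda>z. - \<alpha> * z powr (- \<alpha> - 1)"])
    fix z assume "z \<in> {\<delta>..}"
    then have z: "z \<ge> \<delta>" by simp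
    show "((\<lambda>z. z powr - \<alpha>) has_field_derivative - \<alpha> * z powr (- \<alpha> - 1)) (at z within {\<delta>..})"
      using z \<open>\<delta> > 0\<close> by (auto intro!: derivative_eq_intros)
    have "z powr (- \<alpha> - 1) \<le> \<delta> powr (- \<alpha> - 1)" using z assms by (intro powr_mono2') auto
    then show "norm (- \<alpha> * z powr (- \<alpha> - 1)) \<le> \<alpha> * \<delta> powr (- \<alpha> - 1)"
      using \<open>\<alpha> > 0\<close> by (simp add: abs_mult)
  qed (auto simp: s_def t_def)
  also have "\<dots> \<le> \<alpha> * \<delta> powr (- \<alpha> - 1) * dist x x'"
  proof (rule mult_left_mono)
    have "\<bar>dist x y - dist x' y\<bar> \<le> dist x x'"
      using dist_triangle[of x y x'] dist_triangle[of x' y x] by (simp add: dist_commute abs_le_iff)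
    then show "norm (s - t) \<le> dist x x'" unfolding s_def t_def real_norm_def by (auto simp: max_def)
  qed (use assms in auto)
  finally show ?thesis
    by (simp add: riesz_cut_def s_def t_def powr_minus_divide)
qed

lemma continuous_riesz_cut:
  assumes "\<alpha> > 0" "\<delta> > 0"
  shows "continuous_on UNIV (riesz_cut \<alpha> \<delta> x)"
  unfolding riesz_cut_def using assms by (intro continuous_intros) auto

lemma sub_lebesgueD:
  assumes "sub_lebesgue M"
  shows "M \<in> finite_borel_measures" "A \<in> sets borel \<Longrightarrow> emeasure M A \<le> emeasure lborel A"
    "sets M = sets borel" "finite_measure M" "space M = UNIV" "borel_measurable M = borel_measurable borel"
  using assms finite_borel_measuresD[of M] by (auto simp: sub_lebesgue_def)

lemma sub_lebesgue_near:
  fixes M :: "'a::euclidean_space measure" and \<alpha> :: real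
  assumes "sub_lebesgue M" "0 < \<alpha>" "\<alpha> < real DIM('a)" "\<delta> > 0"
  shows "(\<integral>\<^sup>+y. ennreal (riesz \<alpha> x y) * indicator (ball x \<delta>) y \<partial>M)
     \<le> ennreal (ball_vol TYPE('a) * riesz_const \<alpha> DIM('a) * \<delta> powr (DIM('a) - \<alpha>))"
proof (rule nn_integral_riesz_ball)
  fix r :: real assume "r > 0"
  then show "emeasure M (ball x r) \<le> ennreal (ball_vol TYPE('a) * r ^ DIM('a))"
    using sub_lebesgueD(2)[OF assms(1), of "ball x r"] by (simp add: emeasure_ball_eq)
qed (use assms sub_lebesgueD[OF assms(1)] ball_vol_pos[where 'a='a] in auto)

text \<open>The near field of radius \<open>1\<close> plus the total mass: from distance
  \<open>1\<close> on the kernel is at most \<open>1\<close>.\<close>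

definition potential_bound :: "real \<Rightarrow> 'a::euclidean_space measure \<Rightarrow> real" where
  "potential_bound \<alpha> M = ball_vol TYPE('a) * riesz_const \<alpha> DIM('a) + measure M UNIV"

lemma nn_integral_potential_le:
  fixes M :: "'a::euclidean_space measure" and \<alpha> :: real
  assumes M: "sub_lebesgue M" and \<alpha>: "0 < \<alpha>" "\<alpha> < real DIM('a)"
  shows "(\<integral>\<^sup>+y. ennreal (riesz \<alpha> x y) \<partial>M) \<le> ennreal (potential_bound \<alpha> M)"
proof -
  note D = sub_lebesgueD[OF M]
  have [measurable_cong]: "sets M = sets borel" by (rule D)
  have "ennreal (riesz \<alpha> x y) \<le> ennreal (riesz \<alpha> x y) * indicator (ball x 1) y + 1" for y
  proof (cases "y \<in> ball x 1")
    case False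
    then have "1 powr \<alpha> \<le> dist x y powr \<alpha>" using \<alpha> by (intro powr_mono2) auto
    then have "riesz \<alpha> x y \<le> 1" by (simp add: riesz_def divide_le_eq)
    then show ?thesis using False by (simp add: ennreal_le_1)
  qed simp
  then have "(\<integral>\<^sup>+y. ennreal (riesz \<alpha> x y) \<partial>M) \<le> (\<integral>\<^sup>+y. ennreal (riesz \<alpha> x y) * indicator (ball x 1) y + 1 \<partial>M)"
    by (intro nn_integral_mono)
  also have "\<dots> = (\<integral>\<^sup>+y. ennreal (riesz \<alpha> x y) * indicator (ball x 1) y \<partial>M) + emeasure M UNIV"
    by (subst nn_integral_add) (measurable, simp add: D(5))
  also have "\<dots> \<le> ennreal (ball_vol TYPE('a) * riesz_const \<alpha> DIM('a)) + ennreal (measure M UNIV)"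
    using sub_lebesgue_near[OF M \<alpha>, of 1 x] by (intro add_mono) (auto simp: finite_measure.emeasure_eq_measure[OF D(4)])
  also have "\<dots> = ennreal (potential_bound \<alpha> M)"
    unfolding potential_bound_def using \<alpha> ball_vol_pos[where 'a='a] riesz_const_nonneg[OF \<alpha>(2)]
    by (intro ennreal_plus[symmetric]) auto
  finally show ?thesis .
qed

lemma potential_bound_nonneg:
  "\<alpha> < real DIM('a) \<Longrightarrow> 0 \<le> potential_bound \<alpha> (M :: 'a::euclidean_space measure)"
  unfolding potential_bound_def using riesz_const_nonneg[of \<alpha> "real DIM('a)"] ball_vol_pos[where 'a='a]
  by (intro add_nonneg_nonneg mult_nonneg_nonneg) auto

lemma riesz_energy_finite:
  fixes M :: "'a::euclidean_space measure" and \<alpha> :: real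
  assumes M: "sub_lebesgue M" and \<alpha>: "0 < \<alpha>" "\<alpha> < real DIM('a)"
  shows "riesz_energy \<alpha> M < \<infinity>"
proof -
  note D = sub_lebesgueD[OF M]
  have "riesz_energy \<alpha> M \<le> (\<integral>\<^sup>+x. ennreal (potential_bound \<alpha> M) \<partial>M)"
    unfolding riesz_energy_def by (intro nn_integral_mono nn_integral_potential_le M \<alpha>)
  also have "\<dots> < \<infinity>"
    by (simp add: ennreal_mult_less_top finite_measure.emeasure_eq_measure[OF D(4)])
  finally show ?thesis .
qed

text \<open>Truncating the kernel loses at most the near field \<open>b\<close> for each unit of
  mass, and \<open>b\<close> tends to \<open>0\<close> with \<delta> because \<alpha> is below the
  dimension.\<close>

lemma cut_energy_bounds:
  fixes M :: "'a::euclidean_space measure" and \<alpha> :: real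
  assumes M: "sub_lebesgue M" and \<alpha>: "0 < \<alpha>" "\<alpha> < real DIM('a)" and "\<delta> > 0"
  defines "J \<equiv> (\<integral>x. \<integral>y. riesz_cut \<alpha> \<delta> x y \<partial>M \<partial>M)"
  defines "b \<equiv> ball_vol TYPE('a) * riesz_const \<alpha> DIM('a) * \<delta> powr (DIM('a) - \<alpha>)"
  shows "J \<le> enn2real (riesz_energy \<alpha> M)" "enn2real (riesz_energy \<alpha> M) \<le> J + b * measure M UNIV"
proof -
  note D = sub_lebesgueD[OF M]
  interpret finite_measure M by (rule D)
  have [measurable_cong]: "sets M = sets borel" by (rule D)
  define u where "u x = (\<integral>y. riesz_cut \<alpha> \<delta> x y \<partial>M)" for x
  have cb: "\<bar>riesz_cut \<alpha> \<delta> x y\<bar> \<le> 1 / \<delta> powr \<alpha>" for x y :: 'a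
    using riesz_cut_bound[of \<alpha> \<delta> x y] \<alpha> \<open>\<delta> > 0\<close> by simp
  have int: "integrable M (\<lambda>y. riesz_cut \<alpha> \<delta> x y)" for x
    by (rule integrable_bounded_borel[OF D(1) _ cb]) measurable
  have u [measurable]: "u \<in> borel_measurable borel"
    unfolding u_def by measurable
  have u0: "u x \<ge> 0" for x unfolding u_def by (intro integral_nonneg_AE) auto
  have ub: "\<bar>u x\<bar> \<le> 1 / \<delta> powr \<alpha> * measure M UNIV" for x
  proof -
    have "u x \<le> (\<integral>y. 1 / \<delta> powr \<alpha> \<partial>M)" unfolding u_def
      using riesz_cut_bound[of \<alpha> \<delta> x] \<alpha> \<open>\<delta> > 0\<close> by (intro integral_mono int) auto
    then show ?thesis using u0[of x] by (simp add: D(5))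
  qed
  have u_eq: "ennreal (u x) = (\<integral>\<^sup>+y. ennreal (riesz_cut \<alpha> \<delta> x y) \<partial>M)" for x
    unfolding u_def by (rule nn_integral_eq_integral[symmetric]) (use int in auto)
  have J_eq: "ennreal J = (\<integral>\<^sup>+x. ennreal (u x) \<partial>M)"
    unfolding J_def u_def[symmetric]
    by (rule nn_integral_eq_integral[symmetric]) (use integrable_bounded_borel[OF D(1) u ub] u0 in auto)
  have J0: "J \<ge> 0" unfolding J_def u_def[symmetric] using u0 by (intro integral_nonneg_AE) auto
  have b0: "b \<ge> 0" unfolding b_def using riesz_const_nonneg[OF \<alpha>(2)] ball_vol_pos[where 'a='a] by (auto intro!: mult_nonneg_nonneg)
  have W: "ennreal (enn2real (riesz_energy \<alpha> M)) = riesz_energy \<alpha> M"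
    using riesz_energy_finite[OF M \<alpha>] by simp
  have "ennreal J \<le> riesz_energy \<alpha> M"
    unfolding J_eq riesz_energy_def u_eq
  proof (rule nn_integral_mono, rule nn_integral_mono_AE)
    fix x
    have "emeasure M {x} = 0" using D(2)[of "{x}"] by simp
    then have "AE y in M. y \<noteq> x" by (intro AE_I[of _ _ "{x}"]) (auto simp: D)
    then show "AE y in M. ennreal (riesz_cut \<alpha> \<delta> x y) \<le> ennreal (riesz \<alpha> x y)"
      using \<alpha> by (auto intro!: ennreal_leI riesz_cut_le)
  qed
  then show "J \<le> enn2real (riesz_energy \<alpha> M)" using J0 by (subst (asm) W[symmetric]) simp
  have "riesz_energy \<alpha> M \<le> (\<integral>\<^sup>+x. (ennreal (u x) + ennreal b) \<partial>M)"
    unfolding riesz_energy_def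
  proof (intro nn_integral_mono)
    fix x
    have "(\<integral>\<^sup>+y. ennreal (riesz \<alpha> x y) \<partial>M) \<le> (\<integral>\<^sup>+y. ennreal (riesz_cut \<alpha> \<delta> x y) + ennreal (riesz \<alpha> x y) * indicator (ball x \<delta>) y \<partial>M)"
    proof (intro nn_integral_mono)
      fix y
      have "ennreal (riesz \<alpha> x y) \<le> ennreal (riesz_cut \<alpha> \<delta> x y + riesz \<alpha> x y * indicator (ball x \<delta>) y)"
        by (intro ennreal_leI riesz_le_cut)
      also have "\<dots> = ennreal (riesz_cut \<alpha> \<delta> x y) + ennreal (riesz \<alpha> x y) * indicator (ball x \<delta>) y"
        by (auto simp: indicator_def)
      finally show "ennreal (riesz \<alpha> x y) \<le> ennreal (riesz_cut \<alpha> \<delta> x y) + ennreal (riesz \<alpha> x y) * indicator (ball x \<delta>) y" .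
    qed
    also have "\<dots> = ennreal (u x) + (\<integral>\<^sup>+y. ennreal (riesz \<alpha> x y) * indicator (ball x \<delta>) y \<partial>M)"
      unfolding u_eq by (rule nn_integral_add) measurable
    also have "\<dots> \<le> ennreal (u x) + ennreal b"
      unfolding b_def by (intro add_left_mono sub_lebesgue_near M \<alpha> \<open>\<delta> > 0\<close>)
    finally show "(\<integral>\<^sup>+y. ennreal (riesz \<alpha> x y) \<partial>M) \<le> ennreal (u x) + ennreal b" .
  qed
  also have "\<dots> = ennreal J + ennreal b * ennreal (measure M UNIV)"
    unfolding J_eq by (subst nn_integral_add) (auto simp: D(5) emeasure_eq_measure)
  also have "\<dots> = ennreal (J + b * measure M UNIV)"
    using J0 b0 by (simp add: ennreal_mult')
  finally show "enn2real (riesz_energy \<alpha> M) \<le> J + b * measure M UNIV"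
    using J0 b0 by (subst (asm) W[symmetric]) (simp add: ennreal_le_iff del: ennreal_plus)
qed

text \<open>The error on the lower side is the self-interaction that the truncated kernel assigns to
  each particle, \<open>p\<^sup>2 / \<delta> powr \<alpha>\<close>. For fixed \<delta> it disappears
  as \<epsilon> tends to \<open>0\<close>. The error on the upper side is the near field, uniform in
  \<epsilon>.\<close>

lemma discrete_cut_bounds:
  fixes \<mu> :: "'a::euclidean_space measure" and \<alpha> :: real
  assumes \<mu>: "\<mu> \<in> empirical_measures \<epsilon>" and "\<epsilon> > 0" and \<alpha>: "0 < \<alpha>" "\<alpha> < real DIM('a)" and "\<delta> > 0"
  defines "M \<equiv> rescaled \<epsilon> \<mu>" and "p \<equiv> particle_mass TYPE('a) \<epsilon>"
  defines "J \<equiv> (\<integral>x. \<integral>y. riesz_cut \<alpha> \<delta> x y \<partial>M \<partial>M)"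
  defines "b \<equiv> 2 ^ DIM('a) * ball_vol TYPE('a) / packing_density TYPE('a) * riesz_const \<alpha> DIM('a) * \<delta> powr (DIM('a) - \<alpha>)"
  shows "J - p / \<delta> powr \<alpha> * measure M UNIV \<le> pair_energy \<alpha> p (atoms \<mu>)"
    "pair_energy \<alpha> p (atoms \<mu>) \<le> J + b * measure M UNIV"
proof -
  let ?S = "atoms \<mu>"
  have fin: "finite ?S" by (rule finite_atoms_empirical[OF \<mu>])
  have sep: "separated (2 * \<epsilon>) ?S" by (rule empirical_dirac_sum[OF \<mu> \<open>\<epsilon> > 0\<close>])
  have p: "p > 0" unfolding p_def by (rule particle_mass_pos[OF \<open>\<epsilon> > 0\<close>])
  have mass: "measure M UNIV = p * real (card ?S)"
    unfolding M_def p_def by (rule measure_rescaled[OF \<mu> \<open>\<epsilon> > 0\<close>])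
  have inner: "(\<integral>y. riesz_cut \<alpha> \<delta> x y \<partial>M) = p * (\<Sum>y\<in>?S. riesz_cut \<alpha> \<delta> x y)" for x
    unfolding M_def p_def by (rule integral_rescaled[OF \<mu> \<open>\<epsilon> > 0\<close>]) measurable
  have J: "J = p * (\<Sum>x\<in>?S. p * (\<Sum>y\<in>?S. riesz_cut \<alpha> \<delta> x y))"
    unfolding J_def inner unfolding M_def p_def by (rule integral_rescaled[OF \<mu> \<open>\<epsilon> > 0\<close>]) measurable
  have PE: "pair_energy \<alpha> p ?S = p * (\<Sum>x\<in>?S. p * (\<Sum>y\<in>?S. riesz \<alpha> x y))"
    by (simp add: pair_energy_def power2_eq_square sum_distrib_left mult.assoc)
  have "(\<Sum>y\<in>?S. riesz_cut \<alpha> \<delta> x y) \<le> (\<Sum>y\<in>?S. riesz \<alpha> x y) + 1 / \<delta> powr \<alpha>" if "x \<in> ?S" for x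
  proof -
    have "(\<Sum>y\<in>?S. riesz_cut \<alpha> \<delta> x y) \<le> (\<Sum>y\<in>?S. riesz \<alpha> x y + (if y = x then 1 / \<delta> powr \<alpha> else 0))"
      using \<alpha> \<open>\<delta> > 0\<close> riesz_cut_bound[of \<alpha> \<delta> x x] by (intro sum_mono) (auto intro: riesz_cut_le)
    also have "\<dots> = (\<Sum>y\<in>?S. riesz \<alpha> x y) + 1 / \<delta> powr \<alpha>"
      using fin that by (simp add: sum.distrib)
    finally show ?thesis .
  qed
  then have "J \<le> p * (\<Sum>x\<in>?S. p * ((\<Sum>y\<in>?S. riesz \<alpha> x y) + 1 / \<delta> powr \<alpha>))"
    unfolding J using p by (intro mult_left_mono sum_mono) auto
  also have "\<dots> = pair_energy \<alpha> p ?S + p / \<delta> powr \<alpha> * measure M UNIV"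
    unfolding PE mass by (simp add: distrib_left sum.distrib)
  finally show "J - p / \<delta> powr \<alpha> * measure M UNIV \<le> pair_energy \<alpha> p (atoms \<mu>)" by simp
  have "p * (\<Sum>y\<in>?S. riesz \<alpha> x y) \<le> p * (\<Sum>y\<in>?S. riesz_cut \<alpha> \<delta> x y) + b" if "x \<in> ?S" for x
  proof -
    have "(\<Sum>y\<in>?S. riesz \<alpha> x y) \<le> (\<Sum>y\<in>?S. riesz_cut \<alpha> \<delta> x y + riesz \<alpha> x y * indicator (ball x \<delta>) y)"
      by (intro sum_mono riesz_le_cut)
    also have "\<dots> = (\<Sum>y\<in>?S. riesz_cut \<alpha> \<delta> x y) + (\<Sum>y\<in>?S \<inter> ball x \<delta>. riesz \<alpha> x y)"
      using fin by (simp add: sum.distrib sum.inter_restrict indicator_def if_distrib cong: if_cong)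
    finally have "p * (\<Sum>y\<in>?S. riesz \<alpha> x y) \<le> p * ((\<Sum>y\<in>?S. riesz_cut \<alpha> \<delta> x y) + (\<Sum>y\<in>?S \<inter> ball x \<delta>. riesz \<alpha> x y))"
      using p by (intro mult_left_mono) auto
    then show ?thesis
      using particle_mass_near[OF fin sep \<open>\<epsilon> > 0\<close> that \<open>\<delta> > 0\<close> \<alpha>] unfolding p_def b_def by (simp add: distrib_left)
  qed
  then have "pair_energy \<alpha> p ?S \<le> p * (\<Sum>x\<in>?S. p * (\<Sum>y\<in>?S. riesz_cut \<alpha> \<delta> x y) + b)"
    unfolding PE using p by (intro mult_left_mono sum_mono) auto
  also have "\<dots> = J + b * measure M UNIV"
    unfolding J mass by (simp add: distrib_left sum.distrib)
  finally show "pair_energy \<alpha> p (atoms \<mu>) \<le> J + b * measure M UNIV" .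
qed

lemma particle_mass_tendsto:
  assumes "e \<longlonglongrightarrow> 0"
  shows "(\<lambda>n. particle_mass TYPE('a::euclidean_space) (e n)) \<longlonglongrightarrow> 0"
proof -
  have "(\<lambda>n. e n ^ DIM('a) * ball_vol TYPE('a) / packing_density TYPE('a)) \<longlonglongrightarrow> 0 ^ DIM('a) * ball_vol TYPE('a) / packing_density TYPE('a)"
    using packing_density_pos[where 'a='a] by (intro tendsto_intros assms) auto
  then show ?thesis unfolding particle_mass_def by (simp add: zero_power)
qed

lemma pair_energy_tendsto:
  fixes \<mu> :: "nat \<Rightarrow> 'a::euclidean_space measure" and \<alpha> :: real
  assumes \<mu>: "\<And>n. \<mu> n \<in> empirical_measures (e n)" and e: "\<And>n. e n > 0" "e \<longlonglongrightarrow> 0"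
    and \<alpha>: "0 < \<alpha>" "\<alpha> < real DIM('a)" and \<nu>: "sub_lebesgue \<nu>"
    and tight: "tightly_converges (\<lambda>n. rescaled (e n) (\<mu> n)) \<nu>"
  shows "(\<lambda>n. pair_energy \<alpha> (particle_mass TYPE('a) (e n)) (atoms (\<mu> n))) \<longlonglongrightarrow> enn2real (riesz_energy \<alpha> \<nu>)"
proof (rule LIMSEQ_I)
  fix r :: real assume "r > 0"
  let ?M = "\<lambda>n. rescaled (e n) (\<mu> n)"
  let ?p = "\<lambda>n. particle_mass TYPE('a) (e n)"
  obtain m0 where m0: "m0 > 0" "\<And>n. measure (?M n) UNIV \<le> m0"
    using tight_mass_bound[OF tight] by metis
  define m where "m = max m0 (measure \<nu> UNIV)"
  have m: "m > 0" "\<And>n. measure (?M n) UNIV \<le> m" "measure \<nu> UNIV \<le> m"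
    using m0 by (auto simp: m_def le_max_iff_disj)
  define K where "K = (2 ^ DIM('a) * ball_vol TYPE('a) / packing_density TYPE('a) * riesz_const \<alpha> DIM('a)
    + ball_vol TYPE('a) * riesz_const \<alpha> DIM('a)) * m"
  have K12: "0 \<le> 2 ^ DIM('a) * ball_vol TYPE('a) / packing_density TYPE('a) * riesz_const \<alpha> DIM('a)"
     "0 \<le> ball_vol TYPE('a) * riesz_const \<alpha> DIM('a)"
    using ball_vol_pos[where 'a='a] packing_density_pos[where 'a='a] riesz_const_nonneg[OF \<alpha>(2)]
    by (auto intro!: mult_nonneg_nonneg divide_nonneg_nonneg)
  have K: "K \<ge> 0" unfolding K_def by (rule mult_nonneg_nonneg[OF add_nonneg_nonneg[OF K12]]) (use m in auto)
  \<comment> \<open>Solves \<open>(K + 1) * \<delta> powr (DIM('a) - \<alpha>) = r / 2\<close>. As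
    \<open>K\<close> collects the near-field constants of both sides, truncation costs less than
    \<open>r / 2\<close> for all \<open>n\<close> at once. The other half of \<open>r\<close> is
    shared by the truncated energies and the self-interaction, which converge for this fixed
    \<delta>.\<close>
  define \<delta> where "\<delta> = (r / (2 * (K + 1))) powr (1 / (DIM('a) - \<alpha>))"
  have \<delta>: "\<delta> > 0" using \<open>r > 0\<close> K by (simp add: \<delta>_def)
  have "\<delta> powr (DIM('a) - \<alpha>) = r / (2 * (K + 1))"
    using \<open>r > 0\<close> K \<alpha> by (simp add: \<delta>_def powr_powr)
  then have "2 * ((K + 1) * \<delta> powr (DIM('a) - \<alpha>)) = r" using K by (simp add: add_divide_distrib[symmetric] nonzero_divide_eq_eq)
  moreover have "(K + 1) * \<delta> powr (DIM('a) - \<alpha>) = K * \<delta> powr (DIM('a) - \<alpha>) + \<delta> powr (DIM('a) - \<alpha>)"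
    by (simp add: distrib_right)
  moreover have "\<delta> powr (DIM('a) - \<alpha>) > 0" using \<delta> by simp
  ultimately have Kd: "K * \<delta> powr (DIM('a) - \<alpha>) < r / 2" by linarith
  let ?k = "riesz_cut \<alpha> \<delta> :: 'a \<Rightarrow> _"
  let ?J = "\<lambda>n. \<integral>x. \<integral>y. ?k x y \<partial>?M n \<partial>?M n" and ?J' = "\<integral>x. \<integral>y. ?k x y \<partial>\<nu> \<partial>\<nu>"
  have cb: "\<bar>?k x y\<bar> \<le> 1 / \<delta> powr \<alpha>" for x y using riesz_cut_bound[of \<alpha> \<delta> x y] \<alpha> \<delta> by simp
  have "?J \<longlonglongrightarrow> ?J'"
    by (rule tight_double_integral[OF tight sub_lebesgueD(1)[OF \<nu>] _ cb riesz_cut_lipschitz[OF \<alpha>(1) \<delta>] continuous_riesz_cut[OF \<alpha>(1) \<delta>]])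
      (intro finite_borel_rescaled empirical_finite_borel[OF \<mu> e(1)])
  then have 1: "\<forall>\<^sub>F n in sequentially. dist (?J n) ?J' < r / 4"
    using \<open>r > 0\<close> by (intro tendstoD) auto
  have "(\<lambda>n. ?p n / \<delta> powr \<alpha> * m) \<longlonglongrightarrow> 0 / \<delta> powr \<alpha> * m"
    using particle_mass_tendsto[OF e(2)] \<delta> by (intro tendsto_intros) auto
  then have 2: "\<forall>\<^sub>F n in sequentially. ?p n / \<delta> powr \<alpha> * m < r / 4"
    using \<open>r > 0\<close> by (intro order_tendstoD(2)) auto
  have "\<forall>\<^sub>F n in sequentially. norm (pair_energy \<alpha> (?p n) (atoms (\<mu> n)) - enn2real (riesz_energy \<alpha> \<nu>)) < r"
    using 1 2
  proof eventually_elim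
    case (elim n)
    let ?b1 = "2 ^ DIM('a) * ball_vol TYPE('a) / packing_density TYPE('a) * riesz_const \<alpha> DIM('a) * \<delta> powr (DIM('a) - \<alpha>)"
    let ?b2 = "ball_vol TYPE('a) * riesz_const \<alpha> DIM('a) * \<delta> powr (DIM('a) - \<alpha>)"
    have b: "?b1 \<ge> 0" "?b2 \<ge> 0" using mult_nonneg_nonneg[OF K12(1) powr_ge_zero] mult_nonneg_nonneg[OF K12(2) powr_ge_zero] by auto
    have "?b1 * m + ?b2 * m = K * \<delta> powr (DIM('a) - \<alpha>)" by (simp add: K_def algebra_simps)
    moreover have "?b1 * measure (?M n) UNIV \<le> ?b1 * m" "?b2 * measure \<nu> UNIV \<le> ?b2 * m"
      using mult_left_mono[OF m(2) b(1)] mult_left_mono[OF m(3) b(2)] by auto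
    moreover have "?b1 * m \<ge> 0" "?b2 * m \<ge> 0" using mult_nonneg_nonneg[OF b(1)] mult_nonneg_nonneg[OF b(2)] m(1) by (auto simp del: zero_le_divide_iff)
    moreover have "?p n / \<delta> powr \<alpha> * measure (?M n) UNIV \<le> ?p n / \<delta> powr \<alpha> * m"
      using m(2) particle_mass_pos[OF e(1), where 'a='a, of n] by (intro mult_left_mono) auto
    ultimately show ?case
      using discrete_cut_bounds[OF \<mu> e(1) \<alpha> \<delta>, of n] cut_energy_bounds[OF \<nu> \<alpha> \<delta>] elim Kd
      unfolding real_norm_def dist_real_def by linarith
  qed
  then show "\<exists>no. \<forall>n\<ge>no. norm (pair_energy \<alpha> (?p n) (atoms (\<mu> n)) - enn2real (riesz_energy \<alpha> \<nu>)) < r"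
    by (simp add: eventually_sequentially)
qed

section \<open>Extended integrals and the limit energy\<close>

lemma ext_integral_integrable:
  assumes "integrable M f"
  shows "ext_integral M f = ereal (\<integral>x. f x \<partial>M)"
proof -
  have fin: "(\<integral>\<^sup>+x. ennreal (f x) \<partial>M) \<noteq> \<infinity>" "(\<integral>\<^sup>+x. ennreal (- f x) \<partial>M) \<noteq> \<infinity>"
    using assms by (auto simp: real_integrable_def)
  have "enn2ereal a = ereal (enn2real a)" if "a \<noteq> \<infinity>" for a
    using that by (cases a) auto
  then show ?thesis
    using fin real_lebesgue_integral_def[OF assms] by (simp add: ext_integral_def)
qed

lemma ext_integral_not_integrable:
  fixes f :: "'a::euclidean_space \<Rightarrow> real"
  assumes M: "M \<in> finite_borel_measures" and [measurable]: "f \<in> borel_measurable borel" and "\<And>x. L \<le> f x" "\<not> integrable M f"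
  shows "ext_integral M f = \<infinity>"
proof -
  note D = finite_borel_measuresD[OF M]
  have "(\<integral>\<^sup>+x. ennreal (- f x) \<partial>M) \<le> (\<integral>\<^sup>+x. ennreal \<bar>L\<bar> \<partial>M)"
    using assms(3) by (intro nn_integral_mono ennreal_leI) (simp add: order_trans[OF _ abs_ge_minus_self])
  also have "\<dots> < \<infinity>"
    by (simp add: ennreal_mult_less_top finite_measure.emeasure_eq_measure[OF D(2)])
  finally have fin: "(\<integral>\<^sup>+x. ennreal (- f x) \<partial>M) < \<infinity>" .
  then have "(\<integral>\<^sup>+x. ennreal (f x) \<partial>M) = \<infinity>"
    using assms(4) by (auto simp: real_integrable_def D)
  then show ?thesis
    using fin by (cases "\<integral>\<^sup>+x. ennreal (- f x) \<partial>M") (auto simp: ext_integral_def)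
qed

text \<open>The interaction is finite for measures below Lebesgue measure, so adding an infinite
  potential term never meets an opposite infinity.\<close>

lemma limit_T_sub_lebesgue:
  fixes M :: "'a::euclidean_space measure"
  assumes M: "sub_lebesgue M" and \<sigma>: "- real DIM('a) < \<sigma>" "\<sigma> < 0"
  shows "limit_T \<sigma> g M = - ereal (enn2real (riesz_energy (real DIM('a) + \<sigma>) M)) + ext_integral M g"
proof -
  note D = sub_lebesgueD[OF M]
  interpret finite_measure M by (rule D)
  have [measurable_cong]: "sets M = sets borel" by (rule D)
  let ?\<alpha> = "real DIM('a) + \<sigma>"
  have k: "riesz_kernel \<sigma> x y = - riesz ?\<alpha> x y" for x y :: 'a
    by (simp add: riesz_kernel_def riesz_def dist_norm)
  have "(\<integral>\<^sup>+z. ennreal (riesz ?\<alpha> (fst z) (snd z)) \<partial>(M \<Otimes>\<^sub>M M)) = riesz_energy ?\<alpha> M"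
    unfolding riesz_energy_def by (subst nn_integral_fst[symmetric]) simp_all
  moreover have "(\<integral>\<^sup>+z. ennreal (- riesz ?\<alpha> (fst z) (snd z)) \<partial>(M \<Otimes>\<^sub>M M)) = 0"
    by (simp add: ennreal_neg)
  moreover have "enn2ereal (riesz_energy ?\<alpha> M) = ereal (enn2real (riesz_energy ?\<alpha> M))"
    using riesz_energy_finite[OF M, of ?\<alpha>] \<sigma> by (cases "riesz_energy ?\<alpha> M") auto
  ultimately have "ext_integral (M \<Otimes>\<^sub>M M) (\<lambda>(x, y). riesz_kernel \<sigma> x y) = - ereal (enn2real (riesz_energy ?\<alpha> M))"
    by (simp add: ext_integral_def k case_prod_beta zero_ennreal.rep_eq)
  then show ?thesis
    using M by (simp add: limit_T_def sub_lebesgue_def)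
qed

section \<open>Recovery sequences\<close>

text \<open>A quadrature estimate for all test functions at once. The oscillation \<open>w\<close>
  at scale \<tau> is paid twice, for the integral and for the sum, and \<open>B * \<tau>\<close>
  pays for rounding the mass of each cell. The bounds on \<phi> are asked on the ball only, so an
  unbounded potential is admissible.\<close>

definition approximates :: "real \<Rightarrow> real \<Rightarrow> real \<Rightarrow> 'a::euclidean_space set \<Rightarrow> 'a measure \<Rightarrow> bool" where
  "approximates R \<tau> p S \<nu> \<longleftrightarrow>
     (\<forall>\<phi> B w. \<phi> \<in> borel_measurable borel \<longrightarrow> (\<forall>x\<in>cball 0 R. \<bar>\<phi> x\<bar> \<le> B) \<longrightarrow>
        (\<forall>x\<in>cball 0 R. \<forall>y\<in>cball 0 R. dist x y \<le> \<tau> \<longrightarrow> \<bar>\<phi> x - \<phi> y\<bar> \<le> w) \<longrightarrow>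
        \<bar>p * (\<Sum>x\<in>S. \<phi> x) - (\<integral>x. \<phi> x \<partial>\<nu>)\<bar> \<le> (2 * w + B * \<tau>) * measure lborel (cball (0::'a) R))"

text \<open>On a grid of mesh \<open>\<epsilon> * (r + 2)\<close>, every cell receives as many points of a scaled copy of one
  nearly optimal packing of the cube of side \<open>r\<close> as the mass of the cell allows. Fixing \<open>r\<close> first makes the
  relative rounding error small uniformly in \<open>\<epsilon>\<close>.\<close>

lemma recovery_step:
  fixes \<nu> :: "'a::euclidean_space measure"
  assumes \<nu>: "sub_lebesgue \<nu>" and supp: "emeasure \<nu> (- cball 0 R) = 0" and "R \<ge> 0" and "\<tau> > 0"
  shows "\<exists>\<epsilon>0>0. \<forall>\<epsilon>. 0 < \<epsilon> \<longrightarrow> \<epsilon> < \<epsilon>0 \<longrightarrow> (\<exists>S. finite S \<and> separated (2 * \<epsilon>) S \<and> approximates (R + 1) \<tau> (particle_mass TYPE('a) \<epsilon>) S \<nu>)"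
proof -
  note D = sub_lebesgueD[OF \<nu>]
  interpret finite_measure \<nu> by (rule D)
  define d where "d = DIM('a)"
  define C where "C = packing_density TYPE('a)"
  define \<omega> where "\<omega> = ball_vol TYPE('a)"
  have d: "d > 0" by (simp add: d_def)
  have C: "C > 0" by (simp add: C_def packing_density_pos)
  have \<omega>: "\<omega> > 0" by (simp add: \<omega>_def ball_vol_pos)
  \<comment> \<open>For \<open>r \<ge> R0\<close> two relative losses are small: the mass of a
    single particle against the volume of a cell, \<open>\<omega> / (C * (r + 2) ^ d)\<close>, and
    the volume lost by shrinking the side from \<open>r + 2\<close> to \<open>r\<close>, at most
    \<open>2 * d / (r + 2)\<close> by Bernoulli.\<close>
  define R0 where "R0 = 2 * (\<omega> / C + 2 * d) / \<tau>"
  have "(1 - \<tau> / 2) * C < packing_density TYPE('a)" using C \<open>\<tau> > 0\<close> by (simp add: C_def[symmetric])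
  then obtain X :: "'a set" and r where X: "r \<ge> R0" "r > 0" "separated 2 X"
    "(1 - \<tau> / 2) * C * r ^ d < real (card (X \<inter> qcube 0 r)) * \<omega>"
    using packing_density_approx[where 'a='a] unfolding d_def \<omega>_def by blast
  define Y where "Y = X \<inter> qcube 0 r"
  have finY: "finite Y" unfolding Y_def
    by (rule finite_separated_bounded[OF X(3)]) (auto simp: bounded_qcube)
  have R0': "(\<omega> / C + 2 * d) / (r + 2) \<le> \<tau> / 2"
  proof -
    have "2 * (\<omega> / C + 2 * d) \<le> r * \<tau>" using X(1) \<open>\<tau> > 0\<close> by (simp add: R0_def pos_divide_le_eq)
    also have "\<dots> \<le> (r + 2) * \<tau>" using \<open>\<tau> > 0\<close> by (intro mult_right_mono) auto
    finally show ?thesis using X(2) by (simp add: pos_divide_le_eq field_simps)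
  qed
  have split: "(\<omega> / C + 2 * d) / (r + 2) = \<omega> / C / (r + 2) + 2 * d / (r + 2)"
    by (simp add: add_divide_distrib)
  have gap1: "\<omega> / (C * (r + 2) ^ d) \<le> \<tau>"
  proof -
    have "(r + 2) ^ 1 \<le> (r + 2) ^ d" using d X(2) by (intro power_increasing) auto
    then have "\<omega> / C / (r + 2) ^ d \<le> \<omega> / C / (r + 2)" using X(2) C \<omega> by (intro divide_left_mono) auto
    moreover have "2 * d / (r + 2) \<ge> 0" using X(2) by simp
    ultimately have "\<omega> / C / (r + 2) ^ d \<le> \<tau>" using R0' \<open>\<tau> > 0\<close> unfolding split by linarith
    then show ?thesis by simp
  qed
  have gap2: "1 - (1 - \<tau> / 2) * (r / (r + 2)) ^ d \<le> \<tau>"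
  proof -
    have "1 + real d * (- 2 / (r + 2)) \<le> (1 + (- 2 / (r + 2))) ^ d"
      using X(2) by (intro Bernoulli_inequality) (simp add: field_simps)
    also have "1 + (- 2 / (r + 2)) = r / (r + 2)" using X(2) by (simp add: field_simps)
    finally have 1: "1 - 2 * d / (r + 2) \<le> (r / (r + 2)) ^ d" by (simp add: mult.commute)
    have 2: "(r / (r + 2)) ^ d \<le> 1" "0 \<le> (r / (r + 2)) ^ d" using X(2) by (auto intro!: power_le_one)
    have "\<omega> / C / (r + 2) \<ge> 0" using X(2) C \<omega> by simp
    then have 3: "2 * d / (r + 2) \<le> \<tau> / 2" using R0' unfolding split by linarith
    have "\<tau> / 2 * (r / (r + 2)) ^ d \<le> \<tau> / 2 * 1" using 2 \<open>\<tau> > 0\<close> by (intro mult_left_mono) auto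
    then show ?thesis using 1 3 by (simp add: left_diff_distrib)
  qed
  \<comment> \<open>Keeps the diameter of a cell below \<tau>, the scale of the oscillation, and
    below \<open>1\<close>, so that cells meeting \<open>cball 0 R\<close> stay in
    \<open>cball 0 (R + 1)\<close>.\<close>
  define \<epsilon>0 where "\<epsilon>0 = min \<tau> 1 / (real d * (r + 2))"
  show ?thesis
  proof (intro exI[of _ \<epsilon>0] conjI allI impI)
    show "\<epsilon>0 > 0" using \<open>\<tau> > 0\<close> d X(2) by (simp add: \<epsilon>0_def)
    fix \<epsilon> :: real assume \<epsilon>: "0 < \<epsilon>" "\<epsilon> < \<epsilon>0"
    \<comment> \<open>The scaled packing has side \<open>\<epsilon> * r\<close>; the surplus
      \<open>2 * \<epsilon>\<close> keeps the points of different cells separated.\<close>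
    define L where "L = \<epsilon> * (r + 2)"
    have L: "L > 0" using \<epsilon> X(2) by (simp add: L_def)
    have "\<epsilon> * (real d * (r + 2)) < min \<tau> 1"
      using \<epsilon>(2) d X(2) unfolding \<epsilon>0_def by (subst (asm) pos_less_divide_eq) auto
    then have dL: "real DIM('a) * L \<le> \<tau>" "real DIM('a) * L \<le> 1" by (simp_all add: L_def d_def mult_ac)
    define p where "p = particle_mass TYPE('a) \<epsilon>"
    have p: "p > 0" unfolding p_def by (rule particle_mass_pos[OF \<epsilon>(1)])
    have p_eq: "p = \<epsilon> ^ d * \<omega> / C" by (simp add: p_def particle_mass_def d_def \<omega>_def C_def)
    define Z where "Z = corner L ` (cball 0 R :: 'a set)"
    have finZ: "finite Z" unfolding Z_def by (rule finite_corners[OF L bounded_cball])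
    define m where "m c = measure \<nu> (qcube c L)" for c
    define n where "n c = min (card Y) (nat \<lfloor>m c / p\<rfloor>)" for c
    have m_le: "m c \<le> L ^ d" for c
    proof -
      have "emeasure \<nu> (qcube c L) \<le> ennreal (L ^ d)"
        using D(2)[of "qcube c L"] L by (simp add: emeasure_qcube d_def)
      then show ?thesis unfolding m_def using L by (simp add: emeasure_eq_measure)
    qed
    have m0: "m c \<ge> 0" for c by (simp add: m_def)
    have "\<exists>T\<subseteq>(\<lambda>x. c + \<epsilon> *\<^sub>R x) ` Y. finite T \<and> card T = n c" for c
    proof -
      have "card ((\<lambda>x. c + \<epsilon> *\<^sub>R x) ` Y) = card Y"
        using \<epsilon>(1) by (intro card_image) (auto simp: inj_on_def)
      then have "n c \<le> card ((\<lambda>x. c + \<epsilon> *\<^sub>R x) ` Y)" by (simp add: n_def)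
      then obtain T where "T \<subseteq> (\<lambda>x. c + \<epsilon> *\<^sub>R x) ` Y" "card T = n c" "finite T"
        by (rule obtain_subset_with_card_n)
      then show ?thesis by blast
    qed
    then obtain T where T: "\<And>c. T c \<subseteq> (\<lambda>x. c + \<epsilon> *\<^sub>R x) ` Y" "\<And>c. finite (T c)" "\<And>c. card (T c) = n c"
      by metis
    have T_cell: "T c \<subseteq> qcube c L" for c
    proof
      fix y assume "y \<in> T c"
      then obtain x where x: "x \<in> qcube 0 r" "y = c + \<epsilon> *\<^sub>R x" using T(1)[of c] by (auto simp: Y_def)
      have "\<epsilon> * (x \<bullet> b) < \<epsilon> * (r + 2)" "0 \<le> \<epsilon> * (x \<bullet> b)" if "b \<in> Basis" for b
        using x(1) that \<epsilon>(1) by (auto simp: qcube_def intro!: mult_strict_left_mono mult_nonneg_nonneg)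
      then show "y \<in> qcube c L" by (simp add: x(2) qcube_def L_def inner_add_left)
    qed
    have cell: "qcube c L \<subseteq> cball 0 (R + 1)" if "c \<in> Z" for c
    proof
      fix y assume y: "y \<in> qcube c L"
      obtain x where x: "x \<in> cball 0 R" "c = corner L x" using \<open>c \<in> Z\<close> by (auto simp: Z_def)
      have "dist y x \<le> 1"
        using dist_qcube[OF y mem_qcube_corner[OF L, of x, folded x(2)]] dL(2) by linarith
      then show "y \<in> cball 0 (R + 1)"
        using x(1) norm_triangle_ineq2[of y x] by (simp add: dist_norm)
    qed
    have cZ: "c \<in> qcube c L" for c using L by (simp add: qcube_def)
    have disj: "c = c'" if "y \<in> qcube c L" "y \<in> qcube c' L" "c \<in> Z" "c' \<in> Z" for y c c'
    proof -
      from that(3,4) obtain x x' where "c = corner L x" "c' = corner L x'" by (auto simp: Z_def)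
      then show ?thesis using that(1,2) corner_unique[OF L] by metis
    qed
    define S where "S = (\<Union>c\<in>Z. T c)"
    have finS: "finite S" using finZ T(2) by (simp add: S_def)
    have sep: "separated (2 * \<epsilon>) S"
      unfolding separated_def
    proof (intro ballI impI)
      fix y y' assume "y \<in> S" "y' \<in> S" and ne: "y \<noteq> y'"
      then obtain c c' where "c \<in> Z" "c' \<in> Z" "y \<in> T c" "y' \<in> T c'" by (auto simp: S_def)
      moreover from this obtain x x' where "x \<in> Y" "x' \<in> Y" "y = c + \<epsilon> *\<^sub>R x" "y' = c' + \<epsilon> *\<^sub>R x'"
        using T(1)[of c] T(1)[of c'] by blast
      ultimately obtain c c' x x' where *: "c \<in> Z" "c' \<in> Z" "x \<in> Y" "x' \<in> Y" "y = c + \<epsilon> *\<^sub>R x" "y' = c' + \<epsilon> *\<^sub>R x'"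
        by blast
      show "2 * \<epsilon> \<le> dist y y'"
      proof (cases "c = c'")
        case True
        have "2 \<le> dist x x'" using X(3) * ne True by (auto simp: separated_def Y_def)
        then have "\<epsilon> * 2 \<le> \<epsilon> * dist x x'" using \<epsilon>(1) by (intro mult_left_mono) auto
        then show ?thesis using * True \<epsilon>(1) by (simp add: dist_norm scaleR_diff_right[symmetric] mult.commute)
      next
        case False
        then obtain b where b: "b \<in> Basis" "L \<le> \<bar>c \<bullet> b - c' \<bullet> b\<bar>"
          using corner_gap[OF L] *(1,2) by (force simp: Z_def)
        have "0 \<le> x \<bullet> b \<and> x \<bullet> b < r" "0 \<le> x' \<bullet> b \<and> x' \<bullet> b < r"
          using *(3,4) b(1) by (auto simp: Y_def qcube_def)
        then have "\<bar>x \<bullet> b - x' \<bullet> b\<bar> \<le> r" by linarith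
        then have "\<epsilon> * \<bar>x \<bullet> b - x' \<bullet> b\<bar> \<le> \<epsilon> * r" using \<epsilon>(1) by (intro mult_left_mono) auto
        moreover have "\<bar>\<epsilon> * (x \<bullet> b) - \<epsilon> * (x' \<bullet> b)\<bar> = \<epsilon> * \<bar>x \<bullet> b - x' \<bullet> b\<bar>"
          using \<epsilon>(1) by (simp add: right_diff_distrib[symmetric] abs_mult)
        moreover have "\<bar>(y - y') \<bullet> b\<bar> = \<bar>(c \<bullet> b - c' \<bullet> b) + (\<epsilon> * (x \<bullet> b) - \<epsilon> * (x' \<bullet> b))\<bar>"
          using * by (simp add: inner_diff_left inner_add_left)
        moreover have "L = \<epsilon> * r + 2 * \<epsilon>" by (simp add: L_def algebra_simps)
        ultimately have "2 * \<epsilon> \<le> \<bar>(y - y') \<bullet> b\<bar>" using b(2) by linarith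
        also have "\<dots> \<le> dist y y'" unfolding dist_norm by (rule Basis_le_norm[OF b(1)])
        finally show ?thesis .
      qed
    qed
    have mass_up: "p * n c \<le> m c" for c
    proof -
      have "real (n c) \<le> real (nat \<lfloor>m c / p\<rfloor>)" by (simp add: n_def)
      also have "\<dots> \<le> m c / p" using p m0[of c] by (simp add: of_nat_nat)
      finally show ?thesis using p by (simp add: field_simps)
    qed
    \<comment> \<open>If the rounding of \<open>m c / p\<close> decides, less than one particle is
      lost. If the number of available points decides, the near-optimal packing already fills the
      cell up to the fraction \<tau> of its volume, and \<nu> has no more mass there than Lebesgue
      measure.\<close>
    have mass_low: "m c - p * n c \<le> \<tau> * L ^ d" for c
    proof (cases "nat \<lfloor>m c / p\<rfloor> \<le> card Y")
      case True
      have "m c / p - 1 \<le> real (n c)" using True p m0[of c] by (simp add: n_def of_nat_nat)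
      then have "m c - p * n c \<le> p" using p by (simp add: field_simps)
      also have "p = \<omega> / (C * (r + 2) ^ d) * L ^ d" using X(2) by (simp add: p_eq L_def power_mult_distrib)
      also have "\<dots> \<le> \<tau> * L ^ d" using L gap1 by (intro mult_right_mono) auto
      finally show ?thesis .
    next
      case False
      have "(1 - \<tau> / 2) * r ^ d * \<epsilon> ^ d \<le> p * n c"
      proof -
        have "(1 - \<tau> / 2) * r ^ d \<le> real (card Y) * \<omega> / C"
          using X(4) C by (simp add: Y_def pos_le_divide_eq mult_ac)
        then have "(1 - \<tau> / 2) * r ^ d * \<epsilon> ^ d \<le> real (card Y) * \<omega> / C * \<epsilon> ^ d"
          using \<epsilon>(1) by (intro mult_right_mono) auto
        also have "\<dots> = p * n c" using False by (simp add: n_def p_eq)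
        finally show ?thesis .
      qed
      moreover have "(1 - \<tau> / 2) * r ^ d * \<epsilon> ^ d = ((1 - \<tau> / 2) * (r / (r + 2)) ^ d) * L ^ d"
        using X(2) by (simp add: L_def power_mult_distrib power_divide)
      ultimately have "m c - p * n c \<le> (1 - (1 - \<tau> / 2) * (r / (r + 2)) ^ d) * L ^ d"
        using m_le[of c] by (simp add: left_diff_distrib)
      also have "\<dots> \<le> \<tau> * L ^ d" using L gap2 by (intro mult_right_mono) auto
      finally show ?thesis .
    qed
    have vol: "real (card Z) * L ^ d \<le> measure lborel (cball (0::'a) (R + 1))"
    proof -
      have "disjoint_family_on (\<lambda>c. qcube c L) Z" using disj by (auto simp: disjoint_family_on_def)
      then have "measure lborel (\<Union>c\<in>Z. qcube c L) = (\<Sum>c\<in>Z. measure lborel (qcube c L))"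
        using finZ L by (intro measure_finite_Union) (auto simp: emeasure_qcube)
      also have "\<dots> = real (card Z) * L ^ d" using L by (simp add: measure_qcube d_def)
      finally have "real (card Z) * L ^ d = measure lborel (\<Union>c\<in>Z. qcube c L)" by simp
      also have "\<dots> \<le> measure lborel (cball (0::'a) (R + 1))"
        using cell finZ \<open>R \<ge> 0\<close>
        by (intro measure_mono_fmeasurable) (auto intro!: sets.finite_UN simp: fmeasurable_def emeasure_cball)
      finally show ?thesis .
    qed
    have "\<bar>p * (\<Sum>x\<in>S. \<phi> x) - (\<integral>x. \<phi> x \<partial>\<nu>)\<bar> \<le> (2 * w + B * \<tau>) * measure lborel (cball (0::'a) (R + 1))"
      if \<phi> [measurable]: "\<phi> \<in> borel_measurable borel" and B: "\<forall>x\<in>cball 0 (R + 1). \<bar>\<phi> x\<bar> \<le> B"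
        and w: "\<forall>x\<in>cball 0 (R + 1). \<forall>y\<in>cball 0 (R + 1). dist x y \<le> \<tau> \<longrightarrow> \<bar>\<phi> x - \<phi> y\<bar> \<le> w"
      for \<phi> B w
    proof -
      have z: "(0::'a) \<in> cball 0 (R + 1)" using \<open>R \<ge> 0\<close> by simp
      have w0: "w \<ge> 0" using w[rule_format, OF z z] \<open>\<tau> > 0\<close> by simp
      have B0: "B \<ge> 0" using B[rule_format, OF z] by linarith
      have [measurable_cong]: "sets \<nu> = sets borel" by (rule D)
      define I where "I c = (\<integral>x. indicator (qcube c L) x * \<phi> x \<partial>\<nu>)" for c
      have ib: "\<bar>indicator (qcube c L) x * \<phi> x\<bar> \<le> B" if "c \<in> Z" for c x
        using cell[OF that] B B0 by (auto simp: indicator_def)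
      have int: "integrable \<nu> (\<lambda>x. indicator (qcube c L) x * \<phi> x)" if "c \<in> Z" for c
        by (rule integrable_bounded_borel[OF D(1) _ ib[OF that]]) measurable
      have near: "\<bar>\<phi> y - \<phi> c\<bar> \<le> w" if "c \<in> Z" "y \<in> qcube c L" for c y
      proof -
        have "y \<in> cball 0 (R + 1)" "c \<in> cball 0 (R + 1)" using cell[OF that(1)] that(2) cZ[of c] by blast+
        moreover have "dist y c \<le> \<tau>" using dist_qcube[OF that(2) cZ] dL(1) by linarith
        ultimately show ?thesis using w by blast
      qed
      have "\<bar>p * (\<Sum>x\<in>T c. \<phi> x) - I c\<bar> \<le> (2 * w + B * \<tau>) * L ^ d" if c: "c \<in> Z" for c
      proof -
        have intc: "integrable \<nu> (\<lambda>x. indicator (qcube c L) x * b)" for b :: real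
          by (rule integrable_bounded_borel[OF D(1), of _ "\<bar>b\<bar>"]) (auto simp: indicator_def)
        have mc: "(\<integral>x. indicator (qcube c L) x * b \<partial>\<nu>) = b * m c" for b :: real
          by (simp add: m_def D(5))
        have "\<bar>I c - \<phi> c * m c\<bar> = \<bar>\<integral>x. indicator (qcube c L) x * \<phi> x - indicator (qcube c L) x * \<phi> c \<partial>\<nu>\<bar>"
          unfolding I_def mc[symmetric] using int[OF c] intc by simp
        also have "\<dots> \<le> (\<integral>x. \<bar>indicator (qcube c L) x * \<phi> x - indicator (qcube c L) x * \<phi> c\<bar> \<partial>\<nu>)"
          by (rule integral_abs_bound)
        also have "\<dots> \<le> (\<integral>x. indicator (qcube c L) x * w \<partial>\<nu>)"
          using near[OF c] int[OF c] intc by (intro integral_mono) (auto simp: indicator_def)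
        also have "\<dots> = w * m c" by (rule mc)
        also have "\<dots> \<le> w * L ^ d" using m_le w0 by (intro mult_left_mono) auto
        finally have 1: "\<bar>I c - \<phi> c * m c\<bar> \<le> w * L ^ d" .
        have "\<bar>(\<Sum>x\<in>T c. \<phi> x) - real (n c) * \<phi> c\<bar> = \<bar>\<Sum>x\<in>T c. \<phi> x - \<phi> c\<bar>"
          by (simp add: sum_subtractf T(3))
        also have "\<dots> \<le> (\<Sum>x\<in>T c. w)"
          using near[OF c] T_cell[of c] by (intro order_trans[OF sum_abs] sum_mono) auto
        finally have "\<bar>(\<Sum>x\<in>T c. \<phi> x) - real (n c) * \<phi> c\<bar> \<le> n c * w" by (simp add: T(3))
        then have "p * \<bar>(\<Sum>x\<in>T c. \<phi> x) - real (n c) * \<phi> c\<bar> \<le> p * (n c * w)" using p by (intro mult_left_mono) auto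
        moreover have "\<bar>p * (\<Sum>x\<in>T c. \<phi> x) - p * n c * \<phi> c\<bar> = p * \<bar>(\<Sum>x\<in>T c. \<phi> x) - real (n c) * \<phi> c\<bar>"
          using p abs_mult[of p "(\<Sum>x\<in>T c. \<phi> x) - real (n c) * \<phi> c"] by (simp add: right_diff_distrib mult_ac)
        moreover have "p * (n c * w) \<le> L ^ d * w"
          using mass_up[of c] m_le[of c] w0 mult_right_mono[of "p * n c" "L ^ d" w] by (simp add: mult_ac)
        ultimately have 2: "\<bar>p * (\<Sum>x\<in>T c. \<phi> x) - p * n c * \<phi> c\<bar> \<le> w * L ^ d" by (simp add: mult_ac)
        have "\<bar>p * n c * \<phi> c - \<phi> c * m c\<bar> = \<bar>\<phi> c\<bar> * (m c - p * n c)"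
          using mass_up[of c] abs_mult[of "\<phi> c" "p * n c - m c"] by (simp add: right_diff_distrib mult_ac)
        also have "\<dots> \<le> B * (\<tau> * L ^ d)"
          using mass_low[of c] mass_up[of c] B cell[OF c] cZ[of c] B0 by (intro mult_mono) auto
        finally have 3: "\<bar>p * n c * \<phi> c - \<phi> c * m c\<bar> \<le> B * (\<tau> * L ^ d)" .
        have "(2 * w + B * \<tau>) * L ^ d = w * L ^ d + w * L ^ d + B * (\<tau> * L ^ d)" by (simp add: algebra_simps)
        then show ?thesis using 1 2 3 by linarith
      qed
      then have "(\<Sum>c\<in>Z. \<bar>p * (\<Sum>x\<in>T c. \<phi> x) - I c\<bar>) \<le> (\<Sum>c\<in>Z. (2 * w + B * \<tau>) * L ^ d)"
        by (rule sum_mono)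
      also have "\<dots> = (2 * w + B * \<tau>) * (real (card Z) * L ^ d)" by simp
      also have "\<dots> \<le> (2 * w + B * \<tau>) * measure lborel (cball (0::'a) (R + 1))"
        using vol w0 B0 \<open>\<tau> > 0\<close> by (intro mult_left_mono) auto
      finally have main: "(\<Sum>c\<in>Z. \<bar>p * (\<Sum>x\<in>T c. \<phi> x) - I c\<bar>) \<le> \<dots>" .
      have "(\<Sum>x\<in>S. \<phi> x) = (\<Sum>c\<in>Z. \<Sum>x\<in>T c. \<phi> x)"
        unfolding S_def
      proof (rule sum.UNION_disjoint)
        show "\<forall>i\<in>Z. \<forall>j\<in>Z. i \<noteq> j \<longrightarrow> T i \<inter> T j = {}" using disj T_cell by blast
      qed (use finZ T(2) in auto)
      moreover have "(\<integral>x. \<phi> x \<partial>\<nu>) = (\<Sum>c\<in>Z. I c)"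
      proof -
        have "AE x in \<nu>. x \<in> cball 0 R"
          using supp by (intro AE_I[of _ _ "- cball 0 R"]) (auto simp: D)
        then have "AE x in \<nu>. \<phi> x = (\<Sum>c\<in>Z. indicator (qcube c L) x * \<phi> x)"
        proof eventually_elim
          case (elim x)
          have "(\<Sum>c\<in>Z. indicator (qcube c L) x * \<phi> x) = (\<Sum>c\<in>{corner L x}. indicator (qcube c L) x * \<phi> x)"
            using elim finZ disj[OF _ mem_qcube_corner[OF L]]
            by (intro sum.mono_neutral_right) (auto simp: Z_def indicator_def)
          then show ?case using mem_qcube_corner[OF L, of x] by simp
        qed
        then have "(\<integral>x. \<phi> x \<partial>\<nu>) = (\<integral>x. (\<Sum>c\<in>Z. indicator (qcube c L) x * \<phi> x) \<partial>\<nu>)"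
          by (intro integral_cong_AE) auto
        also have "\<dots> = (\<Sum>c\<in>Z. I c)" unfolding I_def using int by (intro Bochner_Integration.integral_sum) auto
        finally show ?thesis .
      qed
      ultimately have eq: "p * (\<Sum>x\<in>S. \<phi> x) - (\<integral>x. \<phi> x \<partial>\<nu>) = (\<Sum>c\<in>Z. p * (\<Sum>x\<in>T c. \<phi> x) - I c)"
        by (simp add: sum_distrib_left sum_subtractf)
      show ?thesis unfolding eq by (rule order_trans[OF sum_abs main])
    qed
    then show "\<exists>S. finite S \<and> separated (2 * \<epsilon>) S \<and> approximates (R + 1) \<tau> (particle_mass TYPE('a) \<epsilon>) S \<nu>"
      using finS sep unfolding approximates_def p_def by blast
  qed
qed

text \<open>For each \<open>k\<close> the previous construction with tolerance
  \<open>1 / (k + 1)\<close> works for all sufficiently small \<epsilon>, so an index at least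
  \<open>k\<close> can be chosen. The map \<kappa> need not be increasing; only its divergence is
  used.\<close>

lemma recovery_sequence:
  fixes \<nu> :: "'a::euclidean_space measure"
  assumes \<nu>: "sub_lebesgue \<nu>" and supp: "emeasure \<nu> (- cball 0 R) = 0" and "R \<ge> 0"
    and e: "\<And>n. e n > 0" "e \<longlonglongrightarrow> 0"
  obtains \<kappa> \<mu> where "filterlim \<kappa> at_top sequentially" "\<And>k. \<mu> k \<in> empirical_measures (e (\<kappa> k))"
    "\<And>\<phi>. continuous_on UNIV \<phi> \<Longrightarrow>
      (\<lambda>k. particle_mass TYPE('a) (e (\<kappa> k)) * (\<Sum>x\<in>atoms (\<mu> k). \<phi> x)) \<longlonglongrightarrow> (\<integral>x. \<phi> x \<partial>\<nu>)"
proof -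
  define \<tau> where "\<tau> k = inverse (real (Suc k))" for k
  define V where "V = measure lborel (cball (0::'a) (R + 1))"
  have "\<exists>n \<mu>. n \<ge> k \<and> \<mu> \<in> empirical_measures (e n) \<and>
     approximates (R + 1) (\<tau> k) (particle_mass TYPE('a) (e n)) (atoms \<mu>) \<nu>" for k
  proof -
    have "\<tau> k > 0" by (simp add: \<tau>_def)
    from recovery_step[OF \<nu> supp \<open>R \<ge> 0\<close> this] obtain \<epsilon>0 where \<epsilon>0: "\<epsilon>0 > 0"
      and rec: "\<And>\<epsilon>. 0 < \<epsilon> \<Longrightarrow> \<epsilon> < \<epsilon>0 \<Longrightarrow> (\<exists>S. finite S \<and> separated (2 * \<epsilon>) S \<and> approximates (R + 1) (\<tau> k) (particle_mass TYPE('a) \<epsilon>) S \<nu>)"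
      by blast
    have "\<forall>\<^sub>F n in sequentially. e n < \<epsilon>0 \<and> n \<ge> k"
      using order_tendstoD(2)[OF e(2) \<epsilon>0] eventually_ge_at_top[of k] by (rule eventually_conj)
    then obtain n where n: "e n < \<epsilon>0" "n \<ge> k" by (auto simp: eventually_sequentially)
    from rec[OF e(1) n(1)] obtain S where S: "finite S" "separated (2 * e n) S"
      and S': "approximates (R + 1) (\<tau> k) (particle_mass TYPE('a) (e n)) S \<nu>"
      by blast
    obtain \<mu> where "\<mu> \<in> empirical_measures (e n)" "atoms \<mu> = S"
      using empirical_measure_exists[OF S] by blast
    then show ?thesis using n(2) S' by (intro exI[of _ n] exI[of _ \<mu>]) simp
  qed
  then obtain \<kappa> \<mu> where \<kappa>: "\<And>k. \<kappa> k \<ge> k" and \<mu>: "\<And>k. \<mu> k \<in> empirical_measures (e (\<kappa> k))"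
    and est: "\<And>k. approximates (R + 1) (\<tau> k) (particle_mass TYPE('a) (e (\<kappa> k))) (atoms (\<mu> k)) \<nu>"
    by metis
  have "(\<lambda>k. particle_mass TYPE('a) (e (\<kappa> k)) * (\<Sum>x\<in>atoms (\<mu> k). \<phi> x)) \<longlonglongrightarrow> (\<integral>x. \<phi> x \<partial>\<nu>)"
    if \<phi>: "continuous_on UNIV \<phi>" for \<phi>
  proof (rule LIMSEQ_I)
    fix s :: real assume "s > 0"
    have V: "V \<ge> 0" by (simp add: V_def)
    have cont: "continuous_on (cball 0 (R + 1)) \<phi>" using \<phi> continuous_on_subset by blast
    have "bounded (\<phi> ` cball 0 (R + 1))"
      by (intro compact_imp_bounded compact_continuous_image cont compact_cball)
    then obtain B where B: "\<forall>x\<in>cball 0 (R + 1). \<bar>\<phi> x\<bar> \<le> B" by (auto simp: bounded_iff)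
    define w where "w = s / (4 * (V + 1))"
    have w: "w > 0" using \<open>s > 0\<close> V by (simp add: w_def)
    have "4 * (V + 1) * w = s" using V by (simp add: w_def)
    then have wV: "2 * w * V < s / 2" using w by (simp add: algebra_simps)
    have "uniformly_continuous_on (cball 0 (R + 1)) \<phi>"
      by (rule compact_uniformly_continuous[OF cont compact_cball])
    from this[unfolded uniformly_continuous_on_def, rule_format, OF w]
    obtain \<delta> where \<delta>: "\<delta> > 0" "\<And>x y. x \<in> cball 0 (R + 1) \<Longrightarrow> y \<in> cball 0 (R + 1) \<Longrightarrow> dist y x < \<delta> \<Longrightarrow> dist (\<phi> y) (\<phi> x) < w"
      by blast
    have \<tau>0: "\<tau> \<longlonglongrightarrow> 0" unfolding \<tau>_def by (rule LIMSEQ_inverse_real_of_nat)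
    have "(\<lambda>k. B * \<tau> k * V) \<longlonglongrightarrow> B * 0 * V" by (intro tendsto_intros \<tau>0)
    then have "\<forall>\<^sub>F k in sequentially. B * \<tau> k * V < s / 2"
      using \<open>s > 0\<close> by (intro order_tendstoD(2)) auto
    with order_tendstoD(2)[OF \<tau>0 \<delta>(1)]
    have "\<forall>\<^sub>F k in sequentially. norm (particle_mass TYPE('a) (e (\<kappa> k)) * (\<Sum>x\<in>atoms (\<mu> k). \<phi> x) - (\<integral>x. \<phi> x \<partial>\<nu>)) < s"
    proof eventually_elim
      case (elim k)
      have "\<bar>particle_mass TYPE('a) (e (\<kappa> k)) * (\<Sum>x\<in>atoms (\<mu> k). \<phi> x) - (\<integral>x. \<phi> x \<partial>\<nu>)\<bar> \<le> (2 * w + B * \<tau> k) * V"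
        unfolding V_def
    proof (rule est[unfolded approximates_def, rule_format])
        show "\<phi> \<in> borel_measurable borel" by (rule borel_measurable_continuous_onI[OF \<phi>])
        show "\<bar>\<phi> x - \<phi> y\<bar> \<le> w" if "x \<in> cball 0 (R + 1)" "y \<in> cball 0 (R + 1)" "dist x y \<le> \<tau> k" for x y
          using \<delta>(2)[OF that(2,1)] that(3) elim(1) by (simp add: dist_real_def)
      qed (use B in blast)
      also have "\<dots> < s" using elim(2) wV by (simp add: distrib_right)
      finally show ?case by simp
    qed
    then show "\<exists>no. \<forall>k\<ge>no. norm (particle_mass TYPE('a) (e (\<kappa> k)) * (\<Sum>x\<in>atoms (\<mu> k). \<phi> x) - (\<integral>x. \<phi> x \<partial>\<nu>)) < s"
      by (simp add: eventually_sequentially)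
  qed
  moreover have "filterlim \<kappa> at_top sequentially"
    using \<kappa> by (rule filterlim_at_top_mono[OF filterlim_ident always_eventually[OF allI]])
  ultimately show ?thesis using \<mu> that by blast
qed

section \<open>Minimality of the limit\<close>

lemma tightly_converges_subseq:
  assumes "tightly_converges \<nu> \<nu>'" "filterlim \<kappa> at_top sequentially"
  shows "tightly_converges (\<lambda>k. \<nu> (\<kappa> k)) \<nu>'"
  using assms unfolding tightly_converges_def
  by (auto intro!: filterlim_compose[where g = "\<lambda>n. \<integral>x. _ x \<partial>\<nu> n", OF _ assms(2)]
        filterlim_compose[where g = "\<lambda>n. measure (\<nu> n) UNIV", OF _ assms(2)])

text \<open>As \<open>g\<close> is unbounded, its integral is only lower semicontinuous along the minimizers, whence the truncation
  at height \<open>K\<close>; along the recovery sequence, whose supports stay bounded, it converges.\<close>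

lemma minimality_bounded_support:
  fixes g :: "'a::euclidean_space \<Rightarrow> real"
  assumes \<sigma>: "- real DIM('a) < \<sigma>" "\<sigma> < 0"
    and g: "continuous_on UNIV g" "\<And>x. l \<le> g x"
    and e: "\<And>n. e n > 0" "e \<longlonglongrightarrow> 0"
    and min: "\<And>n. is_minimizer (discrete_T \<sigma> g (e n)) (\<mu> n)"
    and M: "sub_lebesgue M" and tight: "tightly_converges (\<lambda>n. rescaled (e n) (\<mu> n)) M"
    and \<nu>: "sub_lebesgue \<nu>" and supp: "emeasure \<nu> (- cball 0 R) = 0" and "R \<ge> 0"
  defines "W \<equiv> \<lambda>M :: 'a measure. enn2real (riesz_energy (real DIM('a) + \<sigma>) M)"
  shows "integrable M g" "- W M + (\<integral>x. g x \<partial>M) \<le> - W \<nu> + (\<integral>x. g x \<partial>\<nu>)"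
proof -
  let ?\<alpha> = "real DIM('a) + \<sigma>"
  have \<alpha>: "0 < ?\<alpha>" "?\<alpha> < real DIM('a)" using \<sigma> by auto
  have gm [measurable]: "g \<in> borel_measurable borel" by (rule borel_measurable_continuous_onI[OF g(1)])
  have \<mu>: "\<mu> n \<in> empirical_measures (e n)" for n by (rule discrete_minimizer(1)[OF e(1) gm min])
  note DM = sub_lebesgueD[OF M] and D\<nu> = sub_lebesgueD[OF \<nu>]
  obtain \<kappa> \<mu>' where \<kappa>: "filterlim \<kappa> at_top sequentially" and \<mu>': "\<And>k. \<mu>' k \<in> empirical_measures (e (\<kappa> k))"
    and rec: "\<And>\<phi>. continuous_on UNIV \<phi> \<Longrightarrow>
      (\<lambda>k. particle_mass TYPE('a) (e (\<kappa> k)) * (\<Sum>x\<in>atoms (\<mu>' k). \<phi> x)) \<longlonglongrightarrow> (\<integral>x. \<phi> x \<partial>\<nu>)"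
    using recovery_sequence[OF \<nu> supp \<open>R \<ge> 0\<close> e] by blast
  define f where "f k = e (\<kappa> k)" for k
  define p where "p k = particle_mass TYPE('a) (f k)" for k
  have f: "f k > 0" "f \<longlonglongrightarrow> 0" for k
    using e(1) filterlim_compose[OF e(2) \<kappa>] by (simp_all add: f_def[abs_def])
  have p: "p k > 0" for k unfolding p_def by (rule particle_mass_pos[OF f(1)])
  define \<mu>1 where "\<mu>1 k = \<mu> (\<kappa> k)" for k
  have \<mu>1: "\<mu>1 k \<in> empirical_measures (f k)" for k by (simp add: \<mu>1_def f_def \<mu>)
  have \<mu>2: "\<mu>' k \<in> empirical_measures (f k)" for k by (simp add: f_def \<mu>')
  have tight1: "tightly_converges (\<lambda>k. rescaled (f k) (\<mu>1 k)) M"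
    unfolding f_def \<mu>1_def by (rule tightly_converges_subseq[OF tight \<kappa>])
  have tight2: "tightly_converges (\<lambda>k. rescaled (f k) (\<mu>' k)) \<nu>"
    unfolding tightly_converges_def
  proof (intro conjI allI impI)
    fix \<phi> :: "'a \<Rightarrow> real" assume \<phi>: "continuous_on UNIV \<phi>"
    show "(\<lambda>n. \<integral>x. \<phi> x \<partial>rescaled (f n) (\<mu>' n)) \<longlonglongrightarrow> (\<integral>x. \<phi> x \<partial>\<nu>)"
      using rec[OF \<phi>] by (subst integral_rescaled[OF \<mu>2 f(1) borel_measurable_continuous_onI[OF \<phi>]]) (simp add: f_def)
  next
    show "(\<lambda>n. measure (rescaled (f n) (\<mu>' n)) UNIV) \<longlonglongrightarrow> measure \<nu> UNIV"
      using rec[of "\<lambda>_. 1"] by (subst measure_rescaled[OF \<mu>2 f(1)]) (simp add: f_def D\<nu>(5))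
  qed
  have E1: "(\<lambda>k. pair_energy ?\<alpha> (p k) (atoms (\<mu>1 k))) \<longlonglongrightarrow> W M"
    unfolding p_def W_def by (rule pair_energy_tendsto[OF \<mu>1 f \<alpha> M tight1])
  have E2: "(\<lambda>k. pair_energy ?\<alpha> (p k) (atoms (\<mu>' k))) \<longlonglongrightarrow> W \<nu>"
    unfolding p_def W_def by (rule pair_energy_tendsto[OF \<mu>2 f \<alpha> \<nu> tight2])
  have cmp: "- pair_energy ?\<alpha> (p k) (atoms (\<mu>1 k)) + p k * (\<Sum>x\<in>atoms (\<mu>1 k). g x)
      \<le> - pair_energy ?\<alpha> (p k) (atoms (\<mu>' k)) + p k * (\<Sum>x\<in>atoms (\<mu>' k). g x)" for k
  proof -
    have "discrete_T \<sigma> g (f k) (\<mu>1 k) \<le> discrete_T \<sigma> g (f k) (\<mu>' k)"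
      using min[of "\<kappa> k"] empirical_finite_borel[OF \<mu>2 f(1)] by (auto simp: is_minimizer_def \<mu>1_def f_def)
    then show ?thesis
      by (simp add: discrete_T_empirical[OF \<mu>1 f(1) gm] discrete_T_empirical[OF \<mu>2 f(1) gm] p_def)
  qed
  define a where "a = W M - W \<nu> + (\<integral>x. g x \<partial>\<nu>)"
  define h where "h K x = min (g x) K" for K x
  have hc: "continuous_on UNIV (h K)" for K unfolding h_def by (intro continuous_intros g(1))
  have hm: "h K \<in> borel_measurable borel" for K by (rule borel_measurable_continuous_onI[OF hc])
  have hb: "\<bar>h K x\<bar> \<le> max \<bar>l\<bar> \<bar>K\<bar>" for K x using g(2)[of x] by (auto simp: h_def)
  have hi: "integrable M (h K)" for K by (rule integrable_bounded_borel[OF DM(1) hm hb])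
  have trunc: "(\<integral>x. h K x \<partial>M) \<le> a" for K
  proof -
    have "(\<lambda>k. \<integral>x. h K x \<partial>rescaled (f k) (\<mu>1 k)) \<longlonglongrightarrow> (\<integral>x. h K x \<partial>M)"
      by (rule tight_bounded_continuous[OF tight1 DM(1) finite_borel_rescaled[OF empirical_finite_borel[OF \<mu>1 f(1)]] hc hb])
    then have "(\<lambda>k. - pair_energy ?\<alpha> (p k) (atoms (\<mu>1 k)) + p k * (\<Sum>x\<in>atoms (\<mu>1 k). h K x)) \<longlonglongrightarrow> - W M + (\<integral>x. h K x \<partial>M)"
      using E1 unfolding integral_rescaled[OF \<mu>1 f(1) hm] p_def[symmetric] by (intro tendsto_intros)
    moreover have "(\<lambda>k. - pair_energy ?\<alpha> (p k) (atoms (\<mu>' k)) + p k * (\<Sum>x\<in>atoms (\<mu>' k). g x)) \<longlonglongrightarrow> - W \<nu> + (\<integral>x. g x \<partial>\<nu>)"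
      using E2 rec[OF g(1)] unfolding f_def[symmetric] p_def[symmetric] by (intro tendsto_intros)
    moreover have "- pair_energy ?\<alpha> (p k) (atoms (\<mu>1 k)) + p k * (\<Sum>x\<in>atoms (\<mu>1 k). h K x)
      \<le> - pair_energy ?\<alpha> (p k) (atoms (\<mu>' k)) + p k * (\<Sum>x\<in>atoms (\<mu>' k). g x)" for k
    proof -
      have "p k * (\<Sum>x\<in>atoms (\<mu>1 k). h K x) \<le> p k * (\<Sum>x\<in>atoms (\<mu>1 k). g x)"
        using p[of k] by (intro mult_left_mono sum_mono) (auto simp: h_def)
      then show ?thesis using cmp[of k] by linarith
    qed
    ultimately have "- W M + (\<integral>x. h K x \<partial>M) \<le> - W \<nu> + (\<integral>x. g x \<partial>\<nu>)"
      by (intro LIMSEQ_le) auto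
    then show ?thesis by (simp add: a_def)
  qed
  \<comment> \<open>The bound \<open>a\<close> is independent of the truncation height, so monotone
    convergence yields the integrability of \<open>g\<close> together with the inequality.\<close>
  have "incseq (\<lambda>n. \<integral>x. h (real n) x \<partial>M)"
    by (intro incseq_SucI integral_mono hi) (auto simp: h_def)
  from incseq_convergent[OF this] trunc obtain z
    where z: "(\<lambda>n. \<integral>x. h (real n) x \<partial>M) \<longlonglongrightarrow> z" by blast
  have mono: "AE x in M. mono (\<lambda>n. h (real n) x)" by (auto simp: h_def mono_def)
  have pw: "AE x in M. (\<lambda>n. h (real n) x) \<longlonglongrightarrow> g x"
  proof (intro AE_I2 tendsto_eventually)
    fix x
    have "\<forall>\<^sub>F n in sequentially. g x \<le> real n"
      using filterlim_real_sequentially by (simp add: filterlim_at_top)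
    then show "\<forall>\<^sub>F n in sequentially. h (real n) x = g x" by eventually_elim (simp add: h_def)
  qed
  have gM: "g \<in> borel_measurable M" using gm by (simp add: DM(6))
  show "integrable M g"
    by (rule integrable_monotone_convergence[OF hi mono pw z gM])
  have "(\<integral>x. g x \<partial>M) = z"
    by (rule integral_monotone_convergence[OF hi mono pw z gM])
  moreover have "z \<le> a" by (rule LIMSEQ_le_const2[OF z]) (use trunc in auto)
  ultimately show "- W M + (\<integral>x. g x \<partial>M) \<le> - W \<nu> + (\<integral>x. g x \<partial>\<nu>)" by (simp add: a_def)
qed

text \<open>Frees competitors from the bounded support of the recovery sequences: the restrictions
  to growing balls converge in energy, by monotone convergence for the interaction and by domination
  for the potential term.\<close>

lemma truncation_energy_tendsto:
  fixes \<nu> :: "'a::euclidean_space measure"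
  assumes \<nu>: "sub_lebesgue \<nu>" and \<alpha>: "0 < \<alpha>" "\<alpha> < real DIM('a)"
  defines "r n \<equiv> density \<nu> (indicator (cball 0 (real n)))"
  shows "sub_lebesgue (r n)" "emeasure (r n) (- cball 0 (real n)) = 0"
    "(\<lambda>n. enn2real (riesz_energy \<alpha> (r n))) \<longlonglongrightarrow> enn2real (riesz_energy \<alpha> \<nu>)"
    "integrable \<nu> g \<Longrightarrow> (\<lambda>n. \<integral>x. g x \<partial>r n) \<longlonglongrightarrow> (\<integral>x. (g x :: real) \<partial>\<nu>)"
proof -
  note D = sub_lebesgueD[OF \<nu>]
  interpret finite_measure \<nu> by (rule D)
  have [measurable_cong]: "sets \<nu> = sets borel" by (rule D)
  let ?i = "\<lambda>n :: nat. indicator (cball (0::'a) (real n)) :: 'a \<Rightarrow> ennreal"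
  have cb [measurable]: "cball (0::'a) s \<in> sets borel" for s by simp
  have em: "emeasure (r n) A = emeasure \<nu> (A \<inter> cball 0 (real n))" if "A \<in> sets borel" for A n
    using that unfolding r_def
    by (subst emeasure_density) (auto simp: D(3) indicator_inter_arith[symmetric] Int_commute)
  show "sub_lebesgue (r n)" for n
    unfolding sub_lebesgue_def finite_borel_measures_def
  proof (intro conjI ballI CollectI finite_measureI)
    show "emeasure (r n) A \<le> emeasure lborel A" if "A \<in> sets borel" for A
      using that D(2) emeasure_mono[of "A \<inter> cball 0 (real n)" A \<nu>] by (auto simp: em D(3) intro: order_trans)
    show "emeasure (r n) (space (r n)) \<noteq> \<infinity>"
      using em[of UNIV n] by (simp add: r_def D(5))
  qed (simp add: r_def D(3))
  show "emeasure (r n) (- cball 0 (real n)) = 0" for n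
    by (subst em) auto
  have ev: "\<forall>\<^sub>F n in sequentially. x \<in> cball 0 (real n)" for x :: 'a
  proof -
    have "\<forall>\<^sub>F n in sequentially. norm x \<le> real n"
      using filterlim_real_sequentially by (simp add: filterlim_at_top)
    then show ?thesis by simp
  qed
  define F where "F n z = ?i n (fst z) * (?i n (snd z) * ennreal (riesz \<alpha> (fst z) (snd z)))" for n z
  have Fm [measurable]: "F n \<in> borel_measurable (\<nu> \<Otimes>\<^sub>M \<nu>)" for n unfolding F_def by measurable
  have W: "riesz_energy \<alpha> (r n) = (\<integral>\<^sup>+z. F n z \<partial>(\<nu> \<Otimes>\<^sub>M \<nu>))" for n
  proof -
    have "riesz_energy \<alpha> (r n) = (\<integral>\<^sup>+x. ?i n x * (\<integral>\<^sup>+y. ?i n y * ennreal (riesz \<alpha> x y) \<partial>\<nu>) \<partial>\<nu>)"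
      unfolding riesz_energy_def r_def by (simp add: nn_integral_density)
    also have "\<dots> = (\<integral>\<^sup>+x. (\<integral>\<^sup>+y. F n (x, y) \<partial>\<nu>) \<partial>\<nu>)"
      unfolding F_def by (simp add: nn_integral_cmult)
    finally show ?thesis by (simp add: nn_integral_fst)
  qed
  have W': "riesz_energy \<alpha> \<nu> = (\<integral>\<^sup>+z. ennreal (riesz \<alpha> (fst z) (snd z)) \<partial>(\<nu> \<Otimes>\<^sub>M \<nu>))"
    unfolding riesz_energy_def by (subst nn_integral_fst[symmetric]) simp_all
  have "(\<lambda>n. riesz_energy \<alpha> (r n)) \<longlonglongrightarrow> riesz_energy \<alpha> \<nu>"
    unfolding W W'
  proof (rule nn_integral_LIMSEQ)
    show "incseq F" unfolding F_def by (auto simp: incseq_def le_fun_def indicator_def)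
    show "(\<lambda>n. F n z) \<longlonglongrightarrow> ennreal (riesz \<alpha> (fst z) (snd z))" for z
      using ev[of "fst z"] ev[of "snd z"]
      by (intro tendsto_eventually, eventually_elim) (simp add: F_def)
  qed simp
  then show "(\<lambda>n. enn2real (riesz_energy \<alpha> (r n))) \<longlonglongrightarrow> enn2real (riesz_energy \<alpha> \<nu>)"
    using riesz_energy_finite[OF \<nu> \<alpha>] by (intro tendsto_enn2real) auto
  assume g: "integrable \<nu> g"
  then have [measurable]: "g \<in> borel_measurable \<nu>" by auto
  have "(\<integral>x. g x \<partial>r n) = (\<integral>x. indicator (cball 0 (real n)) x * g x \<partial>\<nu>)" for n
  proof -
    have "r n = density \<nu> (\<lambda>x. ennreal (indicator (cball 0 (real n)) x))"
      unfolding r_def by (simp add: ennreal_indicator)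
    then show ?thesis by (simp add: integral_density)
  qed
  moreover have "(\<lambda>n. \<integral>x. indicator (cball 0 (real n)) x * g x \<partial>\<nu>) \<longlonglongrightarrow> (\<integral>x. g x \<partial>\<nu>)"
  proof (rule integral_dominated_convergence[where w = "\<lambda>x. \<bar>g x\<bar>"])
    show "AE x in \<nu>. (\<lambda>n. indicator (cball 0 (real n)) x * g x) \<longlonglongrightarrow> g x"
    proof (intro AE_I2 tendsto_eventually)
      fix x show "\<forall>\<^sub>F n in sequentially. indicator (cball 0 (real n)) x * g x = g x"
        using ev[of x] by eventually_elim simp
    qed
  qed (use g in \<open>auto simp: indicator_def\<close>)
  ultimately show "(\<lambda>n. \<integral>x. g x \<partial>r n) \<longlonglongrightarrow> (\<integral>x. g x \<partial>\<nu>)" by simp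
qed

lemma limit_T_integrable:
  fixes M :: "'a::euclidean_space measure"
  assumes "sub_lebesgue M" "- real DIM('a) < \<sigma>" "\<sigma> < 0" "integrable M g"
  shows "limit_T \<sigma> g M = ereal (- enn2real (riesz_energy (real DIM('a) + \<sigma>) M) + (\<integral>x. g x \<partial>M))"
  using assms by (simp add: limit_T_sub_lebesgue ext_integral_integrable)

lemma limit_minimality:
  fixes g :: "'a::euclidean_space \<Rightarrow> real"
  assumes \<sigma>: "- real DIM('a) < \<sigma>" "\<sigma> < 0"
    and g: "continuous_on UNIV g" "\<And>x. l \<le> g x"
    and e: "\<And>n. e n > 0" "e \<longlonglongrightarrow> 0"
    and min: "\<And>n. is_minimizer (discrete_T \<sigma> g (e n)) (\<mu> n)"
    and M: "sub_lebesgue M" and tight: "tightly_converges (\<lambda>n. rescaled (e n) (\<mu> n)) M"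
  shows "integrable M g" "is_minimizer (limit_T \<sigma> g) M"
proof -
  let ?\<alpha> = "real DIM('a) + \<sigma>"
  have \<alpha>: "0 < ?\<alpha>" "?\<alpha> < real DIM('a)" using \<sigma> by auto
  have gm: "g \<in> borel_measurable borel" by (rule borel_measurable_continuous_onI[OF g(1)])
  note cmp = minimality_bounded_support[OF \<sigma> g e min M tight]
  \<comment> \<open>Comparison with the zero measure gives the integrability of \<open>g\<close>
    before any other competitor is considered.\<close>
  have null: "sub_lebesgue (null_measure (borel :: 'a measure))"
    by (auto simp: sub_lebesgue_def finite_borel_measures_def intro!: finite_measureI)
  show int: "integrable M g" by (rule cmp(1)[OF null, of 0]) auto
  show "is_minimizer (limit_T \<sigma> g) M"
    unfolding is_minimizer_def
  proof (intro conjI ballI)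
    show "M \<in> finite_borel_measures" by (rule sub_lebesgueD(1)[OF M])
    fix \<nu> :: "'a measure" assume f\<nu>: "\<nu> \<in> finite_borel_measures"
    consider "\<not> sub_lebesgue \<nu>" | "sub_lebesgue \<nu>" "\<not> integrable \<nu> g" | "sub_lebesgue \<nu>" "integrable \<nu> g" by blast
    then show "limit_T \<sigma> g M \<le> limit_T \<sigma> g \<nu>"
    proof cases
      case 1
      then show ?thesis using f\<nu> by (auto simp: limit_T_def sub_lebesgue_def)
    next
      case 2
      then show ?thesis
        by (simp add: limit_T_sub_lebesgue[OF 2(1) \<sigma>] ext_integral_not_integrable[OF f\<nu> gm g(2) 2(2)])
    next
      case 3
      define r where "r n = density \<nu> (indicator (cball 0 (real n)))" for n
      note T = truncation_energy_tendsto[OF 3(1) \<alpha>, folded r_def]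
      have "(\<lambda>n. - enn2real (riesz_energy ?\<alpha> (r n)) + (\<integral>x. g x \<partial>r n))
        \<longlonglongrightarrow> - enn2real (riesz_energy ?\<alpha> \<nu>) + (\<integral>x. g x \<partial>\<nu>)"
        by (intro tendsto_add tendsto_minus T(3) T(4)[OF 3(2)])
      then have "- enn2real (riesz_energy ?\<alpha> M) + (\<integral>x. g x \<partial>M) \<le> - enn2real (riesz_energy ?\<alpha> \<nu>) + (\<integral>x. g x \<partial>\<nu>)"
        by (rule LIMSEQ_le_const) (use cmp(2)[OF T(1,2)] in auto)
      then show ?thesis
        by (simp add: limit_T_integrable[OF M \<sigma> int] limit_T_integrable[OF 3(1) \<sigma> 3(2)])
    qed
  qed
qed

section \<open>Riesz potentials\<close>

text \<open>Signed, because perturbations are. The bound \<open>1\<close> makes the absolute value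
  the density of a measure below Lebesgue measure, so the near-field estimates apply.\<close>

definition profile :: "('a::euclidean_space \<Rightarrow> real) \<Rightarrow> bool" where
  "profile h \<longleftrightarrow> h \<in> borel_measurable borel \<and> integrable lborel h \<and> (\<forall>x. \<bar>h x\<bar> \<le> 1)"

definition potential :: "real \<Rightarrow> ('a::euclidean_space \<Rightarrow> real) \<Rightarrow> 'a \<Rightarrow> real" where
  "potential \<alpha> h x = (LBINT y. riesz \<alpha> x y * h y)"

lemma profileD:
  assumes "profile h"
  shows "h \<in> borel_measurable borel" "integrable lborel h" "\<bar>h x\<bar> \<le> 1"
  using assms by (auto simp: profile_def)

lemma profile_abs: "profile h \<Longrightarrow> profile (\<lambda>x. \<bar>h x\<bar>)"
  by (auto simp: profile_def)

lemma profile_indicator: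
  "A \<in> sets borel \<Longrightarrow> emeasure lborel A < \<infinity> \<Longrightarrow> profile (indicator A)"
  by (auto simp: profile_def indicator_def)

lemma sub_lebesgue_density:
  assumes "profile h" "\<And>x. 0 \<le> h x"
  shows "sub_lebesgue (density lborel (\<lambda>x. ennreal (h x)))"
proof -
  have [measurable]: "h \<in> borel_measurable borel" by (rule profileD[OF assms(1)])
  show ?thesis
    unfolding sub_lebesgue_def finite_borel_measures_def
  proof (intro conjI ballI CollectI finite_measureI)
    have "(\<integral>\<^sup>+x. ennreal (h x) \<partial>lborel) < \<infinity>"
      using profileD(2)[OF assms(1)] assms(2) by (auto simp: real_integrable_def less_top)
    then show "emeasure (density lborel (\<lambda>x. ennreal (h x))) (space (density lborel (\<lambda>x. ennreal (h x)))) \<noteq> \<infinity>"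
      by (simp add: emeasure_density)
    fix A :: "'a set" assume A [measurable]: "A \<in> sets borel"
    have "emeasure (density lborel (\<lambda>x. ennreal (h x))) A = (\<integral>\<^sup>+x. ennreal (h x) * indicator A x \<partial>lborel)"
      by (simp add: emeasure_density)
    also have "\<dots> \<le> (\<integral>\<^sup>+x. 1 * indicator A x \<partial>lborel)"
      using profileD(3)[OF assms(1)] assms(2) by (intro nn_integral_mono mult_right_mono) (auto simp: ennreal_le_1)
    finally show "emeasure (density lborel (\<lambda>x. ennreal (h x))) A \<le> emeasure lborel A" by simp
  qed simp
qed

context
  fixes \<alpha> :: real
  assumes \<alpha>: "0 < \<alpha>" "\<alpha> < real DIM('a::euclidean_space)"
begin

lemma nn_integral_riesz_profile:
  fixes h :: "'a \<Rightarrow> real"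
  assumes h: "profile h"
  obtains P where "P \<ge> 0" "\<And>x. (\<integral>\<^sup>+y. ennreal \<bar>riesz \<alpha> x y * h y\<bar> \<partial>lborel) \<le> ennreal P"
proof -
  have [measurable]: "h \<in> borel_measurable borel" by (rule profileD[OF h])
  let ?M = "density lborel (\<lambda>x. ennreal \<bar>h x\<bar>)"
  have M: "sub_lebesgue ?M" by (intro sub_lebesgue_density profile_abs h) auto
  have "(\<integral>\<^sup>+y. ennreal \<bar>riesz \<alpha> x y * h y\<bar> \<partial>lborel) = (\<integral>\<^sup>+y. ennreal (riesz \<alpha> x y) \<partial>?M)" for x
    by (simp add: nn_integral_density abs_mult ennreal_mult mult.commute)
  then show ?thesis
    using nn_integral_potential_le[OF M \<alpha>] potential_bound_nonneg[OF \<alpha>(2), of ?M] that by simp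
qed

lemma integrable_riesz_profile:
  fixes h :: "'a \<Rightarrow> real"
  assumes h: "profile h"
  shows "integrable lborel (\<lambda>y. riesz \<alpha> x y * h y)"
proof -
  have [measurable]: "h \<in> borel_measurable borel" by (rule profileD[OF h])
  obtain P where "\<And>x. (\<integral>\<^sup>+y. ennreal \<bar>riesz \<alpha> x y * h y\<bar> \<partial>lborel) \<le> ennreal P"
    using nn_integral_riesz_profile[OF h] by metis
  from le_less_trans[OF this ennreal_less_top] show ?thesis
    by (intro integrableI_bounded) auto
qed

lemma potential_bounded:
  fixes h :: "'a \<Rightarrow> real"
  assumes h: "profile h"
  obtains P where "P \<ge> 0" "\<And>x. \<bar>potential \<alpha> h x\<bar> \<le> P"
proof -
  obtain P where P: "P \<ge> 0" "\<And>x. (\<integral>\<^sup>+y. ennreal \<bar>riesz \<alpha> x y * h y\<bar> \<partial>lborel) \<le> ennreal P"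
    using nn_integral_riesz_profile[OF h] by metis
  have "\<bar>potential \<alpha> h x\<bar> \<le> P" for x
  proof -
    have "ennreal \<bar>potential \<alpha> h x\<bar> \<le> (\<integral>\<^sup>+y. ennreal (norm (riesz \<alpha> x y * h y)) \<partial>lborel)"
      unfolding potential_def using integral_norm_bound_ennreal[OF integrable_riesz_profile[OF h, of x]] by simp
    also have "\<dots> \<le> ennreal P" using P(2)[of x] by simp
    finally show ?thesis using P(1) by simp
  qed
  then show ?thesis using that P(1) by blast
qed

lemma potential_measurable:
  fixes h :: "'a \<Rightarrow> real"
  assumes "profile h"
  shows "potential \<alpha> h \<in> borel_measurable borel"
proof -
  have [measurable]: "h \<in> borel_measurable borel" by (rule profileD[OF assms])
  show ?thesis unfolding potential_def by measurable
qed

lemma integrable_mult_potential: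
  fixes h :: "'a \<Rightarrow> real"
  assumes f: "profile f" and h: "profile h"
  shows "integrable lborel (\<lambda>x. f x * potential \<alpha> h x)"
proof -
  obtain P where P: "P \<ge> 0" "\<And>x. \<bar>potential \<alpha> h x\<bar> \<le> P" using potential_bounded[OF h] by metis
  have [measurable]: "f \<in> borel_measurable borel" "potential \<alpha> h \<in> borel_measurable borel"
    using profileD[OF f] potential_measurable[OF h] by auto
  show ?thesis
  proof (rule Bochner_Integration.integrable_bound[where f = "\<lambda>x. P * f x"])
    show "integrable lborel (\<lambda>x. P * f x)" using profileD(2)[OF f] by simp
    show "AE x in lborel. norm (f x * potential \<alpha> h x) \<le> norm (P * f x)"
    proof (intro AE_I2)
      fix x
      have "\<bar>f x\<bar> * \<bar>potential \<alpha> h x\<bar> \<le> \<bar>f x\<bar> * P" using P(2) by (intro mult_left_mono) auto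
      then show "norm (f x * potential \<alpha> h x) \<le> norm (P * f x)" using P(1) by (simp add: abs_mult mult.commute)
    qed
  qed simp
qed

lemma potential_symmetric:
  fixes f h :: "'a \<Rightarrow> real"
  assumes f: "profile f" and h: "profile h"
  shows "(LBINT x. f x * potential \<alpha> h x) = (LBINT x. h x * potential \<alpha> f x)"
proof -
  have [measurable]: "f \<in> borel_measurable borel" "h \<in> borel_measurable borel"
    using profileD[OF f] profileD[OF h] by auto
  define F where "F x y = f x * (riesz \<alpha> x y * h y)" for x y
  have "integrable (lborel \<Otimes>\<^sub>M lborel) (\<lambda>(x, y). F x y)"
  proof (rule lborel_pair.Fubini_integrable)
    show "(\<lambda>(x, y). F x y) \<in> borel_measurable (lborel \<Otimes>\<^sub>M lborel)" unfolding F_def by measurable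
    have "(LBINT y. norm (F x y)) = \<bar>f x\<bar> * potential \<alpha> (\<lambda>y. \<bar>h y\<bar>) x" for x
      unfolding F_def potential_def by (simp add: abs_mult)
    then show "integrable lborel (\<lambda>x. \<integral>y. norm (case (x, y) of (x, y) \<Rightarrow> F x y) \<partial>lborel)"
      using integrable_mult_potential[OF profile_abs[OF f] profile_abs[OF h]] by simp
    show "AE x in lborel. integrable lborel (\<lambda>y. case (x, y) of (x, y) \<Rightarrow> F x y)"
      unfolding F_def using integrable_riesz_profile[OF h] by simp
  qed
  then have "(\<integral>y. \<integral>x. F x y \<partial>lborel \<partial>lborel) = (\<integral>x. \<integral>y. F x y \<partial>lborel \<partial>lborel)"
    by (rule lborel_pair.Fubini_integral)
  moreover have "(LBINT y. F x y) = f x * potential \<alpha> h x" for x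
    unfolding F_def potential_def by simp
  moreover have "(LBINT x. F x y) = h y * potential \<alpha> f y" for y
    unfolding F_def potential_def by (simp add: riesz_commute[of \<alpha> _ y] mult_ac flip: integral_mult_right_zero)
  ultimately show ?thesis by simp
qed

lemma potential_diff:
  fixes f h :: "'a \<Rightarrow> real"
  assumes f: "profile f" and h: "profile h"
  shows "potential \<alpha> (\<lambda>x. f x - h x) x = potential \<alpha> f x - potential \<alpha> h x"
  unfolding potential_def using integrable_riesz_profile[OF f, of x] integrable_riesz_profile[OF h, of x]
  by (simp add: right_diff_distrib)

lemma potential_cmult: "potential \<alpha> (\<lambda>x. c * f x) x = c * potential \<alpha> f x"
  unfolding potential_def by (simp add: mult.left_commute)

text \<open>The truncated kernels have Lipschitz potentials, and these converge uniformly because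
  the near field is bounded independently of the base point. The radii \<open>\<delta> n\<close> are
  chosen to make this error \<open>K / (n + 1)\<close>.\<close>

lemma continuous_potential:
  fixes h :: "'a \<Rightarrow> real"
  assumes h: "profile h"
  shows "continuous_on UNIV (potential \<alpha> h)"
proof -
  have hm [measurable]: "h \<in> borel_measurable borel" by (rule profileD[OF h])
  let ?M = "density lborel (\<lambda>x. ennreal \<bar>h x\<bar>)"
  have M: "sub_lebesgue ?M" by (intro sub_lebesgue_density profile_abs h) auto
  define K where "K = ball_vol TYPE('a) * riesz_const \<alpha> DIM('a)"
  have K: "K \<ge> 0" unfolding K_def using riesz_const_nonneg[OF \<alpha>(2)] ball_vol_pos[where 'a='a] by simp
  define \<delta> where "\<delta> n = (1 / real (Suc n)) powr (1 / (real DIM('a) - \<alpha>))" for n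
  have \<delta>: "\<delta> n > 0" for n by (simp add: \<delta>_def)
  have \<delta>p: "\<delta> n powr (real DIM('a) - \<alpha>) = 1 / real (Suc n)" for n
    using \<alpha> by (simp add: \<delta>_def powr_powr)
  define u where "u n x = (LBINT y. riesz_cut \<alpha> (\<delta> n) x y * h y)" for n x
  have cut_int: "integrable lborel (\<lambda>y. riesz_cut \<alpha> (\<delta> n) x y * h y)" for n x
  proof (rule Bochner_Integration.integrable_bound[where f = "\<lambda>y. 1 / \<delta> n powr \<alpha> * h y"])
    show "integrable lborel (\<lambda>y. 1 / \<delta> n powr \<alpha> * h y)" by (intro integrable_mult_right profileD[OF h])
    show "AE y in lborel. norm (riesz_cut \<alpha> (\<delta> n) x y * h y) \<le> norm (1 / \<delta> n powr \<alpha> * h y)"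
    proof (intro AE_I2)
      fix y
      show "norm (riesz_cut \<alpha> (\<delta> n) x y * h y) \<le> norm (1 / \<delta> n powr \<alpha> * h y)"
        unfolding norm_mult using riesz_cut_bound[OF less_imp_le[OF \<alpha>(1)] \<delta>[of n], of x y] \<delta>[of n]
        by (intro mult_right_mono) auto
    qed
  qed measurable
  have "continuous_on UNIV (u n)" for n
  proof (rule lipschitz_on_continuous_on)
    let ?C = "\<alpha> * \<delta> n powr (- \<alpha> - 1)"
    have "dist (u n x) (u n x') \<le> (?C * (LBINT y. \<bar>h y\<bar>)) * dist x x'" for x x'
    proof -
      have "\<bar>u n x - u n x'\<bar> = \<bar>\<integral>y. riesz_cut \<alpha> (\<delta> n) x y * h y - riesz_cut \<alpha> (\<delta> n) x' y * h y \<partial>lborel\<bar>"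
        unfolding u_def using cut_int by simp
      also have "\<dots> \<le> (LBINT y. \<bar>riesz_cut \<alpha> (\<delta> n) x y * h y - riesz_cut \<alpha> (\<delta> n) x' y * h y\<bar>)"
        by (rule integral_abs_bound)
      also have "\<dots> \<le> (LBINT y. ?C * dist x x' * \<bar>h y\<bar>)"
      proof (rule integral_mono)
        fix y
        have "\<bar>riesz_cut \<alpha> (\<delta> n) x y * h y - riesz_cut \<alpha> (\<delta> n) x' y * h y\<bar> = \<bar>riesz_cut \<alpha> (\<delta> n) x y - riesz_cut \<alpha> (\<delta> n) x' y\<bar> * \<bar>h y\<bar>"
          by (simp add: left_diff_distrib flip: abs_mult)
        also have "\<dots> \<le> ?C * dist x x' * \<bar>h y\<bar>"
          by (intro mult_right_mono riesz_cut_lipschitz \<alpha> \<delta>) auto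
        finally show "\<bar>riesz_cut \<alpha> (\<delta> n) x y * h y - riesz_cut \<alpha> (\<delta> n) x' y * h y\<bar> \<le> ?C * dist x x' * \<bar>h y\<bar>" .
      qed (use cut_int profileD(2)[OF h] in auto)
      also have "\<dots> = (?C * (LBINT y. \<bar>h y\<bar>)) * dist x x'" by simp
      finally show ?thesis by (simp add: dist_real_def)
    qed
    then show "(?C * (LBINT y. \<bar>h y\<bar>))-lipschitz_on UNIV (u n)"
      using \<alpha> by (intro lipschitz_onI) auto
  qed
  moreover have "uniform_limit UNIV u (potential \<alpha> h) sequentially"
  proof (rule uniform_limitI)
    fix r :: real assume "r > 0"
    have err: "dist (u n x) (potential \<alpha> h x) \<le> K / real (Suc n)" for n x
    proof -
      have int: "integrable lborel (\<lambda>y. riesz_cut \<alpha> (\<delta> n) x y * h y - riesz \<alpha> x y * h y)"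
        using cut_int integrable_riesz_profile[OF h] by auto
      have "ennreal \<bar>u n x - potential \<alpha> h x\<bar> = ennreal (norm (LBINT y. riesz_cut \<alpha> (\<delta> n) x y * h y - riesz \<alpha> x y * h y))"
        unfolding u_def potential_def using cut_int integrable_riesz_profile[OF h] by simp
      also have "\<dots> \<le> (\<integral>\<^sup>+y. ennreal (norm (riesz_cut \<alpha> (\<delta> n) x y * h y - riesz \<alpha> x y * h y)) \<partial>lborel)"
        by (rule integral_norm_bound_ennreal[OF int])
      also have "\<dots> \<le> (\<integral>\<^sup>+y. ennreal \<bar>h y\<bar> * (ennreal (riesz \<alpha> x y) * indicator (ball x (\<delta> n)) y) \<partial>lborel)"
      proof (rule nn_integral_mono_AE)
        have "AE y in lborel. y \<noteq> x" by (rule AE_lborel_singleton)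
        then show "AE y in lborel. ennreal (norm (riesz_cut \<alpha> (\<delta> n) x y * h y - riesz \<alpha> x y * h y))
          \<le> ennreal \<bar>h y\<bar> * (ennreal (riesz \<alpha> x y) * indicator (ball x (\<delta> n)) y)"
        proof eventually_elim
          case (elim y)
          have "\<bar>riesz_cut \<alpha> (\<delta> n) x y - riesz \<alpha> x y\<bar> \<le> riesz \<alpha> x y * indicator (ball x (\<delta> n)) y"
            using riesz_cut_le[of \<alpha> x y "\<delta> n"] riesz_le_cut[of \<alpha> x y "\<delta> n"] \<alpha> elim by auto
          then have "\<bar>h y\<bar> * \<bar>riesz_cut \<alpha> (\<delta> n) x y - riesz \<alpha> x y\<bar> \<le> \<bar>h y\<bar> * (riesz \<alpha> x y * indicator (ball x (\<delta> n)) y)"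
            by (intro mult_left_mono) auto
          moreover have "norm (riesz_cut \<alpha> (\<delta> n) x y * h y - riesz \<alpha> x y * h y) = \<bar>h y\<bar> * \<bar>riesz_cut \<alpha> (\<delta> n) x y - riesz \<alpha> x y\<bar>"
            by (simp add: abs_mult[symmetric] algebra_simps)
          ultimately have "norm (riesz_cut \<alpha> (\<delta> n) x y * h y - riesz \<alpha> x y * h y) \<le> \<bar>h y\<bar> * (riesz \<alpha> x y * indicator (ball x (\<delta> n)) y)"
            by simp
          from ennreal_leI[OF this] show ?case
            by (auto simp: indicator_def ennreal_mult)
        qed
      qed
      also have "\<dots> = (\<integral>\<^sup>+y. ennreal (riesz \<alpha> x y) * indicator (ball x (\<delta> n)) y \<partial>?M)"
        by (simp add: nn_integral_density)
      also have "\<dots> \<le> ennreal (K * \<delta> n powr (DIM('a) - \<alpha>))"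
        unfolding K_def by (rule sub_lebesgue_near[OF M \<alpha> \<delta>])
      finally show ?thesis using K by (simp add: \<delta>p dist_real_def)
    qed
    have "(\<lambda>n. K * inverse (real (Suc n))) \<longlonglongrightarrow> K * 0"
      by (intro tendsto_intros LIMSEQ_inverse_real_of_nat)
    then have "\<forall>\<^sub>F n in sequentially. K / real (Suc n) < r"
      using \<open>r > 0\<close> by (intro order_tendstoD(2)) (auto simp: divide_inverse)
    then show "\<forall>\<^sub>F n in sequentially. \<forall>x\<in>UNIV. dist (u n x) (potential \<alpha> h x) < r"
      by eventually_elim (use err le_less_trans in blast)
  qed
  ultimately show ?thesis
    by (intro uniform_limit_theorem[where F = sequentially and f = u]) auto
qed

lemma potential_indicator_pos:
  fixes A :: "'a set"
  assumes A: "A \<in> sets borel" "emeasure lborel A < \<infinity>" "emeasure lborel A > 0"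
  shows "potential \<alpha> (indicator A) x > 0"
proof (rule ccontr)
  have [measurable]: "A \<in> sets borel" by (rule A)
  note p = profile_indicator[OF A(1,2)]
  have nn: "AE y in lborel. 0 \<le> riesz \<alpha> x y * indicator A y" by auto
  assume "\<not> potential \<alpha> (indicator A) x > 0"
  moreover have "(LBINT y. riesz \<alpha> x y * indicator A y) \<ge> 0" by (rule integral_nonneg_AE[OF nn])
  ultimately have "(LBINT y. riesz \<alpha> x y * indicator A y) = 0" by (simp add: potential_def)
  then have "AE y in lborel. riesz \<alpha> x y * indicator A y = 0"
    using integral_nonneg_eq_0_iff_AE[OF integrable_riesz_profile[OF p] nn] by simp
  moreover have "AE y in lborel. y \<noteq> x" by (rule AE_lborel_singleton)
  ultimately have "AE y in lborel. y \<notin> A"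
    by eventually_elim (auto simp: riesz_def indicator_def split: if_splits)
  then have "emeasure lborel A = 0" by (subst (asm) AE_iff_measurable[where N = A]) auto
  then show False using A(3) by simp
qed

lemma riesz_energy_density:
  fixes f :: "'a \<Rightarrow> real"
  assumes f: "profile f" "\<And>x. 0 \<le> f x"
  shows "enn2real (riesz_energy \<alpha> (density lborel (\<lambda>x. ennreal (f x)))) = (LBINT x. f x * potential \<alpha> f x)"
proof -
  have [measurable]: "f \<in> borel_measurable borel" "potential \<alpha> f \<in> borel_measurable borel"
    using profileD[OF f(1)] potential_measurable[OF f(1)] by auto
  have pot: "0 \<le> potential \<alpha> f x" for x unfolding potential_def using f(2) by (intro integral_nonneg_AE) auto
  have "(\<integral>\<^sup>+y. ennreal (f y) * ennreal (riesz \<alpha> x y) \<partial>lborel) = ennreal (potential \<alpha> f x)" for x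
    unfolding potential_def using f(2)
    by (subst nn_integral_eq_integral[symmetric, OF integrable_riesz_profile[OF f(1)]])
      (auto simp: ennreal_mult mult.commute)
  then have "riesz_energy \<alpha> (density lborel (\<lambda>x. ennreal (f x))) = (\<integral>\<^sup>+x. ennreal (f x * potential \<alpha> f x) \<partial>lborel)"
    unfolding riesz_energy_def using f(2) pot by (simp add: nn_integral_density ennreal_mult)
  also have "\<dots> = ennreal (LBINT x. f x * potential \<alpha> f x)"
    using f(2) pot by (intro nn_integral_eq_integral integrable_mult_potential f(1)) auto
  finally show ?thesis using f(2) pot by (simp add: integral_nonneg_AE)
qed

lemma energy_expansion:
  fixes f f' :: "'a \<Rightarrow> real"
  assumes f: "profile f" and f': "profile f'" and \<phi>: "profile \<phi>" and \<phi>_def: "\<And>x. \<phi> x = f' x - f x"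
  shows "(LBINT x. f' x * potential \<alpha> f' x) = (LBINT x. f x * potential \<alpha> f x)
    + 2 * (LBINT x. \<phi> x * potential \<alpha> f x) + (LBINT x. \<phi> x * potential \<alpha> \<phi> x)"
proof -
  have "\<phi> = (\<lambda>x. f' x - f x)" using \<phi>_def by auto
  then have P: "potential \<alpha> \<phi> x = potential \<alpha> f' x - potential \<alpha> f x" for x
    using potential_diff[OF f' f] by simp
  note i = integrable_mult_potential
  have "(LBINT x. \<phi> x * potential \<alpha> \<phi> x) = (\<integral>x. f' x * potential \<alpha> f' x - f' x * potential \<alpha> f x - \<phi> x * potential \<alpha> f x
      + (f x * potential \<alpha> f x - f x * potential \<alpha> f' x) + \<phi> x * potential \<alpha> f x  \<partial>lborel)"
    by (rule Bochner_Integration.integral_cong) (auto simp: P \<phi>_def algebra_simps)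
  also have "\<dots> = (LBINT x. f' x * potential \<alpha> f' x) - (LBINT x. f' x * potential \<alpha> f x)
      + ((LBINT x. f x * potential \<alpha> f x) - (LBINT x. f x * potential \<alpha> f' x))"
    using i[OF f' f'] i[OF f' f] i[OF f f] i[OF f f'] i[OF \<phi> f] by simp
  also have "(LBINT x. f x * potential \<alpha> f' x) = (LBINT x. f' x * potential \<alpha> f x)"
    by (rule potential_symmetric[OF f f'])
  finally have 1: "(LBINT x. \<phi> x * potential \<alpha> \<phi> x) = (LBINT x. f' x * potential \<alpha> f' x)
     - 2 * (LBINT x. f' x * potential \<alpha> f x) + (LBINT x. f x * potential \<alpha> f x)" by simp
  have "(LBINT x. \<phi> x * potential \<alpha> f x) = (LBINT x. f' x * potential \<alpha> f x - f x * potential \<alpha> f x)"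
    by (rule Bochner_Integration.integral_cong) (auto simp: \<phi>_def algebra_simps)
  also have "\<dots> = (LBINT x. f' x * potential \<alpha> f x) - (LBINT x. f x * potential \<alpha> f x)"
    using i[OF f' f] i[OF f f] by simp
  finally show ?thesis using 1 by simp
qed

end

section \<open>First-order conditions\<close>

text \<open>Explains why perturbations are cut off by balls: \<open>g\<close> may be unbounded, but
  it is bounded on each ball.\<close>

lemma integrable_bounded_support:
  fixes g h :: "'a::euclidean_space \<Rightarrow> real"
  assumes g: "continuous_on UNIV g" and h: "profile h" and supp: "\<And>x. h x \<noteq> 0 \<Longrightarrow> x \<in> cball 0 R"
  shows "integrable lborel (\<lambda>x. h x * g x)"
proof -
  have [measurable]: "h \<in> borel_measurable borel" "g \<in> borel_measurable borel"
    using profileD[OF h] borel_measurable_continuous_onI[OF g] by auto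
  have "bounded (g ` cball 0 R)"
    by (intro compact_imp_bounded compact_continuous_image compact_cball continuous_on_subset[OF g]) auto
  then obtain K where "\<forall>y\<in>g ` cball 0 R. norm y \<le> K" unfolding bounded_iff by blast
  then have K: "\<And>x. x \<in> cball 0 R \<Longrightarrow> \<bar>g x\<bar> \<le> K" by auto
  show ?thesis
  proof (rule Bochner_Integration.integrable_bound[where f = "\<lambda>x. K * h x"])
    show "integrable lborel (\<lambda>x. K * h x)" using profileD(2)[OF h] by simp
    show "AE x in lborel. norm (h x * g x) \<le> norm (K * h x)"
    proof (intro AE_I2)
      fix x
      have "\<bar>h x\<bar> * \<bar>g x\<bar> \<le> \<bar>h x\<bar> * \<bar>K\<bar>"
      proof (cases "h x = 0")
        case False
        then show ?thesis using K[OF supp, of x] by (intro mult_left_mono) auto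
      qed simp
      then show "norm (h x * g x) \<le> norm (K * h x)" by (simp add: abs_mult mult.commute)
    qed
  qed measurable
qed

lemma integral_indicator_pos:
  fixes h :: "'a::euclidean_space \<Rightarrow> real"
  assumes A: "A \<in> sets borel" "emeasure lborel A \<noteq> 0" and pos: "\<And>x. x \<in> A \<Longrightarrow> 0 < h x"
    and int: "integrable lborel (\<lambda>x. indicator A x * h x)"
  shows "0 < (LBINT x. indicator A x * h x)"
proof (rule ccontr)
  have nn: "AE x in lborel. 0 \<le> indicator A x * h x"
    using pos by (auto simp: indicator_def intro: less_imp_le)
  assume "\<not> ?thesis"
  then have "(LBINT x. indicator A x * h x) = 0"
    using integral_nonneg_AE[OF nn] by linarith
  then have "AE x in lborel. indicator A x * h x = 0"
    using integral_nonneg_eq_0_iff_AE[OF int nn] by simp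
  then have "AE x in lborel. x \<notin> A"
  proof eventually_elim
    case (elim x)
    then show ?case using pos[of x] by (auto simp: indicator_def)
  qed
  then have "emeasure lborel A = 0" using A(1) by (subst (asm) AE_iff_measurable[where N = A]) auto
  then show False using A(2) by simp
qed

lemma limit_T_density:
  fixes f g :: "'a::euclidean_space \<Rightarrow> real"
  assumes \<sigma>: "- real DIM('a) < \<sigma>" "\<sigma> < 0" and gm: "g \<in> borel_measurable borel"
    and f: "profile f" "\<And>x. 0 \<le> f x" "integrable lborel (\<lambda>x. f x * g x)"
  shows "limit_T \<sigma> g (density lborel (\<lambda>x. ennreal (f x))) =
    ereal (- (LBINT x. f x * potential (real DIM('a) + \<sigma>) f x) + (LBINT x. f x * g x))"
proof -
  let ?M = "density lborel (\<lambda>x. ennreal (f x))"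
  have [measurable]: "f \<in> borel_measurable borel" by (rule profileD[OF f(1)])
  have \<alpha>: "0 < real DIM('a) + \<sigma>" "real DIM('a) + \<sigma> < real DIM('a)" using \<sigma> by auto
  have "integrable ?M g" using f gm by (subst integrable_density) auto
  moreover have "(\<integral>x. g x \<partial>?M) = (LBINT x. f x * g x)" using f(2) gm by (subst integral_density) auto
  ultimately show ?thesis
    by (simp add: limit_T_integrable[OF sub_lebesgue_density[OF f(1,2)] \<sigma>] riesz_energy_density[OF \<alpha> f(1,2)])
qed

text \<open>The energy is quadratic, so the expansion is exact and \<phi> need not be small.
  Polarization uses it with a \<phi> that takes the values \<open>1\<close> and
  \<open>- 1\<close>.\<close>

lemma first_variation:
  fixes f f' g :: "'a::euclidean_space \<Rightarrow> real"
  assumes \<sigma>: "- real DIM('a) < \<sigma>" "\<sigma> < 0" and gm: "g \<in> borel_measurable borel"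
    and f: "profile f" "\<And>x. 0 \<le> f x" "integrable lborel (\<lambda>x. f x * g x)"
    and min: "is_minimizer (limit_T \<sigma> g) (density lborel (\<lambda>x. ennreal (f x)))"
    and \<phi>: "profile \<phi>" "integrable lborel (\<lambda>x. \<phi> x * g x)"
    and adm: "\<And>x. 0 \<le> f x + \<phi> x" "\<And>x. f x + \<phi> x \<le> 1"
  shows "0 \<le> (LBINT x. \<phi> x * (g x - 2 * potential (real DIM('a) + \<sigma>) f x))
     - (LBINT x. \<phi> x * potential (real DIM('a) + \<sigma>) \<phi> x)"
proof -
  let ?U = "potential (real DIM('a) + \<sigma>) :: ('a \<Rightarrow> real) \<Rightarrow> _"
  have \<alpha>: "0 < real DIM('a) + \<sigma>" "real DIM('a) + \<sigma> < real DIM('a)" using \<sigma> by auto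
  define f' where "f' x = f x + \<phi> x" for x
  have f': "profile f'"
    using profileD[OF f(1)] profileD[OF \<phi>(1)] adm unfolding profile_def f'_def by auto
  have f'0: "0 \<le> f' x" for x using adm by (simp add: f'_def)
  have f'g: "integrable lborel (\<lambda>x. f' x * g x)"
    unfolding f'_def using f(3) \<phi>(2) by (simp add: distrib_right)
  have "limit_T \<sigma> g (density lborel (\<lambda>x. ennreal (f x))) \<le> limit_T \<sigma> g (density lborel (\<lambda>x. ennreal (f' x)))"
    using min sub_lebesgueD(1)[OF sub_lebesgue_density[OF f' f'0]] by (auto simp: is_minimizer_def)
  then have "- (LBINT x. f x * ?U f x) + (LBINT x. f x * g x) \<le> - (LBINT x. f' x * ?U f' x) + (LBINT x. f' x * g x)"
    by (simp add: limit_T_density[OF \<sigma> gm f] limit_T_density[OF \<sigma> gm f' f'0 f'g])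
  moreover have "(LBINT x. f' x * ?U f' x) = (LBINT x. f x * ?U f x)
    + 2 * (LBINT x. \<phi> x * ?U f x) + (LBINT x. \<phi> x * ?U \<phi> x)"
    by (rule energy_expansion[OF \<alpha> f(1) f' \<phi>(1)]) (simp add: f'_def)
  moreover have "(LBINT x. f' x * g x) = (LBINT x. f x * g x) + (LBINT x. \<phi> x * g x)"
    unfolding f'_def using f(3) \<phi>(2) by (simp add: distrib_right)
  moreover have "(LBINT x. \<phi> x * (g x - 2 * ?U f x)) = (LBINT x. \<phi> x * g x - 2 * (\<phi> x * ?U f x))"
    by (rule Bochner_Integration.integral_cong) (auto simp: algebra_simps)
  moreover have "\<dots> = (LBINT x. \<phi> x * g x) - 2 * (LBINT x. \<phi> x * ?U f x)"
    using \<phi>(2) integrable_mult_potential[OF \<alpha> \<phi>(1) f(1)] by simp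
  ultimately show ?thesis by linarith
qed

text \<open>The interaction energy is strictly concave along \<open>f + s * indicator A\<close>, hence such a perturbation must
  increase the energy strictly to first order.\<close>

lemma no_neutral_perturbation:
  fixes f g :: "'a::euclidean_space \<Rightarrow> real"
  assumes \<sigma>: "- real DIM('a) < \<sigma>" "\<sigma> < 0" and g: "continuous_on UNIV g"
    and f: "profile f" "\<And>x. 0 \<le> f x" "integrable lborel (\<lambda>x. f x * g x)"
    and min: "is_minimizer (limit_T \<sigma> g) (density lborel (\<lambda>x. ennreal (f x)))"
    and A: "A \<in> sets borel" "A \<subseteq> cball 0 R" and s: "s \<noteq> 0"
    and adm: "\<And>x. x \<in> A \<Longrightarrow> 0 \<le> f x + s" "\<And>x. x \<in> A \<Longrightarrow> f x + s \<le> 1"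
    and neg: "\<And>x. x \<in> A \<Longrightarrow> s * (g x - 2 * potential (real DIM('a) + \<sigma>) f x) \<le> 0"
  shows "emeasure lborel A = 0"
proof (rule ccontr)
  assume ne: "emeasure lborel A \<noteq> 0"
  let ?U = "potential (real DIM('a) + \<sigma>) :: ('a \<Rightarrow> real) \<Rightarrow> _"
  have \<alpha>: "0 < real DIM('a) + \<sigma>" "real DIM('a) + \<sigma> < real DIM('a)" using \<sigma> by auto
  have fin: "emeasure lborel A < \<infinity>"
    using emeasure_bounded_finite[of A] bounded_subset[OF bounded_cball A(2)] by auto
  have pos: "?U (indicator A) x > 0" for x
    using ne by (intro potential_indicator_pos[OF \<alpha> A(1) fin]) (simp add: zero_less_iff_neq_zero)
  note pA = profile_indicator[OF A(1) fin]
  obtain a where a: "a \<in> A" using ne by fastforce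
  have s1: "\<bar>s\<bar> \<le> 1"
    using adm[OF a] f(2)[of a] profileD(3)[OF f(1), of a] by linarith
  define \<phi> where "\<phi> x = s * indicator A x" for x :: 'a
  have p\<phi>: "profile \<phi>"
    unfolding profile_def
  proof (intro conjI allI)
    show "\<phi> \<in> borel_measurable borel" "integrable lborel \<phi>"
      unfolding \<phi>_def using profileD(1,2)[OF pA] by simp_all
    show "\<bar>\<phi> x\<bar> \<le> 1" for x using s1 by (simp add: \<phi>_def indicator_def)
  qed
  have "integrable lborel (\<lambda>x. \<phi> x * g x)"
    by (rule integrable_bounded_support[OF g p\<phi>, of R]) (use A(2) in \<open>auto simp: \<phi>_def indicator_def split: if_splits\<close>)
  moreover have "0 \<le> f x + \<phi> x" "f x + \<phi> x \<le> 1" for x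
    using adm[of x] f(2)[of x] profileD(3)[OF f(1), of x] by (auto simp: \<phi>_def indicator_def)
  ultimately have "0 \<le> (LBINT x. \<phi> x * (g x - 2 * ?U f x)) - (LBINT x. \<phi> x * ?U \<phi> x)"
    by (intro first_variation[OF \<sigma> borel_measurable_continuous_onI[OF g] f min p\<phi>])
  moreover have "(LBINT x. \<phi> x * (g x - 2 * ?U f x)) \<le> 0"
  proof -
    have "0 \<le> (LBINT x. - (\<phi> x * (g x - 2 * ?U f x)))"
      using neg by (intro integral_nonneg_AE AE_I2) (auto simp: \<phi>_def indicator_def)
    then show ?thesis by simp
  qed
  moreover have "(LBINT x. \<phi> x * ?U \<phi> x) = s\<^sup>2 * (LBINT x. indicator A x * ?U (indicator A) x)"
  proof -
    have "?U \<phi> x = s * ?U (indicator A) x" for x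
      unfolding \<phi>_def by (rule potential_cmult[OF \<alpha>])
    then have "(LBINT x. \<phi> x * ?U \<phi> x) = (LBINT x. s\<^sup>2 * (indicator A x * ?U (indicator A) x))"
      by (simp add: \<phi>_def power2_eq_square mult_ac)
    then show ?thesis by simp
  qed
  moreover have "(LBINT x. indicator A x * ?U (indicator A) x) > 0"
    by (rule integral_indicator_pos[OF A(1) ne pos integrable_mult_potential[OF \<alpha> pA pA]])
  moreover have "s\<^sup>2 > 0" using s by simp
  ultimately show False using mult_pos_pos[of "s\<^sup>2" "\<integral>x. indicator A x * ?U (indicator A) x \<partial>lborel"] by linarith
qed

lemma first_order_conditions:
  fixes f g :: "'a::euclidean_space \<Rightarrow> real"
  assumes \<sigma>: "- real DIM('a) < \<sigma>" "\<sigma> < 0" and g: "continuous_on UNIV g"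
    and f: "profile f" "\<And>x. 0 \<le> f x" "integrable lborel (\<lambda>x. f x * g x)"
    and min: "is_minimizer (limit_T \<sigma> g) (density lborel (\<lambda>x. ennreal (f x)))"
  defines "v \<equiv> \<lambda>x. g x - 2 * potential (real DIM('a) + \<sigma>) f x"
  shows "AE x in lborel. (f x < 1 \<longrightarrow> 0 < v x) \<and> (0 < f x \<longrightarrow> v x < 0)"
proof -
  have \<alpha>: "0 < real DIM('a) + \<sigma>" "real DIM('a) + \<sigma> < real DIM('a)" using \<sigma> by auto
  have [measurable]: "f \<in> borel_measurable borel" "v \<in> borel_measurable borel"
    unfolding v_def using profileD(1)[OF f(1)] potential_measurable[OF \<alpha> f(1)] borel_measurable_continuous_onI[OF g] by auto
  note nnp = no_neutral_perturbation[OF \<sigma> g f min, folded v_def]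
  define t where "t k = 1 / real (Suc k)" for k
  have t: "t k > 0" for k by (simp add: t_def)
  \<comment> \<open>On \<open>A k\<close> the density can be raised by \<open>t k\<close>, on
    \<open>B k\<close> lowered by \<open>t k\<close>, without leaving the interval from
    \<open>0\<close> to \<open>1\<close>. Both sets include the points with \<open>v x = 0\<close>,
    whence the strict conclusions. Over all \<open>k\<close> they exhaust the exceptional
    points.\<close>
  define A where "A k = {x. f x \<le> 1 - t k \<and> v x \<le> 0} \<inter> cball 0 (real k)" for k
  define B where "B k = {x. t k \<le> f x \<and> 0 \<le> v x} \<inter> cball 0 (real k)" for k
  have Am: "A k \<in> sets borel" and Bm: "B k \<in> sets borel" for k
    unfolding A_def B_def by (auto intro!: sets.Int)
  have "emeasure lborel (A k) = 0" for k
    by (rule nnp[OF Am, of _ "real k" "t k"])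
      (use t[of k] f(2) in \<open>auto simp: A_def v_def intro: mult_nonneg_nonpos add_nonneg_nonneg less_imp_le\<close>)
  then have "A k \<in> null_sets lborel" for k using Am by auto
  then have A: "(\<Union>k. A k) \<in> null_sets lborel" by (intro null_sets_UN)
  have "emeasure lborel (B k) = 0" for k
  proof (rule nnp[OF Bm, of _ "real k" "- t k"])
    show "f x + - t k \<le> 1" for x using t[of k] profileD(3)[OF f(1), of x] by linarith
  qed (use t[of k] in \<open>auto simp: B_def v_def intro!: mult_nonneg_nonneg less_imp_le[OF t]\<close>)
  then have "B k \<in> null_sets lborel" for k using Bm by auto
  then have B: "(\<Union>k. B k) \<in> null_sets lborel" by (intro null_sets_UN)
  have large: "\<exists>k. t k \<le> a \<and> norm x \<le> real k" if "a > 0" for a and x :: 'a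
  proof -
    obtain k :: nat where k: "max (1 / a) (norm x) \<le> real k" using real_arch_simple by blast
    then have "1 / a \<le> real (Suc k)" by simp
    then have "t k \<le> a" using \<open>a > 0\<close> by (simp add: t_def divide_le_eq field_simps)
    then show ?thesis using k by auto
  qed
  show ?thesis
    using AE_not_in[OF A] AE_not_in[OF B]
  proof eventually_elim
    case (elim x)
    have "0 < v x" if "f x < 1"
    proof (rule ccontr)
      assume "\<not> 0 < v x"
      moreover obtain k where "t k \<le> 1 - f x" "norm x \<le> real k" using large[of "1 - f x" x] \<open>f x < 1\<close> by auto
      ultimately have "x \<in> A k" by (auto simp: A_def)
      then show False using elim(1) by blast
    qed
    moreover have "v x < 0" if "0 < f x"
    proof (rule ccontr)
      assume "\<not> v x < 0"
      moreover obtain k where "t k \<le> f x" "norm x \<le> real k" using large[of "f x" x] \<open>0 < f x\<close> by auto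
      ultimately have "x \<in> B k" by (auto simp: B_def)
      then show False using elim(2) by blast
    qed
    ultimately show ?case by blast
  qed
qed

lemma potential_cong_AE:
  assumes [measurable]: "f \<in> borel_measurable borel" "h \<in> borel_measurable borel"
    and "AE y in lborel. f y = h y"
  shows "potential \<alpha> f x = potential \<alpha> h x"
  unfolding potential_def
proof (rule integral_cong_AE)
  show "AE y in lborel. riesz \<alpha> x y * f y = riesz \<alpha> x y * h y"
    using assms(3) by eventually_elim simp
qed measurable

text \<open>Taking the sublevel set of the potential of \<open>f\<close>, not the set where
  \<open>f\<close> is \<open>1\<close>, fixes the representative: a change on a null set does not
  alter the potential at any point, so \<open>E\<close> is exactly the sublevel set given by its own
  potential.\<close>

lemma minimizer_is_indicator:
  fixes f g :: "'a::euclidean_space \<Rightarrow> real"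
  assumes \<sigma>: "- real DIM('a) < \<sigma>" "\<sigma> < 0" and g: "continuous_on UNIV g"
    and f: "profile f" "\<And>x. 0 \<le> f x" "integrable lborel (\<lambda>x. f x * g x)"
    and min: "is_minimizer (limit_T \<sigma> g) (density lborel (\<lambda>x. ennreal (f x)))"
  obtains E where "E \<in> sets borel" "emeasure lborel E < \<infinity>"
    "density lborel (\<lambda>x. ennreal (f x)) = density lborel (indicator E)"
    "integrable lborel (\<lambda>x. indicator E x * g x)"
    "E = {x. g x < 2 * potential (real DIM('a) + \<sigma>) (indicator E) x}"
    "AE x in lborel. g x \<noteq> 2 * potential (real DIM('a) + \<sigma>) (indicator E) x"
proof -
  let ?U = "potential (real DIM('a) + \<sigma>) :: ('a \<Rightarrow> real) \<Rightarrow> _"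
  have \<alpha>: "0 < real DIM('a) + \<sigma>" "real DIM('a) + \<sigma> < real DIM('a)" using \<sigma> by auto
  have [measurable]: "f \<in> borel_measurable borel" "?U f \<in> borel_measurable borel" "g \<in> borel_measurable borel"
    using profileD(1)[OF f(1)] potential_measurable[OF \<alpha> f(1)] borel_measurable_continuous_onI[OF g] by auto
  note foc = first_order_conditions[OF \<sigma> g f min]
  define E where "E = {x. g x < 2 * ?U f x}"
  have E [measurable]: "E \<in> sets borel" unfolding E_def by measurable
  have feq: "AE x in lborel. f x = indicator E x"
    using foc
  proof eventually_elim
    case (elim x)
    then show ?case using f(2)[of x] profileD(3)[OF f(1), of x] by (auto simp: E_def indicator_def)
  qed
  have U: "?U (indicator E) x = ?U f x" for x
    by (rule potential_cong_AE) (use feq in \<open>auto elim: AE_mp\<close>)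
  have dens: "density lborel (\<lambda>x. ennreal (f x)) = density lborel (indicator E)"
  proof (rule density_cong)
    show "AE x in lborel. ennreal (f x) = indicator E x"
      using feq by eventually_elim (simp add: ennreal_indicator)
  qed auto
  have int: "integrable lborel (\<lambda>x. indicator E x * g x)"
    by (rule integrable_cong_AE_imp[OF f(3)]) (use feq in \<open>auto elim!: eventually_mono\<close>)
  have "emeasure lborel E = (\<integral>\<^sup>+x. ennreal (f x) \<partial>lborel)"
  proof -
    have "emeasure lborel E = (\<integral>\<^sup>+x. indicator E x \<partial>lborel)" by simp
    also have "\<dots> = (\<integral>\<^sup>+x. ennreal (f x) \<partial>lborel)"
      by (rule nn_integral_cong_AE) (use feq in \<open>auto elim!: eventually_mono simp: ennreal_indicator\<close>)
    finally show ?thesis .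
  qed
  also have "\<dots> < \<infinity>" using profileD(2)[OF f(1)] by (auto simp: real_integrable_def less_top)
  finally have fin: "emeasure lborel E < \<infinity>" .
  have "AE x in lborel. g x \<noteq> 2 * ?U (indicator E) x"
    using foc unfolding U
  proof eventually_elim
    case (elim x)
    then show ?case using f(2)[of x] by (cases "f x < 1") auto
  qed
  moreover have "E = {x. g x < 2 * ?U (indicator E) x}" unfolding U by (simp add: E_def)
  ultimately show ?thesis by (intro that[OF E fin dens int])
qed

section \<open>Polarization\<close>

definition hyper_reflect :: "'a::euclidean_space \<Rightarrow> real \<Rightarrow> 'a \<Rightarrow> 'a" where
  "hyper_reflect e t x = x - (2 * (x \<bullet> e - t)) *\<^sub>R e"

text \<open>\<open>one_sided e t (- E)\<close> consists of the points that polarization adds to \<open>E\<close>.\<close>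

definition one_sided :: "'a::euclidean_space \<Rightarrow> real \<Rightarrow> 'a set \<Rightarrow> 'a set" where
  "one_sided e t E = {x. t \<le> x \<bullet> e \<and> x \<in> E \<and> hyper_reflect e t x \<notin> E}"

context
  fixes e :: "'a::euclidean_space" and t :: real
  assumes e: "norm e = 1"
begin

lemma inner_unit: "e \<bullet> e = 1"
  using e by (simp add: dot_square_norm)

lemma hyper_reflect_inner: "hyper_reflect e t x \<bullet> e = 2 * t - x \<bullet> e"
  by (simp add: hyper_reflect_def inner_diff_left inner_unit)

lemma hyper_reflect_involution [simp]: "hyper_reflect e t (hyper_reflect e t x) = x"
  unfolding hyper_reflect_def[of e t "hyper_reflect e t x"] hyper_reflect_inner
  by (simp add: hyper_reflect_def algebra_simps)

lemma hyper_reflect_fixed: "x \<bullet> e = t \<Longrightarrow> hyper_reflect e t x = x"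
  by (simp add: hyper_reflect_def)

lemma continuous_hyper_reflect: "continuous_on UNIV (hyper_reflect e t)"
  unfolding hyper_reflect_def by (intro continuous_intros)

lemma hyper_reflect_measurable [measurable]: "hyper_reflect e t \<in> borel_measurable borel"
  using continuous_hyper_reflect by (rule borel_measurable_continuous_onI)

text \<open>The sign of the correction tells whether the points lie on the same side: if so,
  reflecting one of them increases the distance. The comparisons of kernels and of norms under
  polarization both come from this identity.\<close>

lemma dist_hyper_reflect_left:
  "(dist (hyper_reflect e t x) y)\<^sup>2 = (dist x y)\<^sup>2 + 4 * ((x \<bullet> e - t) * (y \<bullet> e - t))"
proof -
  have "(dist (hyper_reflect e t x) y)\<^sup>2 = (x - y - (2 * (x \<bullet> e - t)) *\<^sub>R e) \<bullet> (x - y - (2 * (x \<bullet> e - t)) *\<^sub>R e)"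
    by (simp add: hyper_reflect_def dist_norm power2_norm_eq_inner algebra_simps)
  also have "\<dots> = (x - y) \<bullet> (x - y) - 2 * (2 * (x \<bullet> e - t)) * ((x - y) \<bullet> e) + (2 * (x \<bullet> e - t))\<^sup>2"
    by (simp add: inner_diff_left inner_diff_right inner_unit inner_commute power2_eq_square algebra_simps)
  also have "\<dots> = (dist x y)\<^sup>2 + 4 * ((x \<bullet> e - t) * (y \<bullet> e - t))"
    unfolding dist_norm power2_norm_eq_inner by (simp add: power2_eq_square inner_diff_left algebra_simps)
  finally show ?thesis .
qed

lemma dist_hyper_reflect: "dist (hyper_reflect e t x) (hyper_reflect e t y) = dist x y"
proof -
  have "(dist (hyper_reflect e t x) (hyper_reflect e t y))\<^sup>2 = (dist (hyper_reflect e t y) x)\<^sup>2 - 4 * ((x \<bullet> e - t) * (y \<bullet> e - t))"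
    unfolding dist_hyper_reflect_left[of x "hyper_reflect e t y"] hyper_reflect_inner
    by (simp add: dist_commute algebra_simps)
  also have "\<dots> = (dist x y)\<^sup>2" unfolding dist_hyper_reflect_left by (simp add: dist_commute mult.commute)
  finally show ?thesis by (simp add: power2_eq_iff_nonneg)
qed

lemma riesz_hyper_reflect: "riesz \<alpha> (hyper_reflect e t x) (hyper_reflect e t y) = riesz \<alpha> x y"
  by (simp add: riesz_def dist_hyper_reflect)

lemma distr_hyper_reflect: "distr lborel borel (hyper_reflect e t) = lborel"
proof -
  let ?f = "\<lambda>x :: 'a. x - (2 * (x \<bullet> e)) *\<^sub>R e"
  have lin: "linear ?f"
    by (intro linearI) (auto simp: inner_add_left algebra_simps)
  have [measurable]: "?f \<in> borel_measurable borel"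
    by (intro borel_measurable_continuous_onI continuous_intros)
  have "norm (?f x) = norm x" for x
  proof -
    have "(norm (?f x))\<^sup>2 = (norm x)\<^sup>2"
      by (simp add: power2_norm_eq_inner inner_diff_left inner_diff_right inner_unit inner_commute algebra_simps)
    then show ?thesis by (simp add: power2_eq_iff_nonneg)
  qed
  then have "distr lborel borel ?f = lborel" by (rule distr_lborel_linear_isometry[OF lin])
  then have "lborel = distr (distr lborel borel ?f) borel ((+) ((2 * t) *\<^sub>R e))"
    by (simp add: lborel_distr_plus)
  also have "\<dots> = distr lborel borel ((+) ((2 * t) *\<^sub>R e) \<circ> ?f)"
    by (rule distr_distr) auto
  also have "(+) ((2 * t) *\<^sub>R e) \<circ> ?f = hyper_reflect e t"
    by (auto simp: hyper_reflect_def fun_eq_iff algebra_simps)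
  finally show ?thesis ..
qed

lemma integral_hyper_reflect:
  fixes h :: "'a \<Rightarrow> real"
  assumes [measurable]: "h \<in> borel_measurable borel"
  shows "(LBINT x. h (hyper_reflect e t x)) = (LBINT x. h x)"
proof -
  have "(LBINT x. h x) = (\<integral>x. h x \<partial>distr lborel borel (hyper_reflect e t))"
    by (simp only: distr_hyper_reflect)
  also have "\<dots> = (LBINT x. h (hyper_reflect e t x))" by (rule integral_distr) auto
  finally show ?thesis ..
qed

lemma integrable_hyper_reflect:
  fixes h :: "'a \<Rightarrow> real"
  assumes "integrable lborel h"
  shows "integrable lborel (\<lambda>x. h (hyper_reflect e t x))"
proof -
  have "integrable (distr lborel borel (hyper_reflect e t)) h"
    using assms by (simp only: distr_hyper_reflect)
  then show ?thesis by (subst (asm) integrable_distr_eq) (use assms in auto)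
qed

lemma emeasure_hyper_reflect:
  assumes [measurable]: "A \<in> sets borel"
  shows "emeasure lborel (hyper_reflect e t -` A) = emeasure lborel A"
proof -
  have "emeasure lborel A = emeasure (distr lborel borel (hyper_reflect e t)) A"
    by (simp only: distr_hyper_reflect)
  also have "\<dots> = emeasure lborel (hyper_reflect e t -` A)" by (subst emeasure_distr) auto
  finally show ?thesis ..
qed

lemma potential_hyper_reflect:
  assumes [measurable]: "h \<in> borel_measurable borel"
  shows "potential \<alpha> (\<lambda>x. h (hyper_reflect e t x)) x = potential \<alpha> h (hyper_reflect e t x)"
proof -
  have "potential \<alpha> h (hyper_reflect e t x) = (LBINT y. riesz \<alpha> (hyper_reflect e t x) (hyper_reflect e t y) * h (hyper_reflect e t y))"
    unfolding potential_def
    by (rule integral_hyper_reflect[of "\<lambda>y. riesz \<alpha> (hyper_reflect e t x) y * h y", symmetric]) measurable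
  then show ?thesis by (simp add: potential_def riesz_hyper_reflect)
qed

lemma one_sided_measurable [measurable]: "E \<in> sets borel \<Longrightarrow> one_sided e t E \<in> sets borel"
proof -
  assume [measurable]: "E \<in> sets borel"
  have "one_sided e t E = {x. t \<le> x \<bullet> e} \<inter> E - hyper_reflect e t -` E"
    by (auto simp: one_sided_def)
  also have "\<dots> \<in> sets borel"
    using measurable_sets[OF hyper_reflect_measurable \<open>E \<in> sets borel\<close>] by auto
  finally show "one_sided e t E \<in> sets borel" .
qed

text \<open>A point of the hyperplane is its own mirror image, so \<open>E\<close> cannot contain
  one without the other.\<close>

lemma one_sided_interior: "x \<in> one_sided e t E \<Longrightarrow> t < x \<bullet> e"
  using hyper_reflect_fixed[of x] by (auto simp: one_sided_def less_le)

text \<open>The points of \<open>E\<close> whose image is also in \<open>E\<close> contribute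
  nothing. The others lie either in \<open>one_sided e t E\<close> or, on the far side, in the
  mirror image of \<open>one_sided e t (- E)\<close>, where antisymmetry reverses the sign.\<close>

lemma integral_antisymmetric:
  fixes h :: "'a \<Rightarrow> real"
  assumes E: "E \<in> sets borel" and h: "h \<in> borel_measurable borel" "\<And>x. h (hyper_reflect e t x) = - h x"
    and int: "integrable lborel (\<lambda>x. indicator E x * h x)"
  shows "(LBINT x. indicator E x * h x) =
    (LBINT x. indicator (one_sided e t E) x * h x) - (LBINT x. indicator (one_sided e t (- E)) x * h x)"
proof -
  let ?s = "hyper_reflect e t" and ?A = "one_sided e t E" and ?B = "one_sided e t (- E)"
  have [measurable]: "E \<in> sets borel" "h \<in> borel_measurable borel" "- E \<in> sets borel" using E h by auto
  have sub: "integrable lborel (\<lambda>x. indicator C x * h x)" if "C \<subseteq> E" "C \<in> sets borel" for C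
    by (rule Bochner_Integration.integrable_bound[OF int]) (use that h in \<open>auto simp: indicator_def\<close>)
  define S where "S = E \<inter> ?s -` E"
  define B' where "B' = ?s -` ?B"
  have [measurable]: "S \<in> sets borel" "B' \<in> sets borel"
    unfolding S_def B'_def using measurable_sets[OF hyper_reflect_measurable, of E] measurable_sets[OF hyper_reflect_measurable, of ?B] by auto
  have incl: "?A \<subseteq> E" "S \<subseteq> E" "B' \<subseteq> E" by (auto simp: one_sided_def S_def B'_def)
  have "indicator E x = (indicator ?A x + indicator S x + indicator B' x :: real)" for x
  proof -
    consider "t \<le> x \<bullet> e" | "t \<le> ?s x \<bullet> e" "\<not> t \<le> x \<bullet> e" by (auto simp: hyper_reflect_inner)
    then show ?thesis
    proof cases
      case 1
      have "x \<notin> B'" if "x \<in> E" "?s x \<notin> E"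
        using that 1 one_sided_interior[of "?s x" "- E"] by (auto simp: B'_def hyper_reflect_inner)
      moreover have "x \<in> E" if "x \<in> B'" using that incl by auto
      moreover have "?s x \<notin> E" if "x \<in> B'" using that by (auto simp: B'_def one_sided_def)
      ultimately show ?thesis using 1 by (auto simp: indicator_def one_sided_def S_def)
    next
      case 2
      then show ?thesis by (auto simp: indicator_def one_sided_def S_def B'_def)
    qed
  qed
  then have "(LBINT x. indicator E x * h x) = (LBINT x. indicator ?A x * h x + indicator S x * h x + indicator B' x * h x)"
    by (simp add: distrib_right)
  also have "\<dots> = (LBINT x. indicator ?A x * h x) + (LBINT x. indicator S x * h x) + (LBINT x. indicator B' x * h x)"
    using sub[OF incl(1)] sub[OF incl(2)] sub[OF incl(3)] by simp
  also have "(LBINT x. indicator S x * h x) = 0"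
  proof -
    have "(LBINT x. indicator S x * h x) = (LBINT x. indicator S (?s x) * h (?s x))"
      by (rule integral_hyper_reflect[symmetric]) measurable
    also have "\<dots> = (LBINT x. - (indicator S x * h x))"
      by (rule Bochner_Integration.integral_cong) (auto simp: h(2) S_def indicator_def)
    finally show ?thesis by simp
  qed
  also have "(LBINT x. indicator B' x * h x) = - (LBINT x. indicator ?B x * h x)"
  proof -
    have "(LBINT x. indicator B' x * h x) = (LBINT x. indicator B' (?s x) * h (?s x))"
      by (rule integral_hyper_reflect[symmetric]) measurable
    also have "\<dots> = (LBINT x. - (indicator ?B x * h x))"
      by (rule Bochner_Integration.integral_cong) (auto simp: h(2) B'_def indicator_def)
    finally show ?thesis by simp
  qed
  finally show ?thesis by simp
qed

text \<open>Reversing the orientation exchanges the two sides and with them the two one-sided parts.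
  This reduces every hyperplane to one with \<open>t \<le> 0\<close>.\<close>

lemma one_sided_uminus:
  "one_sided (- e) (- t) E = hyper_reflect e t -` one_sided e t (- E)"
  "one_sided (- e) (- t) (- E) = hyper_reflect e t -` one_sided e t E"
  by (auto simp: one_sided_def hyper_reflect_inner) (auto simp: hyper_reflect_def algebra_simps)

lemma bounded_vimage_hyper_reflect:
  "bounded E \<Longrightarrow> bounded (hyper_reflect e t -` E)"
proof -
  assume "bounded E"
  then obtain R where R: "\<And>x. x \<in> E \<Longrightarrow> dist (hyper_reflect e t 0) x \<le> R"
    using bounded_any_center[of E "hyper_reflect e t 0"] by auto
  have "dist 0 x \<le> R" if "x \<in> hyper_reflect e t -` E" for x
    using R[of "hyper_reflect e t x"] that by (simp add: dist_hyper_reflect)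
  then show ?thesis unfolding bounded_def by blast
qed

text \<open>Polarizing a minimizer does not increase the potential part and strictly lowers the interaction part
  unless the polarization changes nothing or is a reflection.\<close>

lemma polarization:
  fixes g :: "'a \<Rightarrow> real" and E :: "'a set"
  assumes \<sigma>: "- real DIM('a) < \<sigma>" "\<sigma> < 0" and g: "continuous_on UNIV g"
    and G: "mono_on {0..} G" "\<And>x. g x = G (norm x)" and "t \<le> 0"
    and E: "E \<in> sets borel" "bounded E"
    and min: "is_minimizer (limit_T \<sigma> g) (density lborel (indicator E))"
  shows "emeasure lborel (one_sided e t E) = 0 \<or> emeasure lborel (one_sided e t (- E)) = 0"
proof (rule ccontr)
  let ?s = "hyper_reflect e t" and ?A = "one_sided e t E" and ?B = "one_sided e t (- E)"
  define \<alpha> where "\<alpha> = real DIM('a) + \<sigma>"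
  have \<alpha>: "0 < \<alpha>" "\<alpha> < real DIM('a)" using \<sigma> by (auto simp: \<alpha>_def)
  assume "\<not> ?thesis"
  then have ne: "emeasure lborel ?A \<noteq> 0" "emeasure lborel ?B \<noteq> 0" by auto
  have [measurable]: "E \<in> sets borel" "- E \<in> sets borel" "g \<in> borel_measurable borel"
    using E borel_measurable_continuous_onI[OF g] by auto
  define B' where "B' = ?s -` ?B"
  have B'm [measurable]: "B' \<in> sets borel" unfolding B'_def using measurable_sets[OF hyper_reflect_measurable, of ?B] by auto
  have B'E: "B' \<subseteq> E" by (auto simp: B'_def one_sided_def)
  have bdB: "bounded ?B"
    by (rule bounded_subset[OF bounded_vimage_hyper_reflect[OF bounded_subset[OF E(2) B'E]]]) (auto simp: B'_def)
  obtain R where R: "E \<subseteq> cball 0 R" "?B \<subseteq> cball 0 R"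
  proof -
    have "bounded (E \<union> ?B)" using E(2) bdB by simp
    then obtain R where "\<forall>x\<in>E \<union> ?B. norm x \<le> R" unfolding bounded_iff by blast
    then show ?thesis by (intro that[of R]) auto
  qed
  have fin: "emeasure lborel C < \<infinity>" if "C \<subseteq> cball 0 R" for C
    using emeasure_bounded_finite[OF bounded_subset[OF bounded_cball that]] by simp
  have pE: "profile (indicator E :: 'a \<Rightarrow> real)" by (rule profile_indicator[OF E(1) fin[OF R(1)]])
  have pB: "profile (indicator ?B :: 'a \<Rightarrow> real)" by (rule profile_indicator[OF _ fin[OF R(2)]]) auto
  have pA: "profile (indicator ?A :: 'a \<Rightarrow> real)"
    by (rule profile_indicator[OF _ fin]) (use R(1) in \<open>auto simp: one_sided_def\<close>)
  have pB': "profile (indicator B' :: 'a \<Rightarrow> real)" by (rule profile_indicator[OF _ fin]) (use R(1) B'E in auto)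
  have iB': "indicator B' x = (indicator ?B (?s x) :: real)" for x by (simp add: B'_def indicator_def)
  \<comment> \<open>Polarization as a perturbation: the part \<open>B'\<close> of \<open>E\<close>
    is moved to its mirror image \<open>?B\<close>, which lies outside \<open>E\<close>.\<close>
  define \<phi> where "\<phi> x = (indicator ?B x - indicator B' x :: real)" for x
  have disj: "x \<notin> B'" if "x \<in> ?B" for x
    using one_sided_interior[OF that] one_sided_interior[of "?s x" "- E"] by (auto simp: B'_def hyper_reflect_inner)
  have \<phi>b: "0 \<le> indicator E x + \<phi> x" "indicator E x + \<phi> x \<le> 1" "\<bar>\<phi> x\<bar> \<le> 1" for x
    using B'E disj by (auto simp: \<phi>_def indicator_def one_sided_def)
  have p\<phi>: "profile \<phi>"
    using profileD(1,2)[OF pB] profileD(1,2)[OF pB'] \<phi>b(3) unfolding profile_def \<phi>_def by auto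
  have ig: "integrable lborel (\<lambda>x. h x * g x)" if "profile h" "\<And>x. h x \<noteq> 0 \<Longrightarrow> x \<in> cball 0 R" for h
    by (rule integrable_bounded_support[OF g that])
  have igE: "integrable lborel (\<lambda>x. indicator E x * g x)"
    by (rule ig[OF pE]) (use R in \<open>auto simp: indicator_def split: if_splits\<close>)
  have igB: "integrable lborel (\<lambda>x. indicator ?B x * g x)"
    by (rule ig[OF pB]) (use R in \<open>auto simp: indicator_def split: if_splits\<close>)
  have igB': "integrable lborel (\<lambda>x. indicator B' x * g x)"
    by (rule ig[OF pB']) (use R B'E in \<open>auto simp: indicator_def split: if_splits\<close>)
  have ig\<phi>: "integrable lborel (\<lambda>x. \<phi> x * g x)"
    unfolding \<phi>_def left_diff_distrib using igB igB' by simp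
  have dens: "density lborel (indicator E) = density lborel (\<lambda>x. ennreal (indicator E x))"
    by (simp add: ennreal_indicator)
  let ?U = "potential \<alpha> :: ('a \<Rightarrow> real) \<Rightarrow> _"
  define D where "D = ?U \<phi>"
  have D_eq: "D x = ?U (indicator ?B) x - ?U (indicator ?B) (?s x)" for x
  proof -
    have "D x = ?U (indicator ?B) x - ?U (indicator B') x"
      unfolding D_def \<phi>_def[abs_def] by (rule potential_diff[OF \<alpha> pB pB'])
    also have "?U (indicator B') x = ?U (indicator ?B) (?s x)"
      using potential_hyper_reflect[of "indicator ?B" \<alpha> x] by (simp add: iB'[abs_def] potential_def)
    finally show ?thesis .
  qed
  have Dm [measurable]: "D \<in> borel_measurable borel" unfolding D_def by (rule potential_measurable[OF \<alpha> p\<phi>])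
  have Danti: "D (?s x) = - D x" for x by (simp add: D_eq)
  have iD: "integrable lborel (\<lambda>x. f x * D x)" if "profile f" for f
    unfolding D_def by (rule integrable_mult_potential[OF \<alpha> that p\<phi>])
  have "0 \<le> (LBINT x. \<phi> x * (g x - 2 * ?U (indicator E) x)) - (LBINT x. \<phi> x * ?U \<phi> x)"
    using first_variation[OF \<sigma> _ pE _ igE min[unfolded dens] p\<phi> ig\<phi> \<phi>b(1,2)] by (simp add: \<alpha>_def)
  moreover have "(LBINT x. \<phi> x * (g x - 2 * ?U (indicator E) x)) = (LBINT x. \<phi> x * g x - 2 * (\<phi> x * ?U (indicator E) x))"
    by (rule Bochner_Integration.integral_cong) (auto simp: algebra_simps)
  moreover have "\<dots> = (LBINT x. \<phi> x * g x) - 2 * (LBINT x. indicator E x * D x)"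
    using ig\<phi> integrable_mult_potential[OF \<alpha> p\<phi> pE] potential_symmetric[OF \<alpha> p\<phi> pE] by (simp add: D_def)
  moreover have "(LBINT x. indicator E x * D x) = (LBINT x. indicator ?A x * D x) - (LBINT x. indicator ?B x * D x)"
    by (rule integral_antisymmetric[OF E(1) Dm Danti iD[OF pE]])
  moreover have "(LBINT x. \<phi> x * ?U \<phi> x) = 2 * (LBINT x. indicator ?B x * D x)"
  proof -
    have "(LBINT x. \<phi> x * ?U \<phi> x) = (LBINT x. indicator ?B x * D x - indicator B' x * D x)"
      by (simp add: D_def \<phi>_def left_diff_distrib)
    also have "\<dots> = (LBINT x. indicator ?B x * D x) - (LBINT x. indicator B' x * D x)"
      using iD[OF pB] iD[OF pB'] by simp
    also have "(LBINT x. indicator B' x * D x) = (LBINT x. indicator B' (?s x) * D (?s x))"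
      by (rule integral_hyper_reflect[symmetric]) measurable
    also have "\<dots> = - (LBINT x. indicator ?B x * D x)"
      by (simp add: iB' Danti)
    finally show ?thesis by simp
  qed
  moreover have "(LBINT x. \<phi> x * g x) \<le> 0"
  proof -
    have i: "integrable lborel (\<lambda>x. indicator ?B x * g (?s x))"
      using integrable_hyper_reflect[OF igB'] by (simp add: iB')
    have "(LBINT x. \<phi> x * g x) = (LBINT x. indicator ?B x * g x) - (LBINT x. indicator B' x * g x)"
      unfolding \<phi>_def left_diff_distrib using igB igB' by simp
    also have "(LBINT x. indicator B' x * g x) = (LBINT x. indicator B' (?s x) * g (?s x))"
      by (rule integral_hyper_reflect[symmetric]) measurable
    also have "\<dots> = (LBINT x. indicator ?B x * g (?s x))" by (simp add: iB')
    also have "(LBINT x. indicator ?B x * g x) \<le> \<dots>"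
    proof (rule integral_mono[OF igB i])
      fix x
      have "g x \<le> g (?s x)" if "x \<in> ?B"
      proof -
        \<comment> \<open>As \<open>t \<le> 0\<close>, the origin lies on the side of
          \<open>?B\<close>, so points of \<open>?B\<close> are no farther from it than their mirror
          images.\<close>
        have "0 \<le> (x \<bullet> e - t) * (0 - t)"
          using \<open>t \<le> 0\<close> one_sided_interior[OF that] by (intro mult_nonneg_nonneg) auto
        moreover have "(norm (?s x))\<^sup>2 = (norm x)\<^sup>2 + 4 * ((x \<bullet> e - t) * (0 - t))"
          using dist_hyper_reflect_left[of x 0] by simp
        ultimately have "(norm x)\<^sup>2 \<le> (norm (?s x))\<^sup>2" by linarith
        then have "norm x \<le> norm (?s x)" by (rule power2_le_imp_le) simp
        then show ?thesis unfolding G(2) by (intro mono_onD[OF G(1)]) auto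
      qed
      then show "indicator ?B x * g x \<le> indicator ?B x * g (?s x)" by (auto simp: indicator_def)
    qed
    finally show ?thesis by simp
  qed
  \<comment> \<open>The integral of \<open>D\<close> over \<open>?B\<close> enters the linear term
    as twice its value and the quadratic term as minus twice its value. It cancels, and with the
    sign of the potential part only the integral over \<open>?A\<close> is left.\<close>
  ultimately have le: "(LBINT x. indicator ?A x * D x) \<le> 0" by linarith
  have Dpos: "D x > 0" if x: "x \<in> ?A" for x
  proof -
    have i: "integrable lborel (\<lambda>y. indicator ?B y * riesz \<alpha> z y)" for z
      using integrable_riesz_profile[OF \<alpha> pB, of z] by (simp add: mult.commute)
    have xi: "t < x \<bullet> e" by (rule one_sided_interior[OF x])
    have str: "riesz \<alpha> (?s x) y < riesz \<alpha> x y" if "y \<in> ?B" for y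
    proof -
      have "0 < (x \<bullet> e - t) * (y \<bullet> e - t)" using xi one_sided_interior[OF that] by simp
      then have "(dist x y)\<^sup>2 < (dist (?s x) y)\<^sup>2" unfolding dist_hyper_reflect_left by simp
      then have lt: "dist x y < dist (?s x) y" by (rule power2_less_imp_less) simp
      moreover have "x \<noteq> y" using x that by (auto simp: one_sided_def)
      ultimately have "dist x y powr \<alpha> < dist (?s x) y powr \<alpha>" using \<alpha>(1) by (intro powr_less_mono2) auto
      moreover have "?s x \<noteq> y" using lt by auto
      ultimately show ?thesis unfolding riesz_def using \<open>x \<noteq> y\<close> by (intro divide_strict_left_mono mult_pos_pos) auto
    qed
    have "D x = (LBINT y. indicator ?B y * (riesz \<alpha> x y - riesz \<alpha> (?s x) y))"
      unfolding D_eq potential_def mult.commute[of "riesz _ _ _"] right_diff_distrib using i by simp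
    moreover have "integrable lborel (\<lambda>y. indicator ?B y * (riesz \<alpha> x y - riesz \<alpha> (?s x) y))"
      unfolding right_diff_distrib using i by simp
    ultimately show ?thesis
      using str ne(2) by (simp add: integral_indicator_pos)
  qed
  have "0 < (LBINT x. indicator ?A x * D x)"
    by (rule integral_indicator_pos[OF one_sided_measurable[OF E(1)] ne(1) Dpos iD[OF pA]])
  then show False using le by simp
qed

end

section \<open>Radial potentials\<close>

lemma emeasure_open_nonzero:
  fixes W :: "'a::euclidean_space set"
  assumes "open W" "W \<noteq> {}"
  shows "emeasure lborel W \<noteq> 0"
  using open_not_negligible[OF assms] assms(1) by (auto simp: negligible_iff_emeasure0)

text \<open>The alternative is symmetric in the two one-sided parts and therefore survives a change
  of orientation.\<close>

lemma polarization_any_side: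
  fixes g :: "'a::euclidean_space \<Rightarrow> real"
  assumes e: "norm e = 1" and \<sigma>: "- real DIM('a) < \<sigma>" "\<sigma> < 0" and g: "continuous_on UNIV g"
    and G: "mono_on {0..} G" "\<And>x. g x = G (norm x)"
    and E: "E \<in> sets borel" "bounded E"
    and min: "is_minimizer (limit_T \<sigma> g) (density lborel (indicator E))"
  shows "emeasure lborel (one_sided e t E) = 0 \<or> emeasure lborel (one_sided e t (- E)) = 0"
proof (cases "t \<le> 0")
  case True
  then show ?thesis by (rule polarization[OF e \<sigma> g G _ E min])
next
  case False
  have "emeasure lborel (one_sided (- e) (- t) E) = 0 \<or> emeasure lborel (one_sided (- e) (- t) (- E)) = 0"
    using False e by (intro polarization[OF _ \<sigma> g G _ E min]) auto
  moreover have "one_sided e t E \<in> sets borel" "one_sided e t (- E) \<in> sets borel"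
    using E(1) by (auto intro!: one_sided_measurable[OF e])
  ultimately show ?thesis
    unfolding one_sided_uminus[OF e] by (auto simp: emeasure_hyper_reflect[OF e])
qed

section \<open>The barycentre and the sides of a hyperplane\<close>

definition barycentre :: "'a::euclidean_space set \<Rightarrow> 'a" where
  "barycentre E = (1 / measure lborel E) *\<^sub>R (LBINT x. indicator E x *\<^sub>R x)"

lemma moment_half_space:
  fixes E :: "'a::euclidean_space set"
  assumes E: "E \<in> sets borel" "bounded E"
  shows "(LBINT x. indicator E x * (x \<bullet> e - t)) = measure lborel E * (barycentre E \<bullet> e - t)"
proof -
  have [measurable]: "E \<in> sets borel" by (rule E)
  have fin: "emeasure lborel E < \<infinity>" using emeasure_bounded_finite[OF E(2)] by simp
  obtain R where R: "\<And>x. x \<in> E \<Longrightarrow> norm x \<le> R" using E(2) by (auto simp: bounded_iff)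
  have i0: "integrable lborel (indicator E :: 'a \<Rightarrow> real)"
    by (rule profileD(2)[OF profile_indicator[OF E(1) fin]])
  have i1: "integrable lborel (\<lambda>x. indicator E x *\<^sub>R x)"
  proof (rule Bochner_Integration.integrable_bound[where f = "\<lambda>x. R * indicator E x"])
    show "AE x in lborel. norm (indicator E x *\<^sub>R x) \<le> norm (R * indicator E x :: real)"
      using R by (auto simp: indicator_def intro: order_trans[OF _ abs_ge_self])
  qed (use i0 in auto)
  have "(LBINT x. indicator E x * (x \<bullet> e - t)) = (LBINT x. (indicator E x *\<^sub>R x) \<bullet> e - t * indicator E x)"
    by (rule Bochner_Integration.integral_cong) (auto simp: algebra_simps)
  also have "\<dots> = (LBINT x. indicator E x *\<^sub>R x) \<bullet> e - t * measure lborel E"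
  proof (subst Bochner_Integration.integral_diff)
    show "integrable lborel (\<lambda>x. (indicator E x *\<^sub>R x) \<bullet> e)" by (rule integrable_inner_left[OF i1])
    show "integrable lborel (\<lambda>x. t * indicator E x)" using i0 by simp
    show "(LBINT x. (indicator E x *\<^sub>R x) \<bullet> e) - (LBINT x. t * indicator E x)
      = (LBINT x. indicator E x *\<^sub>R x) \<bullet> e - t * measure lborel E"
      unfolding integral_inner_left[OF i1] by simp
  qed
  also have "\<dots> = measure lborel E * (barycentre E \<bullet> e - t)"
  proof (cases "measure lborel E = 0")
    case True
    then have "emeasure lborel E = 0" using fin by (simp add: measure_eq_0_null_sets emeasure_eq_ennreal_measure less_top)
    then have "E \<in> null_sets lborel" by auto
    then have "AE x in lborel. x \<notin> E" by (rule AE_not_in)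
    then have "(LBINT x. indicator E x *\<^sub>R x) = 0"
      by (intro integral_eq_zero_AE) (auto elim!: eventually_mono)
    then show ?thesis using True by simp
  qed (simp add: barycentre_def algebra_simps)
  finally show ?thesis .
qed

text \<open>The signed distance to the hyperplane changes sign under reflection, so its integral
  over \<open>E\<close> is a difference of nonnegative integrals over the two one-sided parts. It is
  positive by the position of the barycentre, so \<open>one_sided e t E\<close> is not null, and the
  alternative leaves only the other part.\<close>

lemma one_sided_towards_barycentre:
  fixes E :: "'a::euclidean_space set"
  assumes e: "norm e = 1" and E: "E \<in> sets borel" "bounded E" "measure lborel E > 0"
    and alt: "emeasure lborel (one_sided e t E) = 0 \<or> emeasure lborel (one_sided e t (- E)) = 0"
    and "t < barycentre E \<bullet> e"
  shows "emeasure lborel (one_sided e t (- E)) = 0"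
proof (rule ccontr)
  assume "\<not> ?thesis"
  then have A: "emeasure lborel (one_sided e t E) = 0" using alt by simp
  have [measurable]: "one_sided e t E \<in> sets borel" using one_sided_measurable[OF e E(1)] .
  have fin: "emeasure lborel E < \<infinity>" using emeasure_bounded_finite[OF E(2)] by simp
  obtain R where R: "\<And>x. x \<in> E \<Longrightarrow> norm x \<le> R" using E(2) by (auto simp: bounded_iff)
  let ?q = "\<lambda>x. x \<bullet> e - t"
  have q: "continuous_on UNIV ?q" by (intro continuous_intros)
  have "integrable lborel (\<lambda>x. indicator E x * ?q x)"
    by (rule integrable_bounded_support[OF q profile_indicator[OF E(1) fin], of R])
      (use R in \<open>auto simp: indicator_def split: if_splits\<close>)
  then have "(LBINT x. indicator E x * ?q x) =
    (LBINT x. indicator (one_sided e t E) x * ?q x) - (LBINT x. indicator (one_sided e t (- E)) x * ?q x)"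
    by (intro integral_antisymmetric[OF e E(1)]) (auto simp: hyper_reflect_inner[OF e])
  moreover have "(LBINT x. indicator (one_sided e t E) x * ?q x) = 0"
  proof -
    have "one_sided e t E \<in> null_sets lborel" using A by auto
    then have "AE x in lborel. x \<notin> one_sided e t E" by (rule AE_not_in)
    then show ?thesis by (intro integral_eq_zero_AE) (auto elim!: eventually_mono)
  qed
  moreover have "(LBINT x. indicator (one_sided e t (- E)) x * ?q x) \<ge> 0"
    by (intro integral_nonneg_AE AE_I2) (auto simp: indicator_def one_sided_def)
  moreover have "measure lborel E * (barycentre E \<bullet> e - t) > 0" using assms by simp
  ultimately show False unfolding moment_half_space[OF E(1,2)] by linarith
qed

text \<open>The mirror image in the bisector of \<open>x\<close> and \<open>y\<close> would carry a neighbourhood of \<open>x\<close> in \<open>E\<close> to a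
  neighbourhood of \<open>y\<close> outside \<open>E\<close>, on the side of the barycentre.\<close>

lemma closer_points_inside:
  fixes E :: "'a::euclidean_space set"
  assumes E: "E \<in> sets borel" "bounded E" "measure lborel E > 0"
    and alt: "\<And>e t. norm e = 1 \<Longrightarrow> emeasure lborel (one_sided e t E) = 0 \<or> emeasure lborel (one_sided e t (- E)) = 0"
    and O: "open O1" "O1 \<subseteq> E" "open O2" "O2 \<subseteq> - E" and x: "x \<in> O1" and y: "y \<in> O2"
  shows "dist x (barycentre E) \<le> dist y (barycentre E)"
proof (rule ccontr)
  let ?c = "barycentre E"
  assume "\<not> ?thesis"
  then have lt: "dist y ?c < dist x ?c" by simp
  then have ne: "x \<noteq> y" by auto
  define n where "n = norm (y - x)"
  have n: "n > 0" using ne by (simp add: n_def)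
  \<comment> \<open>Normal and offset of the bisector of \<open>x\<close> and \<open>y\<close>,
    oriented so that \<open>y\<close> lies on the positive side. Being closer to \<open>y\<close>,
    the barycentre lies there too.\<close>
  define e where "e = (1 / n) *\<^sub>R (y - x)"
  define t where "t = ((1 / 2) *\<^sub>R (x + y)) \<bullet> e"
  have e: "norm e = 1" using n by (simp add: e_def n_def)
  have ne_eq: "n *\<^sub>R e = y - x" using n by (simp add: e_def)
  have yt: "y \<bullet> e - t = n / 2"
  proof -
    have "y \<bullet> e - t = (1 / 2) * ((y - x) \<bullet> e)" by (simp add: t_def inner_diff_left inner_add_left algebra_simps)
    also have "(y - x) \<bullet> e = n" unfolding ne_eq[symmetric] using inner_unit[OF e] by simp
    finally show ?thesis by simp
  qed
  have refl: "hyper_reflect e t y = x"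
    unfolding hyper_reflect_def yt using ne_eq by simp
  have ct: "t < ?c \<bullet> e"
  proof -
    have "(dist x ?c)\<^sup>2 = (dist y ?c)\<^sup>2 + 4 * ((y \<bullet> e - t) * (?c \<bullet> e - t))"
      using dist_hyper_reflect_left[OF e, of t y ?c] refl by simp
    moreover have "(dist y ?c)\<^sup>2 < (dist x ?c)\<^sup>2" using lt by (intro power_strict_mono) auto
    ultimately have "0 < (y \<bullet> e - t) * (?c \<bullet> e - t)" by linarith
    then show ?thesis using n unfolding yt by (simp add: zero_less_mult_iff)
  qed
  define W where "W = O2 \<inter> hyper_reflect e t -` O1 \<inter> {z. t < z \<bullet> e}"
  have "open W"
    unfolding W_def using O continuous_hyper_reflect[OF e, of t]
    by (intro open_Int open_vimage) (auto simp: open_halfspace_gt inner_commute[of _ e])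
  moreover have "y \<in> W" using x y yt n by (simp add: W_def refl)
  ultimately have "emeasure lborel W \<noteq> 0"
    by (intro emeasure_open_nonzero) auto
  moreover have "W \<subseteq> one_sided e t (- E)" using O by (auto simp: W_def one_sided_def)
  moreover have "emeasure lborel (one_sided e t (- E)) = 0"
    by (rule one_sided_towards_barycentre[OF e E alt[OF e] ct])
  moreover have "one_sided e t (- E) \<in> sets borel" by (rule one_sided_measurable[OF e]) (use E in auto)
  ultimately show False using emeasure_mono[of W "one_sided e t (- E)" lborel] by auto
qed

lemma sphere_null: "cball c r - ball c r \<in> null_sets lborel" if "r \<ge> 0" for c :: "'a::euclidean_space"
proof -
  have "emeasure lborel (cball c r - ball c r) = emeasure lborel (cball c r) - emeasure lborel (ball c r)"
    using that by (intro emeasure_Diff) (auto simp: emeasure_ball)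
  then show ?thesis using that by (auto simp: emeasure_ball emeasure_cball)
qed

text \<open>With \<open>r\<close> the supremum of the distances from the barycentre to points of
  \<open>E\<close>, the closed ball contains \<open>E\<close> and the open ball misses the points
  with \<open>0 < v x\<close>. The symmetric difference is thus confined to a sphere and the null
  set where \<open>v\<close> vanishes.\<close>

lemma minimizer_is_ball:
  fixes g :: "'a::euclidean_space \<Rightarrow> real"
  assumes \<sigma>: "- real DIM('a) < \<sigma>" "\<sigma> < 0" and g: "continuous_on UNIV g"
    and G: "mono_on {0..} G" "\<And>x. g x = G (norm x)"
    and E: "E \<in> sets borel" "bounded E"
    and min: "is_minimizer (limit_T \<sigma> g) (density lborel (indicator E))"
    and E_eq: "E = {x. g x < 2 * potential (real DIM('a) + \<sigma>) (indicator E) x}"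
    and ae: "AE x in lborel. g x \<noteq> 2 * potential (real DIM('a) + \<sigma>) (indicator E) x"
  shows "\<exists>c r. sym_diff E (ball c r) \<in> null_sets lborel"
proof (cases "E = {}")
  case True
  then show ?thesis by (intro exI[of _ 0] exI[of _ 0]) simp
next
  case False
  have \<alpha>: "0 < real DIM('a) + \<sigma>" "real DIM('a) + \<sigma> < real DIM('a)" using \<sigma> by auto
  have fin: "emeasure lborel E < \<infinity>" using emeasure_bounded_finite[OF E(2)] by simp
  define v where "v x = g x - 2 * potential (real DIM('a) + \<sigma>) (indicator E) x" for x
  have v: "continuous_on UNIV v"
    unfolding v_def by (intro continuous_intros g continuous_potential[OF \<alpha> profile_indicator[OF E(1) fin]])
  have Ev: "E = {x. v x < 0}" using E_eq by (simp add: v_def)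
  have op: "open E" "open {x. 0 < v x}"
    unfolding Ev using v by (auto intro!: open_Collect_less continuous_intros)
  have "emeasure lborel E \<noteq> 0"
    by (rule emeasure_open_nonzero[OF op(1) False])
  then have pos: "measure lborel E > 0" using fin by (simp add: measure_def enn2real_positive_iff zero_less_iff_neq_zero less_top)
  let ?c = "barycentre E"
  have key: "dist x ?c \<le> dist y ?c" if "x \<in> E" "0 < v y" for x y
    by (rule closer_points_inside[OF E pos polarization_any_side[OF _ \<sigma> g G E min] op(1) _ op(2)])
      (use that in \<open>auto simp: Ev\<close>)
  obtain R where R: "\<And>x. x \<in> E \<Longrightarrow> dist x ?c \<le> R"
    using E(2) bounded_any_center[of E ?c] by (auto simp: dist_commute)
  define r where "r = (SUP x\<in>E. dist x ?c)"
  have up: "dist x ?c \<le> r" if "x \<in> E" for x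
    unfolding r_def using that R by (intro cSUP_upper bdd_aboveI2[where M = R]) auto
  have low: "r \<le> dist y ?c" if "0 < v y" for y
    unfolding r_def using False key[OF _ that] by (intro cSUP_least) auto
  have "r \<ge> 0" using False up zero_le_dist order_trans by blast
  have N: "{x. v x = 0} \<in> null_sets lborel"
  proof -
    have [measurable]: "v \<in> borel_measurable borel" using v by (rule borel_measurable_continuous_onI)
    have "{x. v x = 0} \<in> sets lborel" by simp
    moreover have "AE x in lborel. x \<notin> {x. v x = 0}" using ae by (simp add: v_def)
    ultimately show ?thesis by (simp add: AE_iff_null_sets)
  qed
  have "sym_diff E (ball ?c r) \<subseteq> (cball ?c r - ball ?c r) \<union> {x. v x = 0}"
  proof
    fix x assume x: "x \<in> sym_diff E (ball ?c r)"
    show "x \<in> (cball ?c r - ball ?c r) \<union> {x. v x = 0}"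
    proof (cases "x \<in> E")
      case True
      then show ?thesis using x up[OF True] by (auto simp: dist_commute)
    next
      case False
      then have "dist x ?c < r" "\<not> v x < 0" using x by (auto simp: Ev dist_commute)
      then show ?thesis using low[of x] by force
    qed
  qed
  moreover have "(cball ?c r - ball ?c r) \<union> {x. v x = 0} \<in> null_sets lborel"
    by (intro null_sets.Un sphere_null \<open>r \<ge> 0\<close> N)
  moreover have "sym_diff E (ball ?c r) \<in> sets lborel" using E(1) by auto
  ultimately have "sym_diff E (ball ?c r) \<in> null_sets lborel" by (rule null_sets_subset[rotated 2])
  then show ?thesis by blast
qed

text \<open>A bounded potential cannot offset the growth of \<open>g\<close>. Boundedness of
  \<open>E\<close> is what gives it a barycentre and makes polarization an admissible
  perturbation.\<close>

lemma bounded_sublevel: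
  fixes g U :: "'a::euclidean_space \<Rightarrow> real"
  assumes "\<sigma> < 0" "C2 > 0" "\<And>x. C1 + C2 * norm x powr (- \<sigma>) \<le> g x" "\<And>x. \<bar>U x\<bar> \<le> P"
  shows "bounded {x. g x < 2 * U x}"
proof -
  define K where "K = max 0 ((2 * P - C1) / C2)"
  have "norm x \<le> K powr (1 / (- \<sigma>))" if "g x < 2 * U x" for x
  proof (rule ccontr)
    assume "\<not> ?thesis"
    then have "(K powr (1 / (- \<sigma>))) powr (- \<sigma>) < norm x powr (- \<sigma>)"
      using assms(1) by (intro powr_less_mono2) auto
    then have "K < norm x powr (- \<sigma>)" using assms(1) by (simp add: powr_powr K_def)
    then have "(2 * P - C1) / C2 < norm x powr (- \<sigma>)" by (simp add: K_def)
    then have "2 * P - C1 < C2 * norm x powr (- \<sigma>)" using assms(2) by (simp add: divide_less_eq mult.commute)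
    then show False using that assms(3)[of x] assms(4)[of x] by linarith
  qed
  then show ?thesis by (auto simp: bounded_iff)
qed

theorem theorem3p6:
  fixes \<sigma> Cstar :: real
    and g :: "'a::euclidean_space \<Rightarrow> real"
    and \<mu> :: "real \<Rightarrow> 'a measure"
  assumes "- real DIM('a) < \<sigma>" and "\<sigma> < 0"
    and "compactness_constant TYPE('a) \<sigma> Cstar"
    and "confining \<sigma> Cstar g"
    and "\<And>\<epsilon>. 0 < \<epsilon> \<Longrightarrow> \<epsilon> < 1 \<Longrightarrow> is_minimizer (discrete_T \<sigma> g \<epsilon>) (\<mu> \<epsilon>)"
  shows "\<exists>E \<in> sets borel. emeasure lborel E < \<infinity> \<and>
    subseq_tightly_converges (\<lambda>\<epsilon>. rescaled \<epsilon> (\<mu> \<epsilon>)) (density lborel (indicator E)) \<and>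
    is_minimizer (limit_T \<sigma> g) (density lborel (indicator E)) \<and>
    ((\<exists>G :: real \<Rightarrow> real. mono_on {0..} G \<and> (\<forall>x. g x = G (norm x))) \<longrightarrow>
       (\<exists>c r. sym_diff E (ball c r) \<in> null_sets lborel))"
proof -
  note \<sigma> = assms(1,2) and min = assms(5)
  have \<alpha>: "0 < real DIM('a) + \<sigma>" "real DIM('a) + \<sigma> < real DIM('a)" using \<sigma> by auto
  obtain C1 C2 where g: "continuous_on UNIV g" and C2: "C2 > Cstar"
    and growth: "\<And>x. C1 + C2 * norm x powr (- \<sigma>) \<le> g x"
    using assms(4) by (auto simp: confining_def)
  \<comment> \<open>Positivity makes \<open>g\<close> bounded below and, later, its sublevel sets
    bounded.\<close>
  have "Cstar > 0" using assms(3) by (simp add: compactness_constant_def)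
  then have C2': "C2 > 0" using C2 by simp
  have gl: "C1 \<le> g x" for x
  proof -
    have "0 \<le> C2 * norm x powr (- \<sigma>)" using C2' by simp
    then show ?thesis using growth[of x] by linarith
  qed
  have gm: "g \<in> borel_measurable borel" by (rule borel_measurable_continuous_onI[OF g])
  have "discrete_T \<sigma> g \<epsilon> (\<mu> \<epsilon>) \<le> 0" if "\<epsilon> \<in> {0<..<1}" for \<epsilon>
    using that by (intro discrete_minimizer(2)[OF _ gm min]) auto
  then have "(SUP \<epsilon>\<in>{0<..<1}. discrete_T \<sigma> g \<epsilon> (\<mu> \<epsilon>)) \<le> 0" by (rule SUP_least)
  then have "(SUP \<epsilon>\<in>{0<..<1}. discrete_T \<sigma> g \<epsilon> (\<mu> \<epsilon>)) < \<infinity>" by (rule le_less_trans) simp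
  moreover have "\<forall>\<epsilon>\<in>{0<..<1}. \<mu> \<epsilon> \<in> finite_borel_measures"
    using min by (auto simp: is_minimizer_def)
  ultimately obtain \<rho> :: "'a \<Rightarrow> real" where \<rho>: "integrable lborel \<rho>" "\<And>x. \<rho> x \<in> {0..1}"
    and conv: "subseq_tightly_converges (\<lambda>\<epsilon>. rescaled \<epsilon> (\<mu> \<epsilon>)) (density lborel (\<lambda>x. ennreal (\<rho> x)))"
    using assms(3,4) unfolding compactness_constant_def by blast
  let ?M = "density lborel (\<lambda>x. ennreal (\<rho> x))"
  have [measurable]: "\<rho> \<in> borel_measurable borel" using \<rho>(1) by auto
  have \<rho>0: "0 \<le> \<rho> x" for x using \<rho>(2)[of x] by simp
  have p\<rho>: "profile \<rho>" using \<rho> \<rho>0 by (auto simp: profile_def)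
  have M: "sub_lebesgue ?M" by (rule sub_lebesgue_density[OF p\<rho> \<rho>0])
  obtain e where e: "\<And>n. e n \<in> {0<..<1}" "e \<longlonglongrightarrow> 0"
    and tight: "tightly_converges (\<lambda>n. rescaled (e n) (\<mu> (e n))) ?M"
    using conv by (auto simp: subseq_tightly_converges_def)
  have e0: "e n > 0" and mine: "is_minimizer (discrete_T \<sigma> g (e n)) (\<mu> (e n))" for n
    using e(1)[of n] min[of "e n"] by auto
  note LM = limit_minimality[OF \<sigma> g gl e0 e(2) mine M tight]
  have "integrable lborel (\<lambda>x. \<rho> x * g x)"
    using LM(1) \<rho>0 gm by (subst (asm) integrable_density) auto
  then obtain E where E: "E \<in> sets borel" "emeasure lborel E < \<infinity>"
    "?M = density lborel (indicator E)"
    "E = {x. g x < 2 * potential (real DIM('a) + \<sigma>) (indicator E) x}"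
    "AE x in lborel. g x \<noteq> 2 * potential (real DIM('a) + \<sigma>) (indicator E) x"
    by (rule minimizer_is_indicator[OF \<sigma> g p\<rho> \<rho>0 _ LM(2)])
  have min': "is_minimizer (limit_T \<sigma> g) (density lborel (indicator E))" using LM(2) E(3) by simp
  obtain P where P: "\<And>x. \<bar>potential (real DIM('a) + \<sigma>) (indicator E) x\<bar> \<le> P"
    using potential_bounded[OF \<alpha> profile_indicator[OF E(1,2)]] by metis
  have "bounded {x. g x < 2 * potential (real DIM('a) + \<sigma>) (indicator E) x}"
    by (rule bounded_sublevel[OF \<sigma>(2) C2' growth P])
  then have bE: "bounded E" by (subst E(4))
  have "\<exists>c r. sym_diff E (ball c r) \<in> null_sets lborel"
    if "mono_on {0..} G" "\<forall>x. g x = G (norm x)" for G :: "real \<Rightarrow> real"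
    by (rule minimizer_is_ball[OF \<sigma> g that(1) _ E(1) bE min' E(4,5)]) (use that(2) in blast)
  then have "(\<exists>G :: real \<Rightarrow> real. mono_on {0..} G \<and> (\<forall>x. g x = G (norm x))) \<longrightarrow>
      (\<exists>c r. sym_diff E (ball c r) \<in> null_sets lborel)" by blast
  then show ?thesis using conv[unfolded E(3)] min' E(1,2) by (intro bexI[of _ E] conjI) assumption+
qed

end
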